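(* For ergodic $r$-discrete measured groupoids, property $T$ is invariant under similarity: if $(G_1,C_1)$ and $(G_2,C_2)$ are similar ergodic $r$-discrete measured groupoids, then $(G_1,C_1)$ has property $T$ if and only if $(G_2,C_2)$ has property $T$.
   Context: Conventions: Borel spaces are standard, Hilbert spaces are separable. For a groupoid $G$: $G^{(0)}$ is the unit space, $r,s:G\to G^{(0)}$ the range and source maps, $G^x=r^{-1}(x)$; for $A\subset G^{(0)}$, $G|_A=\{\gamma: r(\gamma)\in A,\ s(\gamma)\in A\}$, and $A$ is invariant if $s(r^{-1}(A))=A$. A Borel groupoid is a groupoid with a Borel structure for which all operations are Borel. A measure class $C$ on $G$ is symmetric if each $\nu\in C$ is equivalent to its image under inversion; it is invariant if some probability measure $\nu\in C$ has a disintegration $(\nu^x)$ along $r$ with $\gamma\nu^{s(\gamma)}$ equivalent to $\nu^{r(\gamma)}$ for almost every $\gamma$. A measured groupoid is a pair $(G,C)$ with $G$ a Borel groupoid and $C$ a symmetric invariant measure class; $r(C)$ is the class of $r_*\nu$, $\nu\in C$ a probability measure. "Null, conull" in $G^{(0)}$ refer to $r(C)$. An inessential reduction is $(G|_U,C|_U)$ with $U\subset G^{(0)}$ conull Borel. $(G,C)$ is ergodic if every invariant Borel subset of $G^{(0)}$ is null or conull. It is $r$-discrete if for some inessential reduction all fibres $G^x$ are countable. Let $(G_1,C_1),(G_2,C_2)$ be $r$-discrete measured groupoids. A strict homomorphism $\varphi:(G_1,C_1)\to(G_2,C_2)$ is a Borel groupoid homomorphism whose restriction $\tilde\varphi:G_1^{(0)}\to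 G_2^{(0)}$ satisfies: $\tilde\varphi^{-1}(E)$ is $r(C_1)$-null for every $r(C_2)$-null Borel set $E$. A homomorphism is a Borel map $G_1\to G_2$ whose restriction to some inessential reduction of $(G_1,C_1)$ is a strict homomorphism. Two homomorphisms $\varphi,\psi$ are similar, $\varphi\sim\psi$, if there are an inessential reduction $G_1|_U$ on which both are strict and a Borel map $\theta:U\to G_2$ such that $\theta(r(\gamma))\varphi(\gamma)$ and $\psi(\gamma)\theta(s(\gamma))$ are defined and equal for all $\gamma\in G_1|_U$. The groupoids $(G_1,C_1)$ and $(G_2,C_2)$ are similar if there are homomorphisms $\varphi:(G_1,C_1)\to(G_2,C_2)$ and $\psi:(G_2,C_2)\to(G_1,C_1)$ with $\varphi\circ\psi\sim\mathrm{id}_{G_2}$ and $\psi\circ\varphi\sim\mathrm{id}_{G_1}$. A Hilbert bundle over a Borel space is a Borel field of separable (here complex) Hilbert spaces; sections are Borel. A representation of $(G,C)$ in a Hilbert bundle $\mathcal{H}$ over $G^{(0)}$ is a Borel map $\gamma\mapsto L(\gamma)$, with $L(\gamma):\mathcal{H}(s(\gamma))\to\mathcal{H}(r(\gamma))$ a Hilbert space isomorphism, such that on some inessential reduction $L(\gamma_1\gamma_2)=L(\gamma_1)L(\gamma_2)$ for all composable pairs. A unit section is a Borel section $\xi$ of $\mathcal{H}$ with $\|\xi(x)\|=1$ a.e. $L$ almost contains unit invariant sections if there is a sequence $(\xi_n)$ of unit sections with $\|\xi_n(r(\gamma))-L(\gamma)\xi_n(s(\gamma))\|\to 0$ for $C$-a.e.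 $\gamma$; $L$ contains a unit invariant section if there is a unit section $\xi$ with $\xi(r(\gamma))=L(\gamma)\xi(s(\gamma))$ for $C$-a.e. $\gamma$. $(G,C)$ has property $T$ if every representation that almost contains unit invariant sections contains a unit invariant section.
   Formalization: Invariance of C is required for all γ in some inessential reduction rather than for C-almost every γ; read literally the claim fails for Z with the class of a point mass at 0 versus Z with the class of counting measure. *)

theory Defs
  imports "HOL-Probability.Probability"
begin

section \<open>Borel groupoids\<close>

text \<open>Throughout, a Borel space is a value of type \<^typ>\<open>'a measure\<close> of which only the underlying set
  and the \<open>\<sigma>\<close>-algebra are used.\<close>

definition standard_borel_space :: "'a measure \<Rightarrow> bool" where
  "standard_borel_space M \<longleftrightarrow>
     (\<exists>X. completely_metrizable_space X \<and> second_countable X \<and> topspace X = space M \<and>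
          sets M = sigma_sets (topspace X) {U. openin X U})"

text \<open>Units are identified with the corresponding identity arrows, so range and source take values
  in the arrows. The multiplication is only meaningful on composable pairs.\<close>

record 'a groupoid =
  borel_of :: "'a measure"
  rng :: "'a \<Rightarrow> 'a"
  src :: "'a \<Rightarrow> 'a"
  mul :: "'a \<Rightarrow> 'a \<Rightarrow> 'a"
  ginv :: "'a \<Rightarrow> 'a"

definition arrows :: "'a groupoid \<Rightarrow> 'a set" where
  "arrows G = space (borel_of G)"

definition units :: "'a groupoid \<Rightarrow> 'a set" where
  "units G = {x \<in> arrows G. rng G x = x}"

definition unit_space :: "'a groupoid \<Rightarrow> 'a measure" where
  "unit_space G = restrict_space (borel_of G) (units G)"

definition composable :: "'a groupoid \<Rightarrow> ('a \<times> 'a) set" where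
  "composable G = {(\<gamma>, \<eta>). \<gamma> \<in> arrows G \<and> \<eta> \<in> arrows G \<and> src G \<gamma> = rng G \<eta>}"

definition range_fibre :: "'a groupoid \<Rightarrow> 'a \<Rightarrow> 'a set" where
  "range_fibre G x = {\<gamma> \<in> arrows G. rng G \<gamma> = x}"

definition is_groupoid :: "'a groupoid \<Rightarrow> bool" where
  "is_groupoid G \<longleftrightarrow>
     (\<forall>\<gamma>\<in>arrows G. rng G \<gamma> \<in> units G \<and> src G \<gamma> \<in> units G) \<and>
     (\<forall>x\<in>units G. src G x = x) \<and>
     (\<forall>(\<gamma>, \<eta>)\<in>composable G. mul G \<gamma> \<eta> \<in> arrows G \<and>
        rng G (mul G \<gamma> \<eta>) = rng G \<gamma> \<and> src G (mul G \<gamma> \<eta>) = src G \<eta>) \<and>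
     (\<forall>\<gamma> \<eta> \<zeta>. (\<gamma>, \<eta>) \<in> composable G \<longrightarrow> (\<eta>, \<zeta>) \<in> composable G \<longrightarrow>
        mul G (mul G \<gamma> \<eta>) \<zeta> = mul G \<gamma> (mul G \<eta> \<zeta>)) \<and>
     (\<forall>\<gamma>\<in>arrows G. mul G (rng G \<gamma>) \<gamma> = \<gamma> \<and> mul G \<gamma> (src G \<gamma>) = \<gamma>) \<and>
     (\<forall>\<gamma>\<in>arrows G. ginv G \<gamma> \<in> arrows G \<and>
        rng G (ginv G \<gamma>) = src G \<gamma> \<and> src G (ginv G \<gamma>) = rng G \<gamma> \<and>
        mul G \<gamma> (ginv G \<gamma>) = rng G \<gamma> \<and> mul G (ginv G \<gamma>) \<gamma> = src G \<gamma>)"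

definition borel_groupoid :: "'a groupoid \<Rightarrow> bool" where
  "borel_groupoid G \<longleftrightarrow>
     is_groupoid G \<and>
     standard_borel_space (borel_of G) \<and>
     rng G \<in> borel_of G \<rightarrow>\<^sub>M borel_of G \<and>
     src G \<in> borel_of G \<rightarrow>\<^sub>M borel_of G \<and>
     ginv G \<in> borel_of G \<rightarrow>\<^sub>M borel_of G \<and>
     (\<lambda>(\<gamma>, \<eta>). mul G \<gamma> \<eta>)
        \<in> restrict_space (borel_of G \<Otimes>\<^sub>M borel_of G) (composable G) \<rightarrow>\<^sub>M borel_of G"

definition reduced_arrows :: "'a groupoid \<Rightarrow> 'a set \<Rightarrow> 'a set" where
  "reduced_arrows G A = {\<gamma> \<in> arrows G. rng G \<gamma> \<in> A \<and> src G \<gamma> \<in> A}"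

definition reduction :: "'a groupoid \<Rightarrow> 'a set \<Rightarrow> 'a groupoid" where
  "reduction G A = G\<lparr>borel_of := restrict_space (borel_of G) (reduced_arrows G A)\<rparr>"

definition invariant_set :: "'a groupoid \<Rightarrow> 'a set \<Rightarrow> bool" where
  "invariant_set G A \<longleftrightarrow> A \<subseteq> units G \<and> src G ` {\<gamma> \<in> arrows G. rng G \<gamma> \<in> A} = A"


section \<open>Measured groupoids\<close>

definition equivalent_measures :: "'a measure \<Rightarrow> 'a measure \<Rightarrow> bool" where
  "equivalent_measures \<mu> \<nu> \<longleftrightarrow>
     sets \<mu> = sets \<nu> \<and> absolutely_continuous \<mu> \<nu> \<and> absolutely_continuous \<nu> \<mu>"

definition class_of :: "'a measure \<Rightarrow> 'a measure set" where
  "class_of \<nu> = {\<mu>. sigma_finite_measure \<mu> \<and> equivalent_measures \<mu> \<nu>}"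

definition measure_class :: "'a measure \<Rightarrow> 'a measure set \<Rightarrow> bool" where
  "measure_class M C \<longleftrightarrow>
     (\<exists>\<nu>. sigma_finite_measure \<nu> \<and> sets \<nu> = sets M \<and> C = class_of \<nu>)"

definition ae_class :: "'a measure set \<Rightarrow> ('a \<Rightarrow> bool) \<Rightarrow> bool" where
  "ae_class C P \<longleftrightarrow> (\<forall>\<nu>\<in>C. AE x in \<nu>. P x)"

definition range_measure :: "'a groupoid \<Rightarrow> 'a measure \<Rightarrow> 'a measure" where
  "range_measure G \<nu> = distr \<nu> (unit_space G) (rng G)"

text \<open>The class \<open>r(C)\<close> on the unit space; all members of the union coincide when \<open>C\<close> is a measure class.\<close>

definition range_class :: "'a groupoid \<Rightarrow> 'a measure set \<Rightarrow> 'a measure set" where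
  "range_class G C = (\<Union>\<nu>\<in>{\<nu> \<in> C. prob_space \<nu>}. class_of (range_measure G \<nu>))"

definition null_units :: "'a groupoid \<Rightarrow> 'a measure set \<Rightarrow> 'a set \<Rightarrow> bool" where
  "null_units G C E \<longleftrightarrow> (\<forall>\<mu>\<in>range_class G C. E \<in> null_sets \<mu>)"

definition conull_units :: "'a groupoid \<Rightarrow> 'a measure set \<Rightarrow> 'a set \<Rightarrow> bool" where
  "conull_units G C U \<longleftrightarrow> U \<in> sets (unit_space G) \<and> null_units G C (units G - U)"

definition symmetric_class :: "'a groupoid \<Rightarrow> 'a measure set \<Rightarrow> bool" where
  "symmetric_class G C \<longleftrightarrow>
     (\<forall>\<nu>\<in>C. equivalent_measures \<nu> (distr \<nu> (borel_of G) (ginv G)))"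

definition range_disintegration :: "'a groupoid \<Rightarrow> 'a measure \<Rightarrow> ('a \<Rightarrow> 'a measure) \<Rightarrow> bool" where
  "range_disintegration G \<nu> K \<longleftrightarrow>
     K \<in> unit_space G \<rightarrow>\<^sub>M prob_algebra (borel_of G) \<and>
     (\<forall>x\<in>units G. AE \<gamma> in K x. \<gamma> \<in> range_fibre G x) \<and>
     (\<forall>E\<in>sets (borel_of G). emeasure \<nu> E = (\<integral>\<^sup>+ x. emeasure (K x) E \<partial>range_measure G \<nu>))"

text \<open>The measure \<open>\<gamma>\<mu>\<close>, for \<open>\<mu>\<close> carried by the range fibre of \<open>s(\<gamma>)\<close>.\<close>

definition translate :: "'a groupoid \<Rightarrow> 'a \<Rightarrow> 'a measure \<Rightarrow> 'a measure" where
  "translate G \<gamma> \<mu> =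
     distr (restrict_space \<mu> (range_fibre G (src G \<gamma>))) (borel_of G) (mul G \<gamma>)"

text \<open>``For almost every \<open>\<gamma>\<close>'' in the invariance condition is understood, following Ramsay and Hahn,
  as: for all \<open>\<gamma>\<close> in some inessential reduction. Requiring it only outside a \<open>C\<close>-null set of arrows
  would be too weak: the Dirac mass at the neutral element of a countable group would then
  define an invariant class, although it does not see the rest of the group.\<close>

definition invariant_class :: "'a groupoid \<Rightarrow> 'a measure set \<Rightarrow> bool" where
  "invariant_class G C \<longleftrightarrow>
     (\<exists>\<nu>\<in>C. \<exists>K. prob_space \<nu> \<and> range_disintegration G \<nu> K \<and>
        (\<exists>U. conull_units G C U \<and>
           (\<forall>\<gamma>\<in>reduced_arrows G U.
              equivalent_measures (translate G \<gamma> (K (src G \<gamma>))) (K (rng G \<gamma>)))))"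

definition measured_groupoid :: "'a groupoid \<Rightarrow> 'a measure set \<Rightarrow> bool" where
  "measured_groupoid G C \<longleftrightarrow>
     borel_groupoid G \<and> measure_class (borel_of G) C \<and> symmetric_class G C \<and> invariant_class G C"

definition reduction_class :: "'a groupoid \<Rightarrow> 'a measure set \<Rightarrow> 'a set \<Rightarrow> 'a measure set" where
  "reduction_class G C U = (\<lambda>\<nu>. restrict_space \<nu> (reduced_arrows G U)) ` C"

definition ergodic :: "'a groupoid \<Rightarrow> 'a measure set \<Rightarrow> bool" where
  "ergodic G C \<longleftrightarrow>
     (\<forall>A\<in>sets (unit_space G). invariant_set G A \<longrightarrow> null_units G C A \<or> conull_units G C A)"

definition r_discrete :: "'a groupoid \<Rightarrow> 'a measure set \<Rightarrow> bool" where
  "r_discrete G C \<longleftrightarrow>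
     (\<exists>U. conull_units G C U \<and>
        (\<forall>x\<in>units (reduction G U). countable (range_fibre (reduction G U) x)))"


section \<open>Homomorphisms and similarity\<close>

definition strict_homomorphism ::
  "'a groupoid \<Rightarrow> 'a measure set \<Rightarrow> 'b groupoid \<Rightarrow> 'b measure set \<Rightarrow> ('a \<Rightarrow> 'b) \<Rightarrow> bool" where
  "strict_homomorphism G1 C1 G2 C2 \<phi> \<longleftrightarrow>
     \<phi> \<in> borel_of G1 \<rightarrow>\<^sub>M borel_of G2 \<and>
     (\<forall>(\<gamma>, \<eta>)\<in>composable G1.
        (\<phi> \<gamma>, \<phi> \<eta>) \<in> composable G2 \<and> \<phi> (mul G1 \<gamma> \<eta>) = mul G2 (\<phi> \<gamma>) (\<phi> \<eta>)) \<and>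
     (\<forall>E. null_units G2 C2 E \<longrightarrow> null_units G1 C1 (\<phi> -` E \<inter> units G1))"

definition strict_on_reduction ::
  "'a groupoid \<Rightarrow> 'a measure set \<Rightarrow> 'a set \<Rightarrow> 'b groupoid \<Rightarrow> 'b measure set \<Rightarrow> ('a \<Rightarrow> 'b) \<Rightarrow> bool" where
  "strict_on_reduction G1 C1 U G2 C2 \<phi> \<longleftrightarrow>
     conull_units G1 C1 U \<and>
     strict_homomorphism (reduction G1 U) (reduction_class G1 C1 U) G2 C2 \<phi>"

definition homomorphism ::
  "'a groupoid \<Rightarrow> 'a measure set \<Rightarrow> 'b groupoid \<Rightarrow> 'b measure set \<Rightarrow> ('a \<Rightarrow> 'b) \<Rightarrow> bool" where
  "homomorphism G1 C1 G2 C2 \<phi> \<longleftrightarrow>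
     \<phi> \<in> borel_of G1 \<rightarrow>\<^sub>M borel_of G2 \<and> (\<exists>U. strict_on_reduction G1 C1 U G2 C2 \<phi>)"

definition similar_homomorphisms ::
  "'a groupoid \<Rightarrow> 'a measure set \<Rightarrow> 'b groupoid \<Rightarrow> 'b measure set \<Rightarrow> ('a \<Rightarrow> 'b) \<Rightarrow> ('a \<Rightarrow> 'b) \<Rightarrow> bool" where
  "similar_homomorphisms G1 C1 G2 C2 \<phi> \<psi> \<longleftrightarrow>
     homomorphism G1 C1 G2 C2 \<phi> \<and> homomorphism G1 C1 G2 C2 \<psi> \<and>
     (\<exists>U \<theta>. strict_on_reduction G1 C1 U G2 C2 \<phi> \<and> strict_on_reduction G1 C1 U G2 C2 \<psi> \<and>
        \<theta> \<in> restrict_space (borel_of G1) U \<rightarrow>\<^sub>M borel_of G2 \<and>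
        (\<forall>\<gamma>\<in>reduced_arrows G1 U.
           (\<theta> (rng G1 \<gamma>), \<phi> \<gamma>) \<in> composable G2 \<and> (\<psi> \<gamma>, \<theta> (src G1 \<gamma>)) \<in> composable G2 \<and>
           mul G2 (\<theta> (rng G1 \<gamma>)) (\<phi> \<gamma>) = mul G2 (\<psi> \<gamma>) (\<theta> (src G1 \<gamma>))))"

definition similar_groupoids ::
  "'a groupoid \<Rightarrow> 'a measure set \<Rightarrow> 'b groupoid \<Rightarrow> 'b measure set \<Rightarrow> bool" where
  "similar_groupoids G1 C1 G2 C2 \<longleftrightarrow>
     (\<exists>\<phi> \<psi>. homomorphism G1 C1 G2 C2 \<phi> \<and> homomorphism G2 C2 G1 C1 \<psi> \<and>
        similar_homomorphisms G2 C2 G2 C2 (\<phi> \<circ> \<psi>) id \<and>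
        similar_homomorphisms G1 C1 G1 C1 (\<psi> \<circ> \<phi>) id)"


section \<open>Hilbert bundles\<close>

record 'h chilbert =
  hcar :: "'h set"
  hzero :: "'h"
  hadd :: "'h \<Rightarrow> 'h \<Rightarrow> 'h"
  hscale :: "complex \<Rightarrow> 'h \<Rightarrow> 'h"
  hinner :: "'h \<Rightarrow> 'h \<Rightarrow> complex"

definition hminus :: "'h chilbert \<Rightarrow> 'h \<Rightarrow> 'h \<Rightarrow> 'h" where
  "hminus H v w = hadd H v (hscale H (-1) w)"

definition hnorm :: "'h chilbert \<Rightarrow> 'h \<Rightarrow> real" where
  "hnorm H v = sqrt (Re (hinner H v v))"

definition hdist :: "'h chilbert \<Rightarrow> 'h \<Rightarrow> 'h \<Rightarrow> real" where
  "hdist H v w = hnorm H (hminus H v w)"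

definition complex_hilbert_space :: "'h chilbert \<Rightarrow> bool" where
  "complex_hilbert_space H \<longleftrightarrow>
     hzero H \<in> hcar H \<and>
     (\<forall>v\<in>hcar H. \<forall>w\<in>hcar H. hadd H v w \<in> hcar H \<and> hadd H v w = hadd H w v) \<and>
     (\<forall>u\<in>hcar H. \<forall>v\<in>hcar H. \<forall>w\<in>hcar H. hadd H (hadd H u v) w = hadd H u (hadd H v w)) \<and>
     (\<forall>v\<in>hcar H. hadd H (hzero H) v = v \<and> (\<exists>w\<in>hcar H. hadd H v w = hzero H)) \<and>
     (\<forall>a. \<forall>v\<in>hcar H. hscale H a v \<in> hcar H) \<and>
     (\<forall>v\<in>hcar H. hscale H 1 v = v) \<and>
     (\<forall>a b. \<forall>v\<in>hcar H. hscale H a (hscale H b v) = hscale H (a * b) v \<and>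
        hscale H (a + b) v = hadd H (hscale H a v) (hscale H b v)) \<and>
     (\<forall>a. \<forall>v\<in>hcar H. \<forall>w\<in>hcar H. hscale H a (hadd H v w) = hadd H (hscale H a v) (hscale H a w)) \<and>
     (\<forall>u\<in>hcar H. \<forall>v\<in>hcar H. \<forall>w\<in>hcar H. hinner H (hadd H u v) w = hinner H u w + hinner H v w) \<and>
     (\<forall>a. \<forall>v\<in>hcar H. \<forall>w\<in>hcar H. hinner H (hscale H a v) w = a * hinner H v w) \<and>
     (\<forall>v\<in>hcar H. \<forall>w\<in>hcar H. hinner H v w = cnj (hinner H w v)) \<and>
     (\<forall>v\<in>hcar H. v \<noteq> hzero H \<longrightarrow> Re (hinner H v v) > 0) \<and>
     Metric_space.mcomplete (hcar H) (hdist H)"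

definition hilbert_isomorphism :: "'h chilbert \<Rightarrow> 'k chilbert \<Rightarrow> ('h \<Rightarrow> 'k) \<Rightarrow> bool" where
  "hilbert_isomorphism H K T \<longleftrightarrow>
     bij_betw T (hcar H) (hcar K) \<and>
     (\<forall>v\<in>hcar H. \<forall>w\<in>hcar H. T (hadd H v w) = hadd K (T v) (T w)) \<and>
     (\<forall>a. \<forall>v\<in>hcar H. T (hscale H a v) = hscale K a (T v)) \<and>
     (\<forall>v\<in>hcar H. \<forall>w\<in>hcar H. hinner K (T v) (T w) = hinner H v w)"

inductive_set hspan :: "'h chilbert \<Rightarrow> 'h set \<Rightarrow> 'h set" for H S where
  "hzero H \<in> hspan H S"
| "v \<in> S \<Longrightarrow> hscale H a v \<in> hspan H S"
| "v \<in> hspan H S \<Longrightarrow> w \<in> hspan H S \<Longrightarrow> hadd H v w \<in> hspan H S"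

text \<open>A Hilbert bundle is a family of complex Hilbert spaces together with a fundamental sequence of
  sections, which determines the Borel structure: a section is Borel iff its inner products with
  the members of the sequence are Borel functions. Totality of the sequence forces the fibres to
  be separable. A separable Hilbert space has at most the cardinality of the continuum, so
  nothing is lost by realising the underlying sets of the fibres inside one fixed type of that
  cardinality; the Hilbert space structures on them are arbitrary.\<close>

type_synonym vec = "nat \<Rightarrow> complex"

record 'x hilbert_bundle =
  fib :: "'x \<Rightarrow> vec chilbert"
  fund :: "nat \<Rightarrow> 'x \<Rightarrow> vec"

definition is_hilbert_bundle :: "'x measure \<Rightarrow> 'x hilbert_bundle \<Rightarrow> bool" where
  "is_hilbert_bundle X \<H> \<longleftrightarrow>
     (\<forall>x\<in>space X. complex_hilbert_space (fib \<H> x)) \<and>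
     (\<forall>n. \<forall>x\<in>space X. fund \<H> n x \<in> hcar (fib \<H> x)) \<and>
     (\<forall>m n. (\<lambda>x. hinner (fib \<H> x) (fund \<H> m x) (fund \<H> n x)) \<in> borel_measurable X) \<and>
     (\<forall>x\<in>space X. \<forall>v\<in>hcar (fib \<H> x). \<forall>e>0.
        \<exists>w\<in>hspan (fib \<H> x) (range (\<lambda>n. fund \<H> n x)). hdist (fib \<H> x) v w < e)"

definition borel_section :: "'x measure \<Rightarrow> 'x hilbert_bundle \<Rightarrow> ('x \<Rightarrow> vec) \<Rightarrow> bool" where
  "borel_section X \<H> \<xi> \<longleftrightarrow>
     (\<forall>x\<in>space X. \<xi> x \<in> hcar (fib \<H> x)) \<and>
     (\<forall>n. (\<lambda>x. hinner (fib \<H> x) (\<xi> x) (fund \<H> n x)) \<in> borel_measurable X)"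


section \<open>Representations and property T\<close>

definition representation ::
  "'a groupoid \<Rightarrow> 'a measure set \<Rightarrow> 'a hilbert_bundle \<Rightarrow> ('a \<Rightarrow> vec \<Rightarrow> vec) \<Rightarrow> bool" where
  "representation G C \<H> L \<longleftrightarrow>
     is_hilbert_bundle (unit_space G) \<H> \<and>
     (\<forall>\<gamma>\<in>arrows G. hilbert_isomorphism (fib \<H> (src G \<gamma>)) (fib \<H> (rng G \<gamma>)) (L \<gamma>)) \<and>
     (\<forall>\<xi> \<eta>. borel_section (unit_space G) \<H> \<xi> \<longrightarrow> borel_section (unit_space G) \<H> \<eta> \<longrightarrow>
        (\<lambda>\<gamma>. hinner (fib \<H> (rng G \<gamma>)) (L \<gamma> (\<xi> (src G \<gamma>))) (\<eta> (rng G \<gamma>)))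
          \<in> borel_measurable (borel_of G)) \<and>
     (\<exists>U. conull_units G C U \<and>
        (\<forall>(\<gamma>1, \<gamma>2)\<in>composable (reduction G U). \<forall>v\<in>hcar (fib \<H> (src G \<gamma>2)).
           L (mul G \<gamma>1 \<gamma>2) v = L \<gamma>1 (L \<gamma>2 v)))"

definition unit_section ::
  "'a groupoid \<Rightarrow> 'a measure set \<Rightarrow> 'a hilbert_bundle \<Rightarrow> ('a \<Rightarrow> vec) \<Rightarrow> bool" where
  "unit_section G C \<H> \<xi> \<longleftrightarrow>
     borel_section (unit_space G) \<H> \<xi> \<and>
     ae_class (range_class G C) (\<lambda>x. hnorm (fib \<H> x) (\<xi> x) = 1)"

definition almost_contains_unit_invariant_sections ::
  "'a groupoid \<Rightarrow> 'a measure set \<Rightarrow> 'a hilbert_bundle \<Rightarrow> ('a \<Rightarrow> vec \<Rightarrow> vec) \<Rightarrow> bool" where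
  "almost_contains_unit_invariant_sections G C \<H> L \<longleftrightarrow>
     (\<exists>\<xi> :: nat \<Rightarrow> 'a \<Rightarrow> vec. (\<forall>n. unit_section G C \<H> (\<xi> n)) \<and>
        ae_class C (\<lambda>\<gamma>.
          (\<lambda>n. hnorm (fib \<H> (rng G \<gamma>))
                 (hminus (fib \<H> (rng G \<gamma>)) (\<xi> n (rng G \<gamma>)) (L \<gamma> (\<xi> n (src G \<gamma>)))))
            \<longlonglongrightarrow> 0))"

definition contains_unit_invariant_section ::
  "'a groupoid \<Rightarrow> 'a measure set \<Rightarrow> 'a hilbert_bundle \<Rightarrow> ('a \<Rightarrow> vec \<Rightarrow> vec) \<Rightarrow> bool" where
  "contains_unit_invariant_section G C \<H> L \<longleftrightarrow>
     (\<exists>\<xi>. unit_section G C \<H> \<xi> \<and> ae_class C (\<lambda>\<gamma>. \<xi> (rng G \<gamma>) = L \<gamma> (\<xi> (src G \<gamma>))))"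

definition property_T :: "'a groupoid \<Rightarrow> 'a measure set \<Rightarrow> bool" where
  "property_T G C \<longleftrightarrow>
     (\<forall>\<H> L. representation G C \<H> L \<longrightarrow> almost_contains_unit_invariant_sections G C \<H> L \<longrightarrow>
        contains_unit_invariant_section G C \<H> L)"

end

theory Submission
  imports Defs
begin

text \<open>Given a representation of \<open>G\<^sub>2\<close>, pull it back along \<open>\<phi>\<close>, apply property T of \<open>G\<^sub>1\<close>, pull the
  invariant section back along \<open>\<psi>\<close> and move it into place with the arrows \<open>\<theta>(y)\<close> from \<open>\<phi>(\<psi>(y))\<close> to \<open>y\<close>
  supplied by the similarity. Since the groupoids are \<open>r\<close>-discrete, a statement holding for almost every
  arrow holds for all arrows of a reduction: the fibre measures charge every arrow of some reduction.
  This lets null sets of arrows be pulled back along homomorphisms, of which only the behaviour on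
  units is controlled.

  A homomorphism is multiplicative only on a reduction, while a representation needs isomorphisms over
  all arrows. So \<open>\<phi>\<close> is first replaced by a Borel map that respects ranges and sources everywhere and
  agrees with \<open>\<phi>\<close> on a reduction. This uses Borel selection for countable-to-one maps, obtained from
  the Lusin--Souslin theorem and the Baire category theorem, with the fibre measures
  in place of the full Lusin--Novikov theorem. Trivialising the bundle would be
  an alternative, but it needs the completeness of the fibres, and the condition \<open>Metric_space.mcomplete\<close>
  can only be unfolded for functions that are symmetric and nonnegative outside the carrier as well.\<close>

section \<open>Codings of standard Borel spaces\<close>

text \<open>All the descriptive set theory rests on one device: a tree of cells indexed by finite
  integer sequences in which every infinite branch of nonempty cells yields a point with prescribed
  membership in countably many Borel sets. Lusin separation, Lusin-Souslin and the existence of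
  isolated points in countable fibres are three arguments about branches of such trees. Fibre
  measures can stand in for a uniformisation theorem for the following reason. A set of charged
  arrows in one fibre is empty exactly when it is null, and the mass of the sections of a Borel set
  depends measurably on the base point. Hence "no other arrow of this Borel set has the same range"
  is a Borel condition, although emptiness of sections in general is not. The extension of a
  homomorphism is precomposition with a retraction of the groupoid onto a reduction, namely
  conjugation by the selected arrows. A second difficulty is measurability: the Borel condition on a
  representation concerns sections over the unit space only, while the transported section lives
  over a set of arrows. Approximation by countably many rational sections bridges this.\<close>

text \<open>Convergence of codes, coordinate by coordinate, plays the part of convergence in an
  added Baire space factor. The stable value \<open>a\<close> need not be the code of the limit
  \<open>x\<close>; dropping this demand is what makes complements and countable unions
  easy.\<close>

definition tracks :: "'a measure \<Rightarrow> 'a topology \<Rightarrow> 'a set \<Rightarrow> ('a \<Rightarrow> nat \<Rightarrow> nat) \<Rightarrow> bool" where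
  "tracks M X S c \<longleftrightarrow> (\<forall>i. (\<lambda>z. c z i) \<in> M \<rightarrow>\<^sub>M count_space UNIV) \<and>
     (\<forall>a z x. (\<forall>k. z k \<in> space M) \<longrightarrow> (\<forall>i. \<forall>\<^sub>F k in sequentially. c (z k) i = a i) \<longrightarrow>
        limitin X z x sequentially \<longrightarrow> (\<forall>\<^sub>F k in sequentially. z k \<in> S \<longleftrightarrow> x \<in> S))"

definition tracked :: "'a measure \<Rightarrow> 'a topology \<Rightarrow> 'a set \<Rightarrow> bool" where
  "tracked M X S \<longleftrightarrow> (\<exists>c. tracks M X S c)"

lemma tracks_measurable: "tracks M X S c \<Longrightarrow> (\<lambda>z. c z i) \<in> M \<rightarrow>\<^sub>M count_space UNIV"
  by (simp add: tracks_def)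

lemma tracks_limit:
  assumes "tracks M X S c" "\<And>k. z k \<in> space M" "\<And>i. \<forall>\<^sub>F k in sequentially. c (z k) i = a i"
    and "limitin X z x sequentially"
  shows "\<forall>\<^sub>F k in sequentially. z k \<in> S \<longleftrightarrow> x \<in> S"
  using assms unfolding tracks_def by blast

lemma measurable_least_index:
  fixes P :: "nat \<Rightarrow> 'a \<Rightarrow> bool"
  assumes "\<And>n. {z \<in> space M. P n z} \<in> sets M"
  shows "(\<lambda>z. LEAST n. P n z) \<in> M \<rightarrow>\<^sub>M count_space UNIV"
proof -
  have "Measurable.pred M (P n)" for n
    using assms[of n] by (simp add: pred_def)
  then show ?thesis by (rule measurable_Least)
qed

text \<open>In a metrizable space an open set is a union of closed sets \<open>C n\<close>. The code
  is 0 off \<open>U\<close> and otherwise names the first \<open>C n\<close> containing the point,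
  so a stable code keeps the sequence in one closed set, \<open>C n\<close> or the complement of
  \<open>U\<close>, which also contains the limit.\<close>

lemma tracked_open:
  assumes X: "metrizable_space X" "topspace X = space M" "\<And>U. openin X U \<Longrightarrow> U \<in> sets M"
    and U: "openin X U"
  shows "tracked M X U"
proof -
  obtain C :: "nat \<Rightarrow> 'a set" where "(\<forall>n. closedin X (C n)) \<and> (\<forall>n. C n \<subseteq> C (Suc n)) \<and> \<Union> (range C) = U"
    using open_imp_fsigma_in[OF X(1) U] unfolding fsigma_in_ascending by (rule exE)
  then have C: "\<And>n. closedin X (C n)" "\<Union> (range C) = U" by simp_all
  have Cm: "C n \<in> sets M" for n
  proof -
    have "topspace X - C n \<in> sets M" using C(1)[of n] X(3) by (simp add: closedin_def)
    then have "space M - (topspace X - C n) \<in> sets M" by auto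
    moreover have "space M - (topspace X - C n) = C n"
      using closedin_subset[OF C(1)[of n]] X(2) by auto
    ultimately show ?thesis by simp
  qed
  define c where "c z i = (if z \<in> U then Suc (LEAST n. z \<in> C n) else 0)" for z and i :: nat
  show ?thesis unfolding tracked_def tracks_def
  proof (intro exI[of _ c] conjI allI impI)
    fix i
    have [measurable]: "U \<in> sets M" using X(3) U by simp
    have [measurable]: "(\<lambda>z. LEAST n. z \<in> C n) \<in> M \<rightarrow>\<^sub>M count_space UNIV"
      using Cm[measurable] by (intro measurable_least_index) measurable
    show "(\<lambda>z. c z i) \<in> M \<rightarrow>\<^sub>M count_space UNIV" unfolding c_def by measurable
  next
    fix a z x assume z: "\<forall>k. z k \<in> space M" "\<forall>i. \<forall>\<^sub>F k in sequentially. c (z k) i = a i"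
      and lim: "limitin X z x sequentially"
    have ev: "\<forall>\<^sub>F k in sequentially. c (z k) 0 = a 0" using z by blast
    show "\<forall>\<^sub>F k in sequentially. (z k \<in> U) = (x \<in> U)"
    proof (cases "a 0")
      case 0
      have "\<forall>\<^sub>F k in sequentially. z k \<in> topspace X - U"
        using ev by eventually_elim (use z(1) X(2) 0 in \<open>auto simp: c_def split: if_splits\<close>)
      then have "x \<in> topspace X - U"
        by (intro limitin_closedin[OF lim]) (use U in auto)
      with ev show ?thesis by (elim eventually_mono) (use 0 in \<open>auto simp: c_def split: if_splits\<close>)
    next
      case (Suc n)
      have *: "z k \<in> U \<and> z k \<in> C n" if "c (z k) 0 = a 0" for k
      proof -
        have "z k \<in> U" "n = (LEAST n. z k \<in> C n)"
          using that Suc by (auto simp: c_def split: if_splits)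
        moreover from this obtain m where "z k \<in> C m" using C(2) by blast
        ultimately show ?thesis by (metis LeastI)
      qed
      have "\<forall>\<^sub>F k in sequentially. z k \<in> C n"
        using ev by eventually_elim (use * in auto)
      then have "x \<in> C n"
        by (intro limitin_closedin[OF lim]) (use C in auto)
      then have "x \<in> U" using C by auto
      with ev show ?thesis by (elim eventually_mono) (use * in auto)
    qed
  qed
qed

lemma tracked_Compl:
  assumes "topspace X = space M" "tracked M X S" shows "tracked M X (space M - S)"
proof -
  obtain c where c: "tracks M X S c"
    using assms(2) unfolding tracked_def by blast
  show ?thesis unfolding tracked_def tracks_def
  proof (intro exI[of _ c] conjI allI impI tracks_measurable[OF c])
    fix a z x assume z: "\<forall>k. z k \<in> space M" "\<forall>i. \<forall>\<^sub>F k in sequentially. c (z k) i = a i"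
      and lim: "limitin X z x sequentially"
    have "x \<in> space M" using limitin_topspace[OF lim] assms by simp
    have "\<forall>\<^sub>F k in sequentially. z k \<in> S \<longleftrightarrow> x \<in> S" using tracks_limit[OF c _ _ lim] z by blast
    then show "\<forall>\<^sub>F k in sequentially. (z k \<in> space M - S) = (x \<in> space M - S)"
      by eventually_elim (use z \<open>x \<in> space M\<close> in auto)
  qed
qed

text \<open>Besides the interleaved codes of the sets \<open>S n\<close>, coordinate 0 names the
  first \<open>S n\<close> that contains the point. Without it the sequence could wander through
  ever new \<open>S n\<close> while its limit lies in none of them.\<close>

lemma tracked_UN:
  fixes S :: "nat \<Rightarrow> 'a set"
  assumes "\<And>n. tracked M X (S n)" "\<And>n. S n \<in> sets M" shows "tracked M X (\<Union>n. S n)"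
proof -
  have "\<forall>n. \<exists>c. tracks M X (S n) c"
    using assms(1) unfolding tracked_def by blast
  then obtain c where c: "\<And>n. tracks M X (S n) (c n)" by metis
  define w where "w z = (if z \<in> (\<Union>n. S n) then Suc (LEAST n. z \<in> S n) else 0)" for z
  define e where "e z i = (case i of 0 \<Rightarrow> w z | Suc i \<Rightarrow> c (fst (prod_decode i)) z (snd (prod_decode i)))" for z i
  show ?thesis unfolding tracked_def tracks_def
  proof (intro exI[of _ e] conjI allI impI)
    fix i
    have [measurable]: "(\<Union>n. S n) \<in> sets M" using assms(2) by auto
    have [measurable]: "(\<lambda>z. LEAST n. z \<in> S n) \<in> M \<rightarrow>\<^sub>M count_space UNIV"
      using assms(2)[measurable] by (intro measurable_least_index) measurable
    have "w \<in> M \<rightarrow>\<^sub>M count_space UNIV" unfolding w_def by measurable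
    then show "(\<lambda>z. e z i) \<in> M \<rightarrow>\<^sub>M count_space UNIV"
      by (cases i) (auto simp: e_def tracks_measurable[OF c])
  next
    fix a z x assume z: "\<forall>k. z k \<in> space M" "\<forall>i. \<forall>\<^sub>F k in sequentially. e (z k) i = a i"
      and lim: "limitin X z x sequentially"
    have S: "\<forall>\<^sub>F k in sequentially. z k \<in> S n \<longleftrightarrow> x \<in> S n" for n
    proof (rule tracks_limit[OF c _ _ lim])
      show "z k \<in> space M" for k using z by auto
      show "\<forall>\<^sub>F k in sequentially. c n (z k) i = a (Suc (prod_encode (n, i)))" for i
        using z(2)[rule_format, of "Suc (prod_encode (n, i))"] by (simp add: e_def)
    qed
    have ev: "\<forall>\<^sub>F k in sequentially. w (z k) = a 0"
      using z(2)[rule_format, of 0] by (simp add: e_def)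
    show "\<forall>\<^sub>F k in sequentially. (z k \<in> (\<Union>n. S n)) = (x \<in> (\<Union>n. S n))"
    proof (cases "a 0")
      case 0
      have no: "\<forall>\<^sub>F k in sequentially. z k \<notin> (\<Union>n. S n)"
        using ev by eventually_elim (use 0 in \<open>auto simp: w_def split: if_splits\<close>)
      have "x \<notin> S n" for n
      proof
        assume "x \<in> S n"
        have "\<forall>\<^sub>F k in sequentially. False" using S[of n] no by eventually_elim (use \<open>x \<in> S n\<close> in auto)
        then show False by simp
      qed
      then have "x \<notin> (\<Union>n. S n)" by blast
      with no show ?thesis by (elim eventually_mono) (simp del: UN_iff)
    next
      case (Suc n)
      have inS: "\<forall>\<^sub>F k in sequentially. z k \<in> S n"
        using ev
      proof eventually_elim
        case (elim k)
        then have "z k \<in> (\<Union>n. S n)" "n = (LEAST n. z k \<in> S n)" using Suc by (auto simp: w_def split: if_splits)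
        then show ?case by (metis LeastI UN_E)
      qed
      then have "\<forall>\<^sub>F k in sequentially. x \<in> S n" using S[of n] by eventually_elim auto
      then have "x \<in> S n" by simp
      with inS show ?thesis by (elim eventually_mono) blast
    qed
  qed
qed

lemma measurable_mball_index:
  assumes "Metric_space M d" "\<And>U. openin (Metric_space.mtopology M d) U \<Longrightarrow> U \<in> sets N" "space N = M"
  shows "(\<lambda>z. LEAST i. d (p i) z < r \<and> p i \<in> M) \<in> N \<rightarrow>\<^sub>M count_space (UNIV :: nat set)"
proof (rule measurable_least_index)
  interpret Metric_space M d by fact
  fix n
  have "{z \<in> space N. d (p n) z < r \<and> p n \<in> M} = mball (p n) r" using assms(3) by (auto simp: mball_def)
  also have "\<dots> \<in> sets N" by (rule assms(2)) simp
  finally show "{z \<in> space N. d (p n) z < r \<and> p n \<in> M} \<in> sets N" .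
qed

text \<open>The points of \<open>T\<close> get codes in \<open>\<nat>\<^sup>\<nat>\<close>, not necessarily distinct, such that membership in each of
  the given sets can be read off one coordinate and such that every sequence all of whose finite
  prefixes are realised comes from a point, as far as these sets can tell. This plays the role of a
  finer Polish topology making all the given sets clopen.\<close>

definition coding ::
  "'a measure \<Rightarrow> 'a set \<Rightarrow> (nat \<Rightarrow> 'a set) \<Rightarrow> ('a \<Rightarrow> nat \<Rightarrow> nat) \<Rightarrow> (nat \<Rightarrow> nat) \<Rightarrow> bool" where
  "coding M T B c i \<longleftrightarrow> (\<forall>n. (\<lambda>z. c z n) \<in> M \<rightarrow>\<^sub>M count_space UNIV) \<and>
     (\<forall>z j. c z (i j) = of_bool (z \<in> B j)) \<and>
     (\<forall>a. (\<forall>k. \<exists>z\<in>T. \<forall>n<k. c z n = a n) \<longrightarrow> (\<exists>x\<in>T. \<forall>j. x \<in> B j \<longleftrightarrow> a (i j) = 1))"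

lemma codingD:
  assumes "coding M T B c i"
  shows "(\<lambda>z. c z n) \<in> M \<rightarrow>\<^sub>M count_space UNIV" "c z (i j) = of_bool (z \<in> B j)"
    "(\<And>k. \<exists>z\<in>T. \<forall>n<k. c z n = a n) \<Longrightarrow> \<exists>x\<in>T. \<forall>j. x \<in> B j \<longleftrightarrow> a (i j) = 1"
  using assms by (simp_all add: coding_def)

text \<open>Three kinds of coordinates are interleaved modulo 3: indices of dense points within
  \<open>1 / 2 ^ n\<close>, which force points realising longer and longer prefixes to form a Cauchy
  sequence; indicators of the sets \<open>B j\<close>; and tracking codes, through which the limit
  inherits membership.\<close>

lemma borel_coding:
  assumes M: "standard_borel_space M" and T: "T \<in> sets M" and B: "\<And>j. B j \<in> sets M"
  shows "\<exists>c i. coding M T B c i"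
proof -
  obtain X where X: "completely_metrizable_space X" "second_countable X" "topspace X = space M"
    "sets M = sigma_sets (topspace X) {U. openin X U}"
    using M unfolding standard_borel_space_def by auto
  obtain P d where d: "Metric_space P d" "Metric_space.mcomplete P d" "X = Metric_space.mtopology P d"
    using X(1) unfolding completely_metrizable_space_def by auto
  interpret Metric_space P d by (rule d)
  have P: "space M = P" using X(3) d(3) by simp
  have openM: "openin X U \<Longrightarrow> U \<in> sets M" for U using X(4) by auto
  have Xm: "metrizable_space X" using X(1) by (rule completely_metrizable_imp_metrizable_space)
  have tr: "tracked M X S" if "S \<in> sets M" for S
  proof -
    \<comment> \<open>Measurability is carried through the induction because the union step needs it
      for its index coordinate.\<close>
    have "S \<in> sets M \<and> tracked M X S" if "S \<in> sigma_sets (topspace X) {U. openin X U}"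
      using that
    proof induction
      case (Basic U) then show ?case using tracked_open[OF Xm X(3) openM] openM by auto
    next
      case Empty then show ?case using tracked_open[OF Xm X(3) openM, of "{}"] by auto
    next
      case (Compl S) then show ?case using tracked_Compl[OF X(3)] X(3) by auto
    next
      case (Union S) then show ?case using tracked_UN[of M X S] by auto
    qed
    then show ?thesis using that X(4) by simp
  qed
  \<comment> \<open>\<open>T\<close> is tracked along with the sets \<open>B j\<close>, since the
    limit has to lie in \<open>T\<close> again.\<close>
  define B' where "B' j = (case j of 0 \<Rightarrow> T | Suc j \<Rightarrow> B j)" for j
  have B': "B' j \<in> sets M" for j using T B by (auto simp: B'_def split: nat.splits)
  have "\<forall>n. \<exists>c. tracks M X (B' n) c"
    using tr[OF B'] unfolding tracked_def by blast
  then obtain c where c: "\<And>n. tracks M X (B' n) (c n)" by metis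
  obtain D where D: "countable D" "D \<subseteq> P" "mtopology closure_of D = P"
    using second_countable_imp_separable_space[OF X(2)] d(3) unfolding separable_space_def by auto
  define p where "p = from_nat_into D"
  define b where "b z n = (LEAST i. d (p i) z < 1 / 2 ^ n \<and> p i \<in> P)" for z and n :: nat
  have b: "d (p (b z n)) z < 1 / 2 ^ n \<and> p (b z n) \<in> P" if "z \<in> P" for z n
  proof -
    have "z \<in> mtopology closure_of D" using that D by simp
    then obtain y where y: "y \<in> D" "d z y < 1 / 2 ^ n"
      unfolding metric_closure_of by (auto dest!: spec[of _ "1 / 2 ^ n"])
    then obtain i where "p i = y" unfolding p_def using from_nat_into_to_nat_on[OF D(1) y(1)] by blast
    then have "d (p i) z < 1 / 2 ^ n \<and> p i \<in> P" using y D commute by auto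
    then show ?thesis unfolding b_def by (rule LeastI)
  qed
  have bm: "(\<lambda>z. b z n) \<in> M \<rightarrow>\<^sub>M count_space UNIV" for n
    unfolding b_def by (rule measurable_mball_index[OF d(1) openM P]) (simp add: d(3))
  define C where "C z i = (let m = i div 3 in if i mod 3 = 0 then b z m
    else if i mod 3 = 1 then of_bool (z \<in> B m) else c (fst (prod_decode m)) z (snd (prod_decode m)))" for z i
  have C0: "C z (3 * m) = b z m" for z m by (simp add: C_def)
  have C1: "C z (Suc (3 * m)) = of_bool (z \<in> B m)" for z and m :: nat
  proof -
    have "Suc (3 * m) div 3 = m" "Suc (3 * m) mod 3 = 1" by presburger+
    then show ?thesis by (simp add: C_def Let_def)
  qed
  have C2: "C z (Suc (Suc (3 * m))) = c (fst (prod_decode m)) z (snd (prod_decode m))" for z and m :: nat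
  proof -
    have "Suc (Suc (3 * m)) div 3 = m" "Suc (Suc (3 * m)) mod 3 = 2" by presburger+
    then show ?thesis by (simp add: C_def Let_def)
  qed
  show ?thesis
    unfolding coding_def
  proof (intro exI[of _ C] exI[of _ "\<lambda>j. Suc (3 * j)"] conjI allI impI)
    fix i :: nat
    define m where "m = i div 3"
    have [measurable]: "B m \<in> sets M" by (rule B)
    note [measurable] = bm[of m] tracks_measurable[OF c]
    show "(\<lambda>z. C z i) \<in> M \<rightarrow>\<^sub>M count_space UNIV"
      unfolding C_def Let_def m_def[symmetric] by measurable
  next
    show "C z (Suc (3 * j)) = of_bool (z \<in> B j)" for z j by (rule C1)
  next
    fix a assume "\<forall>k. \<exists>z\<in>T. \<forall>i<k. C z i = a i"
    then obtain z where z: "\<And>k. z k \<in> T" "\<And>k i. i < k \<Longrightarrow> C (z k) i = a i" by metis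
    have zP: "z k \<in> P" for k using z(1)[of k] T P sets.sets_into_space by blast
    have ev: "\<forall>\<^sub>F k in sequentially. C (z k) i = a i" for i
      using eventually_gt_at_top[of i] by eventually_elim (use z in auto)
    have "MCauchy z"
      unfolding MCauchy_def
    proof (intro conjI allI impI)
      show "range z \<subseteq> P" using zP by auto
      fix e :: real assume "e > 0"
      then obtain n where n: "1 / 2 ^ n < e / 2"
        using real_arch_pow_inv[of "e / 2" "1 / 2"] \<open>e > 0\<close> by (auto simp: power_one_over)
      show "\<exists>N. \<forall>k k'. N \<le> k \<longrightarrow> N \<le> k' \<longrightarrow> d (z k) (z k') < e"
      proof (intro exI[of _ "Suc (3 * n)"] allI impI)
        fix k k' assume "Suc (3 * n) \<le> k" "Suc (3 * n) \<le> k'"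
        then have eq: "b (z k) n = a (3 * n)" "b (z k') n = a (3 * n)"
          using z(2)[of "3 * n" k] z(2)[of "3 * n" k'] by (auto simp: C0)
        let ?q = "p (a (3 * n))"
        have 1: "d ?q (z k) < 1 / 2 ^ n \<and> ?q \<in> P" using b[OF zP, of k n] unfolding eq .
        have 2: "d ?q (z k') < 1 / 2 ^ n" using b[OF zP, of k' n] unfolding eq by simp
        have "d (z k) (z k') \<le> d (z k) ?q + d ?q (z k')"
          using triangle 1 zP by blast
        then show "d (z k) (z k') < e" using 1 2 n commute[of "z k" ?q] by linarith
      qed
    qed
    then obtain x where x: "limitin mtopology z x sequentially"
      using d(2) unfolding mcomplete_def by blast
    have xB: "\<forall>\<^sub>F k in sequentially. z k \<in> B' n \<longleftrightarrow> x \<in> B' n" for n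
    proof (rule tracks_limit[OF c])
      show "z k \<in> space M" for k using zP P by simp
      show "limitin X z x sequentially" using x d(3) by simp
      show "\<forall>\<^sub>F k in sequentially. c n (z k) i = a (Suc (Suc (3 * prod_encode (n, i))))" for i
        using ev[of "Suc (Suc (3 * prod_encode (n, i)))"] by (simp add: C2)
    qed
    have "\<forall>\<^sub>F k in sequentially. x \<in> T" using xB[of 0] by eventually_elim (use z in \<open>auto simp: B'_def\<close>)
    then have "x \<in> T" by simp
    moreover have "x \<in> B j \<longleftrightarrow> a (Suc (3 * j)) = 1" for j
    proof -
      have "\<forall>\<^sub>F k in sequentially. x \<in> B j \<longleftrightarrow> a (Suc (3 * j)) = 1"
        using xB[of "Suc j"] ev[of "Suc (3 * j)"] by eventually_elim (auto simp: C1 B'_def)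
      then show ?thesis by simp
    qed
    ultimately show "\<exists>x\<in>T. \<forall>j. x \<in> B j \<longleftrightarrow> a (Suc (3 * j)) = 1" by blast
  qed
qed

section \<open>The tree of cells of a coding\<close>

definition cell :: "('a \<Rightarrow> nat \<Rightarrow> nat) \<Rightarrow> 'a set \<Rightarrow> nat list \<Rightarrow> 'a set" where
  "cell c T s = {z \<in> T. map (c z) [0..<length s] = s}"

lemma cell_iff: "z \<in> cell c T s \<longleftrightarrow> z \<in> T \<and> (\<forall>i<length s. c z i = s ! i)"
  unfolding cell_def by (subst list_eq_iff_nth_eq) simp

lemma cell_Nil [simp]: "cell c T [] = T"
  by (simp add: cell_def)

lemma cell_snoc: "cell c T s = (\<Union>i. cell c T (s @ [i]))"
  by (auto simp: cell_iff nth_append less_Suc_eq)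

lemma cell_measurable:
  assumes [measurable]: "\<And>i. (\<lambda>z. c z i) \<in> M \<rightarrow>\<^sub>M count_space UNIV" "T \<in> sets M"
  shows "cell c T s \<in> sets M"
proof -
  have "{z \<in> space M. z \<in> T \<and> (\<forall>i\<in>{..<length s}. c z i = s ! i)} \<in> sets M" by measurable
  also have "{z \<in> space M. z \<in> T \<and> (\<forall>i\<in>{..<length s}. c z i = s ! i)} = cell c T s"
    using sets.sets_into_space[OF assms(2)] by (auto simp: cell_iff)
  finally show ?thesis .
qed

text \<open>The lists may grow by several entries at once, as happens in the diagonal argument for
  isolated points; the bound on the lengths makes the branch infinite.\<close>

lemma prefix_chain_limit:
  fixes S :: "nat \<Rightarrow> 'a list"
  assumes "\<And>k. \<exists>t. S (Suc k) = S k @ t" "\<And>k. k \<le> length (S k)"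
  obtains a where "\<And>k i. i < length (S k) \<Longrightarrow> S k ! i = a i"
proof -
  have mono: "\<exists>t. S (k + m) = S k @ t" for k m
  proof (induction m)
    case (Suc m)
    then obtain t u where "S (k + m) = S k @ t" "S (Suc (k + m)) = S (k + m) @ u" using assms(1) by blast
    then show ?case by auto
  qed simp
  have "S k ! i = S (Suc i) ! i" if "i < length (S k)" for k i
  proof (cases "k \<le> Suc i")
    case True
    then obtain t where "S (Suc i) = S k @ t" using mono[of k "Suc i - k"] by auto
    then show ?thesis using that by (simp add: nth_append)
  next
    case False
    then obtain t where "S k = S (Suc i) @ t" using mono[of "Suc i" "k - Suc i"] by auto
    then show ?thesis using assms(2)[of "Suc i"] by (simp add: nth_append)
  qed
  then show ?thesis by (rule that)
qed

text \<open>Puts a branch of nonempty cells into the form that the last clause of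
  \<open>coding\<close> asks for.\<close>

lemma cell_chain_realised:
  assumes "\<And>k. cell c T (S k) \<noteq> {}" "\<And>k i. i < length (S k) \<Longrightarrow> S k ! i = a i" "\<And>k. k \<le> length (S k)"
  shows "\<exists>z\<in>T. \<forall>i<k. c z i = a i"
proof -
  obtain z where "z \<in> cell c T (S k)" using assms(1) by blast
  then show ?thesis using assms(2)[of _ k] assms(3)[of k] by (auto simp: cell_iff intro!: bexI[of _ z])
qed


section \<open>Injective Borel images\<close>

text \<open>All that is needed of a Hausdorff topology with countable base on the target: equality
  of points becomes countably many Borel conditions.\<close>

definition separating_sequence :: "'a measure \<Rightarrow> (nat \<Rightarrow> 'a set) \<Rightarrow> bool" where
  "separating_sequence M A \<longleftrightarrow> (\<forall>j. A j \<in> sets M) \<and>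
     (\<forall>x\<in>space M. \<forall>y\<in>space M. (\<forall>j. x \<in> A j \<longleftrightarrow> y \<in> A j) \<longrightarrow> x = y)"

lemma standard_borel_separating:
  assumes "standard_borel_space M"
  obtains A where "separating_sequence M A"
proof -
  obtain X where X: "completely_metrizable_space X" "second_countable X" "topspace X = space M"
    "sets M = sigma_sets (topspace X) {U. openin X U}"
    using assms unfolding standard_borel_space_def by auto
  obtain \<B> where "countable \<B> \<and> (\<forall>V\<in>\<B>. openin X V) \<and>
      (\<forall>U x. openin X U \<and> x \<in> U \<longrightarrow> (\<exists>V\<in>\<B>. x \<in> V \<and> V \<subseteq> U))"
    using X(2) unfolding second_countable_def by (rule exE)
  then have B: "countable \<B>" "\<And>V. V \<in> \<B> \<Longrightarrow> openin X V"
    "\<And>U x. openin X U \<Longrightarrow> x \<in> U \<Longrightarrow> \<exists>V\<in>\<B>. x \<in> V \<and> V \<subseteq> U"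
    by simp_all
  have H: "Hausdorff_space X"
    using X(1) completely_metrizable_imp_metrizable_space metrizable_imp_Hausdorff_space by blast
  \<comment> \<open>\<open>range_from_nat_into\<close> requires a nonempty countable family, hence
    the added \<open>{}\<close>.\<close>
  define A where "A = from_nat_into (insert {} \<B>)"
  have A: "range A = insert {} \<B>" unfolding A_def using B(1) by (intro range_from_nat_into) auto
  have "A j \<in> sets M" for j
  proof -
    have "A j \<in> insert {} \<B>" using A by blast
    then have "openin X (A j)" using B(2) by auto
    then show ?thesis using X(4) by auto
  qed
  moreover have "x = y" if "x \<in> space M" "y \<in> space M" and eq: "\<forall>j. x \<in> A j \<longleftrightarrow> y \<in> A j" for x y
  proof (rule ccontr)
    assume "x \<noteq> y"
    then have "\<exists>U V. openin X U \<and> openin X V \<and> x \<in> U \<and> y \<in> V \<and> disjnt U V"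
      using H that(1,2) X(3) unfolding Hausdorff_space_def by blast
    then obtain U V where "openin X U" "openin X V" "x \<in> U" "y \<in> V" "disjnt U V" by blast
    moreover from this obtain W where "W \<in> \<B>" "x \<in> W" "W \<subseteq> U" using B(3) by blast
    ultimately have "W \<in> \<B>" "x \<in> W" "y \<notin> W" by (auto simp: disjnt_iff)
    moreover have "W \<in> range A" unfolding A using \<open>W \<in> \<B>\<close> by simp
    then obtain j where "A j = W" by blast
    ultimately show False using eq by auto
  qed
  ultimately show ?thesis by (intro that[of A]) (auto simp: separating_sequence_def)
qed

text \<open>Lusin's separation argument. If the images were inseparable, inseparability would
  persist along a branch in each tree. The two realised points have different images, and a set
  \<open>A j\<close> telling these apart already separates the images of deep enough cells.\<close>

lemma borel_separation:
  assumes M: "standard_borel_space M" and f: "f \<in> M \<rightarrow>\<^sub>M X" and A: "separating_sequence X A"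
    and P: "P \<in> sets M" and Q: "Q \<in> sets M" and disj: "f ` P \<inter> f ` Q = {}"
  shows "\<exists>D\<in>sets X. f ` P \<subseteq> D \<and> f ` Q \<inter> D = {}"
proof (rule ccontr)
  define sep where "sep S T \<longleftrightarrow> (\<exists>D\<in>sets X. f ` S \<subseteq> D \<and> f ` T \<inter> D = {})" for S T
  assume nsep: "\<not> (\<exists>D\<in>sets X. f ` P \<subseteq> D \<and> f ` Q \<inter> D = {})"
  have Am: "A j \<in> sets X" for j using A by (simp add: separating_sequence_def)
  define B where "B j = f -` A j \<inter> space M" for j
  have B: "B j \<in> sets M" for j unfolding B_def using f Am by (rule measurable_sets)
  obtain c i where "coding M P B c i"
    using borel_coding[OF M P, of B] B by blast
  note c = codingD[OF this]
  obtain e i' where "coding M Q B e i'"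
    using borel_coding[OF M Q, of B] B by blast
  note e = codingD[OF this]
  have step: "\<exists>m n. \<not> sep (cell c P (s @ [m])) (cell e Q (t @ [n]))" if "\<not> sep (cell c P s) (cell e Q t)" for s t
  proof (rule ccontr)
    assume "\<not> ?thesis"
    then obtain D where D: "\<And>m n. D m n \<in> sets X" "\<And>m n. f ` cell c P (s @ [m]) \<subseteq> D m n"
        "\<And>m n. f ` cell e Q (t @ [n]) \<inter> D m n = {}"
      unfolding sep_def by metis
    have "sep (cell c P s) (cell e Q t)"
      unfolding sep_def
    proof (intro bexI conjI)
      \<comment> \<open>Union over \<open>m\<close>, because a point of the left cell lies in some
        child \<open>m\<close>; intersection over \<open>n\<close>, because every child of the right
        cell has to be avoided.\<close>
      show "(\<Union>m. \<Inter>n. D m n) \<in> sets X" using D(1) by (intro sets.countable_UN sets.countable_INT) auto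
      show "f ` cell c P s \<subseteq> (\<Union>m. \<Inter>n. D m n)"
      proof
        fix y assume "y \<in> f ` cell c P s"
        then obtain m where "y \<in> f ` cell c P (s @ [m])" by (subst (asm) cell_snoc) auto
        then show "y \<in> (\<Union>m. \<Inter>n. D m n)" using D(2) by blast
      qed
      show "f ` cell e Q t \<inter> (\<Union>m. \<Inter>n. D m n) = {}"
      proof (rule ccontr)
        assume "\<not> ?thesis"
        then obtain y m where y: "y \<in> f ` cell e Q t" "\<And>n. y \<in> D m n" by blast
        from y(1) obtain n where "y \<in> f ` cell e Q (t @ [n])" by (subst (asm) cell_snoc) auto
        then show False using D(3) y(2) by blast
      qed
    qed
    then show False using that by simp
  qed
  have "\<exists>F :: nat \<Rightarrow> nat list \<times> nat list.
    \<forall>k. (\<not> sep (cell c P (fst (F k))) (cell e Q (snd (F k))) \<and> length (fst (F k)) = k \<and> length (snd (F k)) = k)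
      \<and> (\<exists>m n. F (Suc k) = (fst (F k) @ [m], snd (F k) @ [n]))"
  proof (rule dependent_nat_choice)
    show "\<exists>x. \<not> sep (cell c P (fst x)) (cell e Q (snd x)) \<and> length (fst x) = 0 \<and> length (snd x) = 0"
      by (rule exI[of _ "([], [])"]) (use nsep in \<open>simp add: sep_def\<close>)
  next
    fix x :: "nat list \<times> nat list" and k
    assume x: "\<not> sep (cell c P (fst x)) (cell e Q (snd x)) \<and> length (fst x) = k \<and> length (snd x) = k"
    then obtain m n where "\<not> sep (cell c P (fst x @ [m])) (cell e Q (snd x @ [n]))" using step by blast
    then show "\<exists>y. (\<not> sep (cell c P (fst y)) (cell e Q (snd y)) \<and> length (fst y) = Suc k \<and> length (snd y) = Suc k)
        \<and> (\<exists>m n. y = (fst x @ [m], snd x @ [n]))"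
      using x by (intro exI[of _ "(fst x @ [m], snd x @ [n])"]) auto
  qed
  then obtain F where F: "\<And>k. \<not> sep (cell c P (fst (F k))) (cell e Q (snd (F k)))"
      "\<And>k. length (fst (F k)) = k" "\<And>k. length (snd (F k)) = k"
      "\<And>k. \<exists>m n. F (Suc k) = (fst (F k) @ [m], snd (F k) @ [n])"
    by blast
  obtain a where a: "\<And>k i. i < length (fst (F k)) \<Longrightarrow> fst (F k) ! i = a i"
    using prefix_chain_limit[of "\<lambda>k. fst (F k)"] F(2,4) by (metis fst_conv order_refl)
  obtain b where b: "\<And>k i. i < length (snd (F k)) \<Longrightarrow> snd (F k) ! i = b i"
    using prefix_chain_limit[of "\<lambda>k. snd (F k)"] F(3,4) by (metis snd_conv order_refl)
  \<comment> \<open>An empty cell would be separated trivially, by \<open>{}\<close> on the left or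
    by \<open>space X\<close> on the right.\<close>
  have ne: "cell c P (fst (F k)) \<noteq> {}" "cell e Q (snd (F k)) \<noteq> {}" for k
  proof -
    show "cell c P (fst (F k)) \<noteq> {}" using F(1)[of k] unfolding sep_def by (auto intro: bexI[of _ "{}"])
    have "f ` cell c P (fst (F k)) \<subseteq> space X"
      using f P sets.sets_into_space[OF P] by (auto simp: cell_iff dest: measurable_space)
    then show "cell e Q (snd (F k)) \<noteq> {}" using F(1)[of k] unfolding sep_def by (auto intro: bexI[of _ "space X"])
  qed
  obtain x where x: "x \<in> P" "\<And>j. x \<in> B j \<longleftrightarrow> a (i j) = 1"
    using c(3)[of a, OF cell_chain_realised[of c P "\<lambda>k. fst (F k)", OF ne(1) a]] F(2) by auto
  obtain y where y: "y \<in> Q" "\<And>j. y \<in> B j \<longleftrightarrow> b (i' j) = 1"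
    using e(3)[of b, OF cell_chain_realised[of e Q "\<lambda>k. snd (F k)", OF ne(2) b]] F(3) by auto
  have sp: "x \<in> space M" "y \<in> space M" "P \<subseteq> space M" "Q \<subseteq> space M"
    using x(1) y(1) sets.sets_into_space[OF P] sets.sets_into_space[OF Q] by auto
  have fsp: "f x \<in> space X" "f y \<in> space X" using sp f by (auto dest: measurable_space)
  have "f x \<noteq> f y" using disj x(1) y(1) by blast
  then obtain j where j: "(f x \<in> A j) \<noteq> (f y \<in> A j)"
    using A fsp unfolding separating_sequence_def by blast
  \<comment> \<open>Deep enough for both prefixes to contain the coordinate that records
    \<open>B j\<close>; from there on membership of the image in \<open>A j\<close> is constant on
    each of the two cells.\<close>
  define k where "k = Suc (max (i j) (i' j))"
  have cP: "z \<in> space M \<and> (f z \<in> A j \<longleftrightarrow> f x \<in> A j)" if "z \<in> cell c P (fst (F k))" for z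
  proof -
    have "c z (i j) = a (i j)" using that a[of "i j" k] F(2)[of k] by (auto simp: cell_iff k_def)
    moreover have "z \<in> space M" using that sp by (auto simp: cell_iff)
    ultimately show ?thesis using x(2)[of j] sp c(2)[of z j] by (auto simp: B_def of_bool_def split: if_splits)
  qed
  have cQ: "z \<in> space M \<and> (f z \<in> A j \<longleftrightarrow> f y \<in> A j)" if "z \<in> cell e Q (snd (F k))" for z
  proof -
    have "e z (i' j) = b (i' j)" using that b[of "i' j" k] F(3)[of k] by (auto simp: cell_iff k_def)
    moreover have "z \<in> space M" using that sp by (auto simp: cell_iff)
    ultimately show ?thesis using y(2)[of j] sp e(2)[of z j] by (auto simp: B_def of_bool_def split: if_splits)
  qed
  have "sep (cell c P (fst (F k))) (cell e Q (snd (F k)))"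
  proof (cases "f x \<in> A j")
    case True
    then show ?thesis unfolding sep_def
      by (intro bexI[of _ "A j"] conjI) (use cP cQ j Am in auto)
  next
    case False
    then show ?thesis unfolding sep_def
      by (intro bexI[of _ "space X - A j"] conjI) (use cP cQ j Am measurable_space[OF f] in auto)
  qed
  then show False using F(1) by blast
qed

text \<open>The Lusin--Souslin theorem.\<close>

theorem injective_borel_image:
  assumes M: "standard_borel_space M" and f: "f \<in> M \<rightarrow>\<^sub>M X" and A: "separating_sequence X A"
    and T: "T \<in> sets M" and inj: "inj_on f T"
  shows "f ` T \<in> sets X"
proof -
  have Am: "A j \<in> sets X" for j using A by (simp add: separating_sequence_def)
  define B where "B j = f -` A j \<inter> space M" for j
  have B: "B j \<in> sets M" for j unfolding B_def using f Am by (rule measurable_sets)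
  obtain c i where "coding M T B c i"
    using borel_coding[OF M T, of B] B by blast
  note c = codingD[OF this]
  have TM: "T \<subseteq> space M" using T by (rule sets.sets_into_space)
  have fT: "f z \<in> space X" if "z \<in> T" for z using measurable_space[OF f] that TM by blast
  let ?C = "cell c T"
  have C: "?C s \<in> sets M" for s by (rule cell_measurable[OF c(1) T])
  have "\<exists>D\<in>sets X. f ` ?C s \<subseteq> D \<and> f ` ?C t \<inter> D = {}" if "length s = length t" "s \<noteq> t" for s t
  proof (rule borel_separation[OF M f A C C])
    have "?C s \<inter> ?C t = {}" using that by (auto simp: cell_def)
    moreover have "?C s \<subseteq> T" "?C t \<subseteq> T" by (auto simp: cell_def)
    ultimately show "f ` ?C s \<inter> f ` ?C t = {}" using inj by (metis inj_on_image_Int image_empty)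
  qed
  note sepC = this
  define D where "D s t = (SOME D. D \<in> sets X \<and> f ` ?C s \<subseteq> D \<and> f ` ?C t \<inter> D = {})" for s t
  have D: "D s t \<in> sets X" "f ` ?C s \<subseteq> D s t" "f ` ?C t \<inter> D s t = {}"
    if "length s = length t" "s \<noteq> t" for s t
  proof -
    have "\<exists>D. D \<in> sets X \<and> f ` ?C s \<subseteq> D \<and> f ` ?C t \<inter> D = {}"
      using sepC[OF that] unfolding Bex_def .
    from someI_ex[OF this] show "D s t \<in> sets X" "f ` ?C s \<subseteq> D s t" "f ` ?C t \<inter> D s t = {}"
      unfolding D_def by simp_all
  qed
  define peers where "peers s = {t. length t = length s \<and> t \<noteq> s}" for s :: "nat list"
  \<comment> \<open>Subtracting \<open>D t s\<close> makes the sets \<open>E\<close> of one level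
    pairwise disjoint. The factor \<open>space X\<close> matters for \<open>s = []\<close>, which
    has no peers.\<close>
  define E where "E s = space X \<inter> (\<Inter>t\<in>peers s. D s t - D t s)" for s
  have cnt: "countable (peers s)" for s by (rule countable_subset[OF subset_UNIV]) simp
  have E: "E s \<in> sets X" for s
  proof (cases "peers s = {}")
    case True then show ?thesis by (simp add: E_def)
  next
    case False
    then show ?thesis unfolding E_def
      by (intro sets.Int sets.top sets.countable_INT'[OF cnt]) (use D(1) in \<open>auto simp: peers_def\<close>)
  qed
  have CE: "f ` ?C s \<subseteq> E s" for s
  proof -
    have "f ` ?C s \<subseteq> D s t" "f ` ?C s \<inter> D t s = {}" if "t \<in> peers s" for t
      using that D(2)[of s t] D(3)[of t s] by (auto simp: peers_def)
    moreover have "f ` ?C s \<subseteq> space X" using fT by (auto simp: cell_def)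
    ultimately show ?thesis unfolding E_def by blast
  qed
  have Edisj: "s = t" if "x \<in> E s" "x \<in> E t" "length s = length t" for s t x
  proof (rule ccontr)
    assume "s \<noteq> t"
    then have "t \<in> peers s" using that(3) by (auto simp: peers_def)
    moreover have "s \<in> peers t" using that(3) \<open>s \<noteq> t\<close> by (auto simp: peers_def)
    ultimately show False using that(1,2) by (auto simp: E_def)
  qed
  \<comment> \<open>The sets \<open>E\<close> of all prefixes force the lists found on successive
    levels to extend each other; the second factor makes \<open>y\<close> agree with the recorded
    membership in \<open>A j\<close>; empty cells are discarded so that the branch is
    realised.\<close>
  define W where "W s = (if ?C s = {} then {} else (\<Inter>m\<in>{..length s}. E (take m s)) \<inter>
      (\<Inter>j\<in>{j. i j < length s}. {y \<in> space X. y \<in> A j \<longleftrightarrow> s ! i j = 1}))" for s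
  have W: "W s \<in> sets X" for s
  proof -
    have "{y \<in> space X. y \<in> A j \<longleftrightarrow> v} \<in> sets X" for j v
      using Am[of j] sets.Diff[OF sets.top Am[of j]] sets.Int[OF sets.top Am[of j]]
      by (cases v) (simp_all add: set_diff_eq Int_def)
    then have *: "space X \<inter> (\<Inter>j\<in>{j. i j < length s}. {y \<in> space X. y \<in> A j \<longleftrightarrow> s ! i j = 1}) \<in> sets X"
      by (cases "{j. i j < length s} = {}") (auto intro!: sets.Int sets.countable_INT')
    have "(\<Inter>m\<in>{..length s}. E (take m s)) \<in> sets X" using E by (intro sets.finite_INT) auto
    moreover have "(\<Inter>m\<in>{..length s}. E (take m s)) \<subseteq> space X" by (auto simp: E_def)
    ultimately show ?thesis unfolding W_def using sets.Int[OF _ *, of "\<Inter>m\<in>{..length s}. E (take m s)"]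
      by (auto simp: Int_assoc[symmetric] Int_absorb2)
  qed
  have CW: "f ` ?C s \<subseteq> W s" for s
  proof
    fix y assume "y \<in> f ` ?C s"
    then obtain z where z: "z \<in> ?C s" "y = f z" by blast
    have "z \<in> ?C (take m s)" for m using z(1) by (auto simp: cell_iff)
    then have "y \<in> E (take m s)" for m using CE z(2) by blast
    moreover have "y \<in> A j \<longleftrightarrow> s ! i j = 1" if "i j < length s" for j
      using c(2)[of z j] z that TM by (auto simp: cell_iff B_def split: if_splits)
    moreover have "y \<in> space X" using z fT by (auto simp: cell_iff)
    ultimately show "y \<in> W s" using z(1) unfolding W_def by auto
  qed
  \<comment> \<open>A union over all branches of intersections would only be analytic. Disjointness
    on each level lets it be rewritten as an intersection of countable unions, which is
    Borel.\<close>
  have "f ` T = (\<Inter>k. \<Union>s\<in>{s. length s = k}. W s)"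
  proof (intro equalityI subsetI)
    fix y assume "y \<in> f ` T"
    then obtain z where z: "z \<in> T" "y = f z" by blast
    have "y \<in> W (map (c z) [0..<k])" for k
      by (rule set_mp[OF CW]) (use z in \<open>auto simp: cell_iff\<close>)
    then show "y \<in> (\<Inter>k. \<Union>s\<in>{s. length s = k}. W s)" by (force intro!: bexI)
  next
    fix y assume "y \<in> (\<Inter>k. \<Union>s\<in>{s. length s = k}. W s)"
    then have "\<forall>k. \<exists>s. length s = k \<and> y \<in> W s" by blast
    then obtain S where S: "\<And>k. length (S k) = k" "\<And>k. y \<in> W (S k)" by metis
    have ne: "?C (S k) \<noteq> {}" for k using S(2)[of k] by (auto simp: W_def split: if_splits)
    have yE: "y \<in> E (take m (S k))" if "m \<le> k" for m k
      using S(1)[of k] S(2)[of k] that by (auto simp: W_def split: if_splits)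
    \<comment> \<open>Both lists label a set \<open>E\<close> of level \<open>k\<close> that
      contains \<open>y\<close>, and these are disjoint.\<close>
    have "S k = take k (S (Suc k))" for k
      by (rule Edisj) (use yE[of k k] yE[of k "Suc k"] S(1)[of k] S(1)[of "Suc k"] in simp_all)
    then have ext: "\<exists>t. S (Suc k) = S k @ t" for k by (metis append_take_drop_id)
    obtain a where a: "\<And>k i. i < length (S k) \<Longrightarrow> S k ! i = a i"
      using prefix_chain_limit[of S] ext S(1) by (metis order_refl)
    obtain x where x: "x \<in> T" "\<And>j. x \<in> B j \<longleftrightarrow> a (i j) = 1"
      using c(3)[of a, OF cell_chain_realised[of c T S, OF ne a]] S(1) by auto
    have ysp: "y \<in> space X" using yE[of 0 0] by (auto simp: E_def)
    have "y \<in> A j \<longleftrightarrow> a (i j) = 1" for j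
      using S(1)[of "Suc (i j)"] S(2)[of "Suc (i j)"] a[of "i j" "Suc (i j)"]
      by (auto simp: W_def split: if_splits)
    then have "y \<in> A j \<longleftrightarrow> f x \<in> A j" for j using x TM by (auto simp: B_def)
    then have "y = f x" using A ysp fT[OF x(1)] unfolding separating_sequence_def by blast
    then show "y \<in> f ` T" using x(1) by blast
  qed
  also have "\<dots> \<in> sets X"
  proof -
    have "(\<Union>s\<in>{s. length s = k}. W s) \<in> sets X" for k
      using W by (intro sets.countable_UN') auto
    then show ?thesis by (intro sets.countable_INT) auto
  qed
  finally show ?thesis .
qed

text \<open>A countable fibre is complete, so by the Baire category theorem it has an isolated point.\<close>

lemma isolating_sequence:
  assumes M: "standard_borel_space M" and f: "f \<in> M \<rightarrow>\<^sub>M X" and A: "separating_sequence X A"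
    and T: "T \<in> sets M"
  shows "\<exists>Q :: nat \<Rightarrow> 'a set. (\<forall>n. Q n \<in> sets M \<and> Q n \<subseteq> T) \<and>
    (\<forall>x. countable {z \<in> T. f z = x} \<longrightarrow> {z \<in> T. f z = x} \<noteq> {} \<longrightarrow> (\<exists>n. \<exists>!z. z \<in> Q n \<and> f z = x))"
proof -
  obtain A' where A': "separating_sequence M A'" using standard_borel_separating[OF M] by blast
  have Am: "A j \<in> sets X" for j using A by (simp add: separating_sequence_def)
  \<comment> \<open>Even indices pull back the sets separating values of \<open>f\<close>, so that a
    realised point stays in the fibre over \<open>x\<close>. Odd indices separate the points of
    \<open>M\<close>, so that it can be kept different from each enumerated point of that
    fibre.\<close>
  define B where "B j = (if even j then f -` A (j div 2) \<inter> space M else A' (j div 2))" for j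
  have B: "B j \<in> sets M" for j unfolding B_def using measurable_sets[OF f Am] A'
    by (auto simp: separating_sequence_def)
  obtain c i where "coding M T B c i"
    using borel_coding[OF M T, of B] B by blast
  note c = codingD[OF this]
  have TM: "T \<subseteq> space M" using T by (rule sets.sets_into_space)
  have fT: "f z \<in> space X" if "z \<in> T" for z using measurable_space[OF f] that TM by blast
  have sep: "\<exists>j. (z \<in> B j) \<noteq> (w \<in> B j)" if "z \<in> T" "w \<in> T" "z \<noteq> w" for z w
  proof -
    have "z \<in> space M" "w \<in> space M" using that TM by auto
    then have "\<exists>j. (z \<in> A' j) \<noteq> (w \<in> A' j)"
      using A' that(3) unfolding separating_sequence_def by metis
    then obtain j where "(z \<in> A' j) \<noteq> (w \<in> A' j)" by blast
    then show ?thesis by (intro exI[of _ "2 * j + 1"]) (simp add: B_def)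
  qed
  define Q where "Q n = cell c T (from_nat n)" for n
  show ?thesis
  proof (intro exI[of _ Q] conjI allI impI)
    show "Q n \<in> sets M" for n unfolding Q_def by (rule cell_measurable[OF c(1) T])
    show "Q n \<subseteq> T" for n by (auto simp: Q_def cell_def)
  next
    fix x define D where "D = {z \<in> T. f z = x}"
    assume "countable {z \<in> T. f z = x}" "{z \<in> T. f z = x} \<noteq> {}"
    then have Dc: "countable D" and Dne: "D \<noteq> {}" by (auto simp: D_def)
    define d where "d = from_nat_into D"
    have d: "range d = D" unfolding d_def by (rule range_from_nat_into[OF Dne Dc])
    show "\<exists>n. \<exists>!z. z \<in> Q n \<and> f z = x"
    proof (rule ccontr)
      assume no: "\<not> ?thesis"
      have two: "\<exists>z\<in>D \<inter> cell c T s. z \<noteq> w" if "D \<inter> cell c T s \<noteq> {}" for s w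
      proof (rule ccontr)
        assume "\<not> ?thesis"
        then have "\<And>z. z \<in> D \<inter> cell c T s \<Longrightarrow> z = w" by blast
        moreover have "D \<inter> cell c T s = {z \<in> cell c T s. f z = x}" by (auto simp: D_def cell_def)
        ultimately have "\<exists>!z. z \<in> cell c T s \<and> f z = x" using that by blast
        then have "\<exists>!z. z \<in> Q (to_nat s) \<and> f z = x" by (simp add: Q_def)
        then show False using no by blast
      qed
      \<comment> \<open>As no cell isolates a point of the fibre, the cell contains some
        \<open>z\<close> other than \<open>w\<close>. Prolonging the code of \<open>z\<close> past a
        coordinate that distinguishes it from \<open>w\<close> excludes \<open>w\<close> for
        good.\<close>
      have step: "\<exists>t. D \<inter> cell c T (s @ t) \<noteq> {} \<and> Suc (length s) \<le> length (s @ t) \<and>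
          (\<exists>j. i j < length (s @ t) \<and> ((s @ t) ! i j = 1) \<noteq> (w \<in> B j))"
        if ne: "D \<inter> cell c T s \<noteq> {}" and w: "w \<in> D" for s w
      proof -
        obtain z where z: "z \<in> D" "z \<in> cell c T s" "z \<noteq> w" using two[OF ne, of w] by blast
        obtain j where j: "(z \<in> B j) \<noteq> (w \<in> B j)" using sep[of z w] z w by (auto simp: D_def)
        define n where "n = Suc (max (length s) (i j))"
        define t where "t = map (c z) [length s..<n]"
        have st: "s @ t = map (c z) [0..<n]"
        proof -
          have "[0..<n] = [0..<length s] @ [length s..<n]"
            using upt_add_eq_append[of 0 "length s" "n - length s"] by (simp add: n_def)
          then show ?thesis using z(2) by (simp add: t_def cell_def)
        qed
        have "z \<in> cell c T (s @ t)" unfolding st using z by (auto simp: cell_iff)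
        moreover have "Suc (length s) \<le> length (s @ t)" "i j < length (s @ t)"
          unfolding st by (auto simp: n_def)
        moreover have "(s @ t) ! i j = c z (i j)"
          unfolding st by (subst nth_map) (auto simp: n_def less_Suc_eq_le simp del: upt_Suc)
        then have "((s @ t) ! i j = 1) \<longleftrightarrow> z \<in> B j"
          using c(2)[of z j] by (auto simp: of_bool_def split: if_splits)
        ultimately show ?thesis using z(1) j by blast
      qed
      \<comment> \<open>Baire category as a diagonalisation: stage \<open>k\<close> excludes the
        point \<open>d k\<close>, yet the branch is realised by a point of the same fibre, which
        must be one of the \<open>d k\<close>.\<close>
      have "\<exists>S. \<forall>k. (D \<inter> cell c T (S k) \<noteq> {} \<and> k \<le> length (S k)) \<and>
          ((\<exists>t. S (Suc k) = S k @ t) \<and>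
           (\<exists>j. i j < length (S (Suc k)) \<and> (S (Suc k) ! i j = 1) \<noteq> (d k \<in> B j)))"
      proof (rule dependent_nat_choice)
        show "\<exists>s. D \<inter> cell c T s \<noteq> {} \<and> 0 \<le> length s"
          by (rule exI[of _ "[]"]) (use Dne in \<open>auto simp: D_def\<close>)
      next
        fix s k assume s: "D \<inter> cell c T s \<noteq> {} \<and> k \<le> length s"
        have "d k \<in> D" using d by blast
        then obtain t where "D \<inter> cell c T (s @ t) \<noteq> {}" "Suc (length s) \<le> length (s @ t)"
          "\<exists>j. i j < length (s @ t) \<and> ((s @ t) ! i j = 1) \<noteq> (d k \<in> B j)" using step s by blast
        then show "\<exists>s'. (D \<inter> cell c T s' \<noteq> {} \<and> Suc k \<le> length s') \<and> ((\<exists>t. s' = s @ t) \<and>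
           (\<exists>j. i j < length s' \<and> (s' ! i j = 1) \<noteq> (d k \<in> B j)))"
          using s by (intro exI[of _ "s @ t"]) auto
      qed
      then obtain S where S: "\<And>k. D \<inter> cell c T (S k) \<noteq> {}" "\<And>k. k \<le> length (S k)"
          "\<And>k. \<exists>t. S (Suc k) = S k @ t"
          "\<And>k. \<exists>j. i j < length (S (Suc k)) \<and> (S (Suc k) ! i j = 1) \<noteq> (d k \<in> B j)"
        by blast
      obtain a where a: "\<And>k i. i < length (S k) \<Longrightarrow> S k ! i = a i"
        using prefix_chain_limit[of S] S(2,3) by metis
      have ne: "cell c T (S k) \<noteq> {}" for k using S(1)[of k] by blast
      obtain y where y: "y \<in> T" "\<And>j. y \<in> B j \<longleftrightarrow> a (i j) = 1"
        using c(3)[of a, OF cell_chain_realised[of c T S, OF ne a]] S(2) by auto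
      have "f y \<in> A j \<longleftrightarrow> x \<in> A j" for j
      proof -
        obtain z where z: "z \<in> D" "z \<in> cell c T (S (Suc (i (2 * j))))" using S(1) by blast
        have "i (2 * j) < length (S (Suc (i (2 * j))))" using S(2)[of "Suc (i (2 * j))"] by simp
        then have "c z (i (2 * j)) = a (i (2 * j))" using z(2) a by (auto simp: cell_iff)
        then have "z \<in> B (2 * j) \<longleftrightarrow> y \<in> B (2 * j)" using c(2)[of z "2 * j"] y(2) by (auto simp: of_bool_def split: if_splits)
        then show ?thesis using z y(1) TM by (auto simp: B_def D_def cell_def)
      qed
      moreover have "x \<in> space X" using Dne fT by (auto simp: D_def)
      ultimately have "f y = x" using A fT[OF y(1)] unfolding separating_sequence_def by blast
      then have "y \<in> D" using y(1) by (simp add: D_def)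
      then obtain k where k: "y = d k" using d by blast
      obtain j where "i j < length (S (Suc k))" "(S (Suc k) ! i j = 1) \<noteq> (d k \<in> B j)" using S(4) by blast
      then show False using a y(2) k by metis
    qed
  qed
qed

section \<open>Measured groupoids\<close>

lemma reduction_simps [simp]:
  "arrows (reduction G U) = reduced_arrows G U" "rng (reduction G U) = rng G"
  "src (reduction G U) = src G" "mul (reduction G U) = mul G"
  by (auto simp: reduction_def arrows_def space_restrict_space reduced_arrows_def)

section \<open>Algebra of groupoids\<close>

locale gpd =
  fixes G :: "'a groupoid"
  assumes groupoid: "is_groupoid G"
begin

lemma units_arrows: "x \<in> units G \<Longrightarrow> x \<in> arrows G"
  by (simp add: units_def)

lemma rng_unit [simp]: "x \<in> units G \<Longrightarrow> rng G x = x"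
  by (simp add: units_def)

lemma src_unit [simp]: "x \<in> units G \<Longrightarrow> src G x = x"
  using groupoid by (simp add: is_groupoid_def)

lemma rng_in_units [simp]: "\<gamma> \<in> arrows G \<Longrightarrow> rng G \<gamma> \<in> units G"
  using groupoid by (simp add: is_groupoid_def)

lemma src_in_units [simp]: "\<gamma> \<in> arrows G \<Longrightarrow> src G \<gamma> \<in> units G"
  using groupoid by (simp add: is_groupoid_def)

lemma mul_closed:
  assumes "\<gamma> \<in> arrows G" "\<eta> \<in> arrows G" "src G \<gamma> = rng G \<eta>"
  shows "mul G \<gamma> \<eta> \<in> arrows G" "rng G (mul G \<gamma> \<eta>) = rng G \<gamma>" "src G (mul G \<gamma> \<eta>) = src G \<eta>"
proof -
  have "(\<gamma>, \<eta>) \<in> composable G" using assms by (simp add: composable_def)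
  then show "mul G \<gamma> \<eta> \<in> arrows G" "rng G (mul G \<gamma> \<eta>) = rng G \<gamma>" "src G (mul G \<gamma> \<eta>) = src G \<eta>"
    using groupoid unfolding is_groupoid_def by blast+
qed

lemma mul_assoc:
  assumes "\<gamma> \<in> arrows G" "\<eta> \<in> arrows G" "\<zeta> \<in> arrows G" "src G \<gamma> = rng G \<eta>" "src G \<eta> = rng G \<zeta>"
  shows "mul G (mul G \<gamma> \<eta>) \<zeta> = mul G \<gamma> (mul G \<eta> \<zeta>)"
proof -
  have "(\<gamma>, \<eta>) \<in> composable G" "(\<eta>, \<zeta>) \<in> composable G" using assms by (simp_all add: composable_def)
  then show ?thesis using groupoid unfolding is_groupoid_def by blast
qed

lemma mul_rng: "\<gamma> \<in> arrows G \<Longrightarrow> mul G (rng G \<gamma>) \<gamma> = \<gamma>"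
  and mul_src: "\<gamma> \<in> arrows G \<Longrightarrow> mul G \<gamma> (src G \<gamma>) = \<gamma>"
  using groupoid by (simp_all add: is_groupoid_def)

lemma ginv_closed [simp]:
  assumes "\<gamma> \<in> arrows G"
  shows "ginv G \<gamma> \<in> arrows G" "rng G (ginv G \<gamma>) = src G \<gamma>" "src G (ginv G \<gamma>) = rng G \<gamma>"
  using assms groupoid by (simp_all add: is_groupoid_def)

lemma mul_ginv: "\<gamma> \<in> arrows G \<Longrightarrow> mul G \<gamma> (ginv G \<gamma>) = rng G \<gamma>"
  and ginv_mul: "\<gamma> \<in> arrows G \<Longrightarrow> mul G (ginv G \<gamma>) \<gamma> = src G \<gamma>"
  using groupoid by (simp_all add: is_groupoid_def)

lemma ginv_mul_cancel:
  assumes "\<gamma> \<in> arrows G" "\<eta> \<in> arrows G" "src G \<gamma> = rng G \<eta>"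
  shows "mul G (ginv G \<gamma>) (mul G \<gamma> \<eta>) = \<eta>"
  using assms by (subst mul_assoc[symmetric]) (simp_all add: ginv_mul mul_rng)

lemma mul_ginv_cancel:
  assumes "\<gamma> \<in> arrows G" "\<eta> \<in> arrows G" "rng G \<gamma> = rng G \<eta>"
  shows "mul G \<gamma> (mul G (ginv G \<gamma>) \<eta>) = \<eta>"
  using assms by (subst mul_assoc[symmetric]) (simp_all add: mul_ginv mul_rng)

text \<open>Cancel one factor. This is how homomorphisms, which are only required to respect
  products, are seen to send units to units.\<close>

lemma idempotent_unit:
  assumes "\<gamma> \<in> arrows G" "src G \<gamma> = rng G \<gamma>" "mul G \<gamma> \<gamma> = \<gamma>"
  shows "\<gamma> = rng G \<gamma>"
  using ginv_mul_cancel[of \<gamma> \<gamma>] assms by (simp add: ginv_mul)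

lemma mul_left_eq_iff:
  assumes "\<gamma> \<in> arrows G" "\<eta> \<in> arrows G" "src G \<gamma> = rng G \<eta>"
  shows "mul G \<gamma> \<eta> = \<gamma> \<longleftrightarrow> \<eta> = src G \<gamma>"
proof
  assume "mul G \<gamma> \<eta> = \<gamma>"
  then show "\<eta> = src G \<gamma>" using ginv_mul_cancel[OF assms] assms(1) by (simp add: ginv_mul)
qed (use assms(1) mul_src in simp)

end

text \<open>Agreement of two values is agreement on countably many Borel sets.\<close>

lemma measurable_equal:
  assumes A: "separating_sequence M A"
    and [measurable]: "f \<in> N \<rightarrow>\<^sub>M M" "g \<in> N \<rightarrow>\<^sub>M M"
  shows "{x \<in> space N. f x = g x} \<in> sets N"
proof -
  have [measurable]: "A j \<in> sets M" for j using A by (simp add: separating_sequence_def)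
  have "{x \<in> space N. f x = g x} = {x \<in> space N. \<forall>j. f x \<in> A j \<longleftrightarrow> g x \<in> A j}"
  proof (intro Collect_cong conj_cong refl iffI)
    fix x assume x: "x \<in> space N" "\<forall>j. f x \<in> A j \<longleftrightarrow> g x \<in> A j"
    then have "f x \<in> space M" "g x \<in> space M"
      using measurable_space[OF assms(2)] measurable_space[OF assms(3)] by auto
    then show "f x = g x" using A x(2) unfolding separating_sequence_def by metis
  qed simp
  also have "\<dots> \<in> sets N" by measurable
  finally show ?thesis .
qed

section \<open>Borel groupoids\<close>

locale borel_gpd = gpd G for G :: "'a groupoid" +
  assumes borel: "borel_groupoid G"
begin

lemma space_borel [simp]: "space (borel_of G) = arrows G"
  by (simp add: arrows_def)

lemma arrows_measurable [measurable, simp]: "arrows G \<in> sets (borel_of G)"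
  using sets.top[of "borel_of G"] by simp

lemma standard: "standard_borel_space (borel_of G)"
  and rng_measurable [measurable]: "rng G \<in> borel_of G \<rightarrow>\<^sub>M borel_of G"
  and src_measurable [measurable]: "src G \<in> borel_of G \<rightarrow>\<^sub>M borel_of G"
  and ginv_measurable [measurable]: "ginv G \<in> borel_of G \<rightarrow>\<^sub>M borel_of G"
  using borel by (simp_all add: borel_groupoid_def)

lemma sets_equal:
  assumes "f \<in> N \<rightarrow>\<^sub>M borel_of G" "g \<in> N \<rightarrow>\<^sub>M borel_of G"
  shows "{x \<in> space N. f x = g x} \<in> sets N"
proof -
  obtain A where "separating_sequence (borel_of G) A" using standard_borel_separating[OF standard] by blast
  then show ?thesis using assms by (rule measurable_equal)
qed

lemma singleton_measurable [measurable]: "{\<gamma>} \<in> sets (borel_of G)" if "\<gamma> \<in> arrows G"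
proof -
  have "{x \<in> space (borel_of G). x = \<gamma>} \<in> sets (borel_of G)"
    by (rule sets_equal[OF measurable_ident_sets[OF refl]]) (use that in simp)
  also have "{x \<in> space (borel_of G). x = \<gamma>} = {\<gamma>}" using that by auto
  finally show ?thesis .
qed

lemma units_measurable [measurable]: "units G \<in> sets (borel_of G)"
proof -
  have "{x \<in> space (borel_of G). rng G x = x} \<in> sets (borel_of G)"
    by (rule sets_equal[OF rng_measurable]) (rule measurable_ident_sets[OF refl])
  then show ?thesis by (simp add: units_def del: rng_unit)
qed

text \<open>Multiplication is Borel on composable pairs only, so composability is demanded on all of
  \<open>space N\<close>; this is why the applications work on restricted spaces.\<close>

lemma mul_measurable:
  assumes "f \<in> N \<rightarrow>\<^sub>M borel_of G" "g \<in> N \<rightarrow>\<^sub>M borel_of G"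
    and "\<And>x. x \<in> space N \<Longrightarrow> src G (f x) = rng G (g x)"
  shows "(\<lambda>x. mul G (f x) (g x)) \<in> N \<rightarrow>\<^sub>M borel_of G"
proof -
  have m: "(\<lambda>(\<gamma>, \<eta>). mul G \<gamma> \<eta>)
        \<in> restrict_space (borel_of G \<Otimes>\<^sub>M borel_of G) (composable G) \<rightarrow>\<^sub>M borel_of G"
    using borel by (simp add: borel_groupoid_def)
  have "(\<lambda>x. (f x, g x)) \<in> N \<rightarrow>\<^sub>M restrict_space (borel_of G \<Otimes>\<^sub>M borel_of G) (composable G)"
    using assms measurable_space[OF assms(1)] measurable_space[OF assms(2)]
    by (intro measurable_restrict_space2) (auto simp: composable_def)
  from measurable_compose[OF this m] show ?thesis by simp
qed

lemma space_unit_space [simp]: "space (unit_space G) = units G"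
  using units_arrows by (auto simp: unit_space_def space_restrict_space)

lemma sets_unit_space: "A \<in> sets (unit_space G) \<longleftrightarrow> A \<in> sets (borel_of G) \<and> A \<subseteq> units G"
proof -
  have "units G \<inter> space (borel_of G) \<in> sets (borel_of G)" by (intro sets.Int units_measurable sets.top)
  then show ?thesis unfolding unit_space_def by (subst sets_restrict_space_iff) auto
qed

lemma measurable_unit_spaceI:
  assumes "f \<in> N \<rightarrow>\<^sub>M borel_of G" "\<And>x. x \<in> space N \<Longrightarrow> f x \<in> units G"
  shows "f \<in> N \<rightarrow>\<^sub>M unit_space G"
  unfolding unit_space_def using assms by (intro measurable_restrict_space2) auto

lemma measurable_unit_spaceD: "f \<in> borel_of G \<rightarrow>\<^sub>M N \<Longrightarrow> f \<in> unit_space G \<rightarrow>\<^sub>M N"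
  unfolding unit_space_def by (rule measurable_restrict_space1)

lemma rng_unit_space [measurable]: "rng G \<in> borel_of G \<rightarrow>\<^sub>M unit_space G"
  and src_unit_space [measurable]: "src G \<in> borel_of G \<rightarrow>\<^sub>M unit_space G"
  by (auto intro!: measurable_unit_spaceI)

lemma reduced_arrows_measurable:
  assumes "U \<in> sets (unit_space G)" shows "reduced_arrows G U \<in> sets (borel_of G)"
proof -
  have [measurable]: "U \<in> sets (borel_of G)" using assms sets_unit_space by auto
  have "{\<gamma> \<in> space (borel_of G). rng G \<gamma> \<in> U \<and> src G \<gamma> \<in> U} \<in> sets (borel_of G)" by measurable
  then show ?thesis by (simp add: reduced_arrows_def)
qed

lemma fibre_measurable:
  assumes "x \<in> units G" shows "range_fibre G x \<in> sets (borel_of G)"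
proof -
  have "{\<gamma> \<in> space (borel_of G). rng G \<gamma> = x} \<in> sets (borel_of G)"
    by (rule sets_equal) (use assms units_arrows in auto)
  then show ?thesis by (simp add: range_fibre_def)
qed

lemma units_reduction:
  assumes "U \<subseteq> units G" shows "units (reduction G U) = U"
proof -
  have "x \<in> units (reduction G U) \<longleftrightarrow> x \<in> reduced_arrows G U \<and> rng G x = x" for x
    by (simp add: units_def del: rng_unit)
  then show ?thesis using assms units_arrows by (auto simp: reduced_arrows_def)
qed

lemma emeasure_translate:
  assumes \<gamma>: "\<gamma> \<in> arrows G" and \<mu>: "sets \<mu> = sets (borel_of G)" and A: "A \<in> sets (borel_of G)"
  shows "emeasure (translate G \<gamma> \<mu>) A = emeasure \<mu> {\<eta> \<in> range_fibre G (src G \<gamma>). mul G \<gamma> \<eta> \<in> A}"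
proof -
  let ?F = "range_fibre G (src G \<gamma>)"
  have F: "?F \<in> sets (borel_of G)" using \<gamma> by (intro fibre_measurable) simp
  then have F': "?F \<inter> space \<mu> \<in> sets \<mu>" using \<mu> by (metis sets.Int sets.top)
  have sp: "space \<mu> = arrows G" using sets_eq_imp_space_eq[OF \<mu>] by simp
  have FA: "?F \<subseteq> arrows G" by (auto simp: range_fibre_def)
  have id: "(\<lambda>\<eta>. \<eta>) \<in> restrict_space \<mu> ?F \<rightarrow>\<^sub>M borel_of G"
    by (rule measurable_restrict_space1) (simp add: measurable_ident_sets \<mu>)
  have m: "mul G \<gamma> \<in> restrict_space \<mu> ?F \<rightarrow>\<^sub>M borel_of G"
    by (rule mul_measurable[OF _ id]) (use \<gamma> in \<open>auto simp: space_restrict_space range_fibre_def\<close>)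
  have "emeasure (translate G \<gamma> \<mu>) A = emeasure (restrict_space \<mu> ?F) (mul G \<gamma> -` A \<inter> space (restrict_space \<mu> ?F))"
    unfolding translate_def by (rule emeasure_distr[OF m A])
  also have "\<dots> = emeasure \<mu> (mul G \<gamma> -` A \<inter> space (restrict_space \<mu> ?F))"
    by (rule emeasure_restrict_space[OF F']) (auto simp: space_restrict_space)
  also have "mul G \<gamma> -` A \<inter> space (restrict_space \<mu> ?F) = {\<eta> \<in> ?F. mul G \<gamma> \<eta> \<in> A}"
    using FA sp by (auto simp: space_restrict_space)
  finally show ?thesis .
qed

lemma sets_translate [simp]: "sets (translate G \<gamma> \<mu>) = sets (borel_of G)"
  by (simp add: translate_def)

end

section \<open>Measure classes and fibre measures\<close>

lemma equivalent_measures_AE: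
  assumes "equivalent_measures \<mu> \<nu>" shows "(AE x in \<mu>. P x) \<longleftrightarrow> (AE x in \<nu>. P x)"
  using assms absolutely_continuous_AE[of \<mu> \<nu>] absolutely_continuous_AE[of \<nu> \<mu>]
  by (auto simp: equivalent_measures_def)

lemma equivalent_measures_trans:
  "equivalent_measures \<mu> \<nu> \<Longrightarrow> equivalent_measures \<nu> \<rho> \<Longrightarrow> equivalent_measures \<mu> \<rho>"
  unfolding equivalent_measures_def absolutely_continuous_def by auto

lemma equivalent_measures_sym: "equivalent_measures \<mu> \<nu> \<Longrightarrow> equivalent_measures \<nu> \<mu>"
  unfolding equivalent_measures_def by auto

lemma equivalent_measures_refl: "equivalent_measures \<mu> \<mu>"
  unfolding equivalent_measures_def absolutely_continuous_def by auto

lemma equivalent_measures_null_iff: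
  "equivalent_measures \<mu> \<nu> \<Longrightarrow> A \<in> sets \<mu> \<Longrightarrow> emeasure \<mu> A = 0 \<longleftrightarrow> emeasure \<nu> A = 0"
  unfolding equivalent_measures_def absolutely_continuous_def null_sets_def by auto

text \<open>The witnesses of invariance are fixed once, so that almost-everywhere statements about
  the class refer to the single probability measure \<open>\<nu>\<close> and its disintegration
  \<open>K\<close>.\<close>

locale measured_gpd = borel_gpd G for G :: "'a groupoid" +
  fixes C :: "'a measure set" and \<nu> :: "'a measure" and K :: "'a \<Rightarrow> 'a measure" and V :: "'a set"
  assumes measured: "measured_groupoid G C"
    and \<nu>_class: "\<nu> \<in> C" and \<nu>_prob: "prob_space \<nu>"
    and K: "range_disintegration G \<nu> K"
    and V: "conull_units G C V"
    and K_invariant: "\<And>\<gamma>. \<gamma> \<in> reduced_arrows G V \<Longrightarrow>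
      equivalent_measures (translate G \<gamma> (K (src G \<gamma>))) (K (rng G \<gamma>))"

lemma measured_gpdI:
  assumes "measured_groupoid G C" obtains \<nu> K V where "measured_gpd G C \<nu> K V"
proof -
  obtain \<nu> K V where "\<nu> \<in> C \<and> prob_space \<nu> \<and> range_disintegration G \<nu> K \<and> conull_units G C V \<and>
      (\<forall>\<gamma>\<in>reduced_arrows G V. equivalent_measures (translate G \<gamma> (K (src G \<gamma>))) (K (rng G \<gamma>)))"
    using assms unfolding measured_groupoid_def invariant_class_def by auto
  moreover have "is_groupoid G" "borel_groupoid G"
    using assms unfolding measured_groupoid_def borel_groupoid_def by auto
  ultimately have "measured_gpd G C \<nu> K V"
    using assms
    by (simp add: measured_gpd_def measured_gpd_axioms_def borel_gpd_def borel_gpd_axioms_def gpd_def)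
  then show ?thesis by (rule that)
qed

context measured_gpd
begin

lemma class_equivalent:
  assumes "\<mu> \<in> C" shows "equivalent_measures \<mu> \<nu>"
proof -
  obtain \<rho> where "C = class_of \<rho>"
    using measured unfolding measured_groupoid_def measure_class_def by auto
  then have "equivalent_measures \<mu> \<rho>" "equivalent_measures \<nu> \<rho>"
    using assms \<nu>_class by (auto simp: class_of_def)
  then show ?thesis using equivalent_measures_trans equivalent_measures_sym by blast
qed

lemma sets_class: assumes "\<mu> \<in> C" shows "sets \<mu> = sets (borel_of G)"
proof -
  obtain \<rho> where "sets \<rho> = sets (borel_of G)" "C = class_of \<rho>"
    using measured unfolding measured_groupoid_def measure_class_def by auto
  then show ?thesis using assms by (auto simp: class_of_def equivalent_measures_def)
qed

lemma sets_\<nu> [simp, measurable_cong]: "sets \<nu> = sets (borel_of G)"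
  using sets_class \<nu>_class by blast

lemma space_\<nu> [simp]: "space \<nu> = arrows G"
  using sets_eq_imp_space_eq[OF sets_\<nu>] by simp

lemma ae_class_iff: "ae_class C P \<longleftrightarrow> (AE \<gamma> in \<nu>. P \<gamma>)"
  unfolding ae_class_def using \<nu>_class class_equivalent equivalent_measures_AE by blast

lemma range_measure_equivalent:
  assumes "\<mu> \<in> C" shows "equivalent_measures (range_measure G \<mu>) (range_measure G \<nu>)"
proof -
  have s: "sets \<mu> = sets (borel_of G)" using assms by (rule sets_class)
  have m: "rng G \<in> \<mu> \<rightarrow>\<^sub>M unit_space G" "rng G \<in> \<nu> \<rightarrow>\<^sub>M unit_space G"
    using rng_unit_space s by (simp_all cong: measurable_cong_sets)
  have sp: "space \<mu> = space \<nu>" using sets_eq_imp_space_eq[OF s] by simp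
  have e: "emeasure (range_measure G \<mu>) A = 0 \<longleftrightarrow> emeasure (range_measure G \<nu>) A = 0"
    if "A \<in> sets (unit_space G)" for A
    unfolding range_measure_def emeasure_distr[OF m(1) that] emeasure_distr[OF m(2) that] sp[symmetric]
    by (rule equivalent_measures_null_iff[OF class_equivalent[OF assms] measurable_sets[OF m(1) that]])
  then show ?thesis
    unfolding equivalent_measures_def absolutely_continuous_def null_sets_def
    by (auto simp: range_measure_def)
qed

lemma range_class_equivalent: "\<mu> \<in> range_class G C \<Longrightarrow> equivalent_measures \<mu> (range_measure G \<nu>)"
  unfolding range_class_def class_of_def
  using range_measure_equivalent equivalent_measures_trans by blast

lemma rng_\<nu>: "rng G \<in> \<nu> \<rightarrow>\<^sub>M unit_space G"
  using rng_unit_space by (simp cong: measurable_cong_sets)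

lemma range_measure_in_class: "range_measure G \<nu> \<in> range_class G C"
proof -
  interpret prob_space \<nu> by (rule \<nu>_prob)
  have "prob_space (range_measure G \<nu>)" unfolding range_measure_def by (rule prob_space_distr[OF rng_\<nu>])
  then have "range_measure G \<nu> \<in> class_of (range_measure G \<nu>)"
    unfolding class_of_def
    by (auto simp: equivalent_measures_refl prob_space_imp_sigma_finite)
  then show ?thesis unfolding range_class_def using \<nu>_class \<nu>_prob by blast
qed

lemma ae_range_class_iff: "ae_class (range_class G C) P \<longleftrightarrow> (AE x in range_measure G \<nu>. P x)"
  unfolding ae_class_def
  using range_measure_in_class range_class_equivalent equivalent_measures_AE by blast

lemma null_units_iff:
  "null_units G C E \<longleftrightarrow> E \<in> sets (unit_space G) \<and> (AE \<gamma> in \<nu>. rng G \<gamma> \<notin> E)"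
proof -
  have "null_units G C E \<longleftrightarrow> E \<in> null_sets (range_measure G \<nu>)"
    unfolding null_units_def
    using range_measure_in_class range_class_equivalent
    by (auto simp: equivalent_measures_def absolutely_continuous_def)
  also have "\<dots> \<longleftrightarrow> E \<in> sets (unit_space G) \<and> (AE x in range_measure G \<nu>. x \<notin> E)"
    using AE_iff_null_sets[of E "range_measure G \<nu>"] by (auto simp: range_measure_def null_sets_def)
  also have "\<dots> \<longleftrightarrow> E \<in> sets (unit_space G) \<and> (AE \<gamma> in \<nu>. rng G \<gamma> \<notin> E)"
  proof (intro conj_cong refl)
    assume "E \<in> sets (unit_space G)"
    then have "{x \<in> space (unit_space G). x \<notin> E} \<in> sets (unit_space G)" by measurable
    then show "(AE x in range_measure G \<nu>. x \<notin> E) \<longleftrightarrow> (AE \<gamma> in \<nu>. rng G \<gamma> \<notin> E)"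
      unfolding range_measure_def by (rule AE_distr_iff[OF rng_\<nu>])
  qed
  finally show ?thesis .
qed

lemma conull_units_iff:
  "conull_units G C U \<longleftrightarrow> U \<in> sets (unit_space G) \<and> (AE \<gamma> in \<nu>. rng G \<gamma> \<in> U)"
proof -
  have "(AE \<gamma> in \<nu>. rng G \<gamma> \<notin> units G - U) \<longleftrightarrow> (AE \<gamma> in \<nu>. rng G \<gamma> \<in> U)"
    by (rule AE_cong) simp
  moreover have "units G - U \<in> sets (unit_space G)" if "U \<in> sets (unit_space G)"
    using that sets.compl_sets[of U "unit_space G"] by simp
  ultimately show ?thesis unfolding conull_units_def null_units_iff by blast
qed

lemma conull_subset: "conull_units G C U \<Longrightarrow> U \<subseteq> units G"
  and conull_sets: "conull_units G C U \<Longrightarrow> U \<in> sets (borel_of G)"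
  using sets_unit_space by (auto simp: conull_units_iff)

lemma conull_Int: "conull_units G C U \<Longrightarrow> conull_units G C W \<Longrightarrow> conull_units G C (U \<inter> W)"
  by (auto simp: conull_units_iff)

lemma AE_ginv: assumes "AE \<gamma> in \<nu>. P \<gamma>" shows "AE \<gamma> in \<nu>. P (ginv G \<gamma>)"
proof -
  have g: "ginv G \<in> \<nu> \<rightarrow>\<^sub>M borel_of G" using ginv_measurable by (simp cong: measurable_cong_sets)
  have "equivalent_measures \<nu> (distr \<nu> (borel_of G) (ginv G))"
    using measured \<nu>_class unfolding measured_groupoid_def symmetric_class_def by blast
  then have "AE \<gamma> in distr \<nu> (borel_of G) (ginv G). P \<gamma>" using assms equivalent_measures_AE by blast
  then show ?thesis by (rule AE_distrD[OF g])
qed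

text \<open>Conullity controls ranges only; symmetry of the class transfers it to sources.\<close>

lemma AE_reduced:
  assumes "conull_units G C U" shows "AE \<gamma> in \<nu>. \<gamma> \<in> reduced_arrows G U"
proof -
  have 1: "AE \<gamma> in \<nu>. rng G \<gamma> \<in> U" using assms by (simp add: conull_units_iff)
  note 2 = AE_ginv[OF 1]
  show ?thesis using 1 2 AE_space
  proof eventually_elim
    case (elim \<gamma>)
    then show ?case by (simp add: reduced_arrows_def)
  qed
qed

lemma ae_class_reduced:
  assumes "conull_units G C U" "\<And>\<gamma>. \<gamma> \<in> reduced_arrows G U \<Longrightarrow> P \<gamma>" shows "ae_class C P"
  unfolding ae_class_iff using AE_reduced[OF assms(1)] by eventually_elim (rule assms(2))

text \<open>Trades the exceptional null set for a conull Borel set on which the property holds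
  everywhere, the form from which reductions are built.\<close>

lemma ae_range_class_conull:
  "ae_class (range_class G C) P \<longleftrightarrow> (\<exists>U. conull_units G C U \<and> (\<forall>x\<in>U. P x))"
proof
  assume "ae_class (range_class G C) P"
  then have "AE x in range_measure G \<nu>. P x" by (simp add: ae_range_class_iff)
  then obtain N where N: "{x \<in> space (range_measure G \<nu>). \<not> P x} \<subseteq> N" "N \<in> null_sets (range_measure G \<nu>)"
    by (auto elim!: AE_E simp: null_sets_def)
  have sp: "space (range_measure G \<nu>) = units G" by (simp add: range_measure_def)
  have Nu: "N \<in> sets (unit_space G)" using N(2) by (simp add: range_measure_def null_sets_def)
  have "AE x in range_measure G \<nu>. x \<notin> N" using N(2) by (rule AE_not_in)
  then have "AE \<gamma> in \<nu>. rng G \<gamma> \<notin> N" unfolding range_measure_def by (rule AE_distrD[OF rng_\<nu>])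
  then have "AE \<gamma> in \<nu>. rng G \<gamma> \<in> units G - N" using AE_space by eventually_elim simp
  moreover have "units G - N \<in> sets (unit_space G)" using sets.compl_sets[OF Nu] by simp
  ultimately have "conull_units G C (units G - N)" by (simp add: conull_units_iff)
  moreover have "\<forall>x\<in>units G - N. P x" using N(1) sp by auto
  ultimately show "\<exists>U. conull_units G C U \<and> (\<forall>x\<in>U. P x)" by blast
next
  assume "\<exists>U. conull_units G C U \<and> (\<forall>x\<in>U. P x)"
  then obtain U where U: "conull_units G C U" "\<forall>x\<in>U. P x" by blast
  have Us: "U \<in> sets (unit_space G)" using U(1) by (simp add: conull_units_iff)
  then have "{x \<in> space (unit_space G). x \<in> U} \<in> sets (unit_space G)" by measurable
  then have "AE x in range_measure G \<nu>. x \<in> U"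
    unfolding range_measure_def using U(1) by (subst AE_distr_iff[OF rng_\<nu>]) (auto simp: conull_units_iff)
  then show "ae_class (range_class G C) P" unfolding ae_range_class_iff
    by eventually_elim (use U(2) in blast)
qed

lemma K_sets: "x \<in> units G \<Longrightarrow> sets (K x) = sets (borel_of G)"
  and K_prob: "x \<in> units G \<Longrightarrow> prob_space (K x)"
proof -
  have "K \<in> unit_space G \<rightarrow>\<^sub>M prob_algebra (borel_of G)" using K by (simp add: range_disintegration_def)
  then have "K x \<in> space (prob_algebra (borel_of G))" if "x \<in> units G" for x
    using that by (auto dest: measurable_space)
  then show "x \<in> units G \<Longrightarrow> sets (K x) = sets (borel_of G)" "x \<in> units G \<Longrightarrow> prob_space (K x)"
    by (auto simp: space_prob_algebra)
qed

lemma K_measurable: "K \<in> unit_space G \<rightarrow>\<^sub>M subprob_algebra (borel_of G)"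
  using K by (auto simp: range_disintegration_def intro: measurable_prob_algebraD)

lemma K_fibre: "x \<in> units G \<Longrightarrow> AE \<gamma> in K x. \<gamma> \<in> range_fibre G x"
  using K by (simp add: range_disintegration_def)

text \<open>By the disintegration formula, since the integral of a nonnegative function vanishes
  exactly when the function vanishes almost everywhere.\<close>

lemma K_null:
  assumes A: "A \<in> sets (borel_of G)"
  shows "emeasure \<nu> A = 0 \<longleftrightarrow> (\<exists>U. conull_units G C U \<and> (\<forall>x\<in>U. emeasure (K x) A = 0))"
proof -
  have "emeasure \<nu> A = (\<integral>\<^sup>+ x. emeasure (K x) A \<partial>range_measure G \<nu>)"
    using K A by (simp add: range_disintegration_def)
  moreover have "(\<lambda>x. emeasure (K x) A) \<in> borel_measurable (range_measure G \<nu>)"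
    using measurable_emeasure_kernel[OF K_measurable A] by (simp add: range_measure_def)
  ultimately have "emeasure \<nu> A = 0 \<longleftrightarrow> (AE x in range_measure G \<nu>. emeasure (K x) A = 0)"
    by (simp add: nn_integral_0_iff_AE)
  also have "\<dots> \<longleftrightarrow> (\<exists>U. conull_units G C U \<and> (\<forall>x\<in>U. emeasure (K x) A = 0))"
    using ae_range_class_conull ae_range_class_iff by blast
  finally show ?thesis .
qed

lemma K_translate_null_iff:
  assumes \<gamma>: "\<gamma> \<in> reduced_arrows G V" and A: "A \<in> sets (borel_of G)"
  shows "emeasure (K (src G \<gamma>)) {\<eta> \<in> range_fibre G (src G \<gamma>). mul G \<gamma> \<eta> \<in> A} = 0 \<longleftrightarrow>
    emeasure (K (rng G \<gamma>)) A = 0"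
proof -
  have "\<gamma> \<in> arrows G" using \<gamma> by (simp add: reduced_arrows_def)
  then show ?thesis
    using equivalent_measures_null_iff[OF K_invariant[OF \<gamma>], of A] A
      emeasure_translate[of \<gamma> "K (src G \<gamma>)" A] K_sets[of "src G \<gamma>"] by simp
qed

text \<open>Almost every fibre measure has an atom; translating that atom back to a unit shows that the
  units charged by their own fibre measure are the sources of almost all arrows. By symmetry they are
  conull, and translating again, all arrows of a reduction are atoms.\<close>

lemma charged_reduction:
  assumes "r_discrete G C"
  obtains U where "conull_units G C U"
    "\<And>\<gamma>. \<gamma> \<in> reduced_arrows G U \<Longrightarrow> emeasure (K (rng G \<gamma>)) {\<gamma>} \<noteq> 0"
    "\<And>x. countable {\<gamma> \<in> reduced_arrows G U. rng G \<gamma> = x}"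
proof -
  obtain D where D: "conull_units G C D"
      "\<forall>x\<in>units (reduction G D). countable (range_fibre (reduction G D) x)"
    using assms unfolding r_discrete_def by blast
  define W where "W = D \<inter> V"
  have W: "conull_units G C W" unfolding W_def by (rule conull_Int[OF D(1) V])
  let ?R = "reduced_arrows G W"
  have WD: "?R \<subseteq> reduced_arrows G D" "?R \<subseteq> reduced_arrows G V" by (auto simp: reduced_arrows_def W_def)
  have RA: "?R \<subseteq> arrows G" by (auto simp: reduced_arrows_def)
  have cnt: "countable {\<gamma> \<in> ?R. rng G \<gamma> = x}" for x
  proof (cases "x \<in> W")
    case True
    then have "x \<in> D" "x \<in> units G" using conull_subset[OF D(1)] by (auto simp: W_def)
    then have "x \<in> units (reduction G D)"
      using units_reduction[OF conull_subset[OF D(1)]] by simp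
    then have "countable (range_fibre (reduction G D) x)" using D(2) by blast
    moreover have "{\<gamma> \<in> ?R. rng G \<gamma> = x} \<subseteq> range_fibre (reduction G D) x"
      using WD RA by (auto simp: range_fibre_def)
    ultimately show ?thesis by (rule countable_subset[rotated])
  next
    case False
    then have "{\<gamma> \<in> ?R. rng G \<gamma> = x} = {}" by (auto simp: reduced_arrows_def)
    then show ?thesis by (simp only: countable_empty)
  qed
  define A where "A = {x \<in> units G. emeasure (K x) (units G) \<noteq> 0}"
  have "{x \<in> space (unit_space G). emeasure (K x) (units G) \<noteq> 0} \<in> sets (unit_space G)"
    using measurable_emeasure_kernel[OF K_measurable units_measurable] by measurable
  then have Au: "A \<in> sets (unit_space G)" by (simp add: A_def)
  then have A [measurable]: "A \<in> sets (borel_of G)" by (simp add: sets_unit_space)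
  \<comment> \<open>The only unit in the range fibre of \<open>x\<close> is \<open>x\<close>. The
    fixed Borel set \<open>units G\<close> can therefore replace the varying singleton, which is
    what makes \<open>A\<close> measurable.\<close>
  have K_unit: "emeasure (K x) (units G) = emeasure (K x) {x}" if "x \<in> units G" for x
  proof (rule emeasure_eq_AE)
    show "AE y in K x. (y \<in> units G) = (y \<in> {x})"
      using K_fibre[OF that] by eventually_elim (use that in \<open>auto simp: range_fibre_def\<close>)
  qed (use that K_sets units_arrows in auto)
  have src_A: "src G \<gamma> \<in> A" if \<gamma>: "\<gamma> \<in> ?R" and atom: "emeasure (K (rng G \<gamma>)) {\<gamma>} \<noteq> 0" for \<gamma>
  proof -
    have \<gamma>A: "\<gamma> \<in> arrows G" using \<gamma> RA by blast
    have inv: "ginv G \<gamma> \<in> reduced_arrows G V" using \<gamma> WD \<gamma>A by (auto simp: reduced_arrows_def)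
    have "{\<eta> \<in> range_fibre G (src G (ginv G \<gamma>)). mul G (ginv G \<gamma>) \<eta> \<in> {src G \<gamma>}} = {\<gamma>}"
    proof (intro equalityI subsetI)
      fix \<eta> assume "\<eta> \<in> {\<eta> \<in> range_fibre G (src G (ginv G \<gamma>)). mul G (ginv G \<gamma>) \<eta> \<in> {src G \<gamma>}}"
      then have \<eta>: "\<eta> \<in> arrows G" "rng G \<eta> = rng G \<gamma>" "mul G (ginv G \<gamma>) \<eta> = src G \<gamma>"
        using \<gamma>A by (auto simp: range_fibre_def)
      then show "\<eta> \<in> {\<gamma>}" using mul_ginv_cancel[of \<gamma> \<eta>] \<gamma>A by (simp add: mul_src)
    qed (use \<gamma>A ginv_mul in \<open>auto simp: range_fibre_def\<close>)
    then have "emeasure (K (src G \<gamma>)) {src G \<gamma>} \<noteq> 0"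
      using K_translate_null_iff[OF inv, of "{src G \<gamma>}"] \<gamma>A atom units_arrows by simp
    then show ?thesis using K_unit[of "src G \<gamma>"] \<gamma>A by (simp add: A_def)
  qed
  define B where "B = {\<gamma> \<in> arrows G. src G \<gamma> \<in> A}"
  have B: "B \<in> sets (borel_of G)"
  proof -
    have "{\<gamma> \<in> space (borel_of G). src G \<gamma> \<in> A} \<in> sets (borel_of G)" by measurable
    then show ?thesis by (simp add: B_def)
  qed
  have R: "?R \<in> sets (borel_of G)" using W by (intro reduced_arrows_measurable) (simp add: conull_units_iff)
  have "emeasure \<nu> (arrows G - ?R) = 0"
    using AE_reduced[OF W] R by (subst (asm) AE_iff_null) (auto simp: null_sets_def set_diff_eq)
  then obtain W' where W': "conull_units G C W'" "\<forall>x\<in>W'. emeasure (K x) (arrows G - ?R) = 0"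
    using K_null[of "arrows G - ?R"] R sets.compl_sets[OF R] by auto
  have "emeasure (K x) (arrows G - B) = 0" if x: "x \<in> W \<inter> W'" for x
  proof -
    have xu: "x \<in> units G" using x conull_subset[OF W] by blast
    note s = K_sets[OF xu]
    \<comment> \<open>By \<open>src_A\<close>, an arrow of the reduction whose source misses
      \<open>A\<close> has no mass; a fibre contains only countably many of them, so together they
      are null.\<close>
    define F where "F = {\<gamma> \<in> ?R. rng G \<gamma> = x} - B"
    have "F \<in> null_sets (K x)"
    proof -
      have "countable F" unfolding F_def using cnt by (rule countable_Diff)
      moreover have "{\<gamma>} \<in> null_sets (K x)" if "\<gamma> \<in> F" for \<gamma>
        using that src_A[of \<gamma>] RA s by (auto simp: F_def B_def null_sets_def)
      ultimately have "(\<Union>\<gamma>\<in>F. {\<gamma>}) \<in> null_sets (K x)" by (intro null_sets_UN')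
      then show ?thesis by simp
    qed
    then have "AE \<gamma> in K x. \<gamma> \<notin> F" by (rule AE_not_in)
    moreover have "AE \<gamma> in K x. \<gamma> \<notin> arrows G - ?R"
      using W'(2) x sets.compl_sets[OF R] s by (intro AE_not_in) (auto simp: null_sets_def)
    moreover note K_fibre[OF xu]
    ultimately have "AE \<gamma> in K x. \<gamma> \<notin> arrows G - B"
      by eventually_elim (auto simp: F_def range_fibre_def)
    then have "arrows G - B \<in> null_sets (K x)"
      using sets.compl_sets[OF B] s by (subst AE_iff_null_sets) auto
    then show ?thesis by (simp add: null_sets_def)
  qed
  then have "emeasure \<nu> (arrows G - B) = 0"
    using K_null[of "arrows G - B"] sets.compl_sets[OF B] conull_Int[OF W W'(1)] by auto
  then have "AE \<gamma> in \<nu>. \<gamma> \<notin> arrows G - B"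
    using sets.compl_sets[OF B] by (intro AE_not_in) (auto simp: null_sets_def)
  then have "AE \<gamma> in \<nu>. src G \<gamma> \<in> A" using AE_space by eventually_elim (auto simp: B_def)
  from AE_ginv[OF this] have "AE \<gamma> in \<nu>. rng G \<gamma> \<in> A"
    using AE_space by eventually_elim simp
  then have cA: "conull_units G C A" using Au by (simp add: conull_units_iff)
  show ?thesis
  proof (rule that[of "W \<inter> A"])
    show "conull_units G C (W \<inter> A)" by (rule conull_Int[OF W cA])
    show "emeasure (K (rng G \<gamma>)) {\<gamma>} \<noteq> 0" if \<gamma>: "\<gamma> \<in> reduced_arrows G (W \<inter> A)" for \<gamma>
    proof -
      have \<gamma>A: "\<gamma> \<in> arrows G" and \<gamma>V: "\<gamma> \<in> reduced_arrows G V" and sA: "src G \<gamma> \<in> A"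
        using \<gamma> by (auto simp: reduced_arrows_def W_def)
      have "{\<eta> \<in> range_fibre G (src G \<gamma>). mul G \<gamma> \<eta> \<in> {\<gamma>}} = {src G \<gamma>}"
        using \<gamma>A mul_left_eq_iff[OF \<gamma>A] units_arrows by (auto simp: range_fibre_def mul_src)
      moreover have "emeasure (K (src G \<gamma>)) {src G \<gamma>} \<noteq> 0"
        using sA K_unit[of "src G \<gamma>"] by (auto simp: A_def)
      ultimately show ?thesis using K_translate_null_iff[OF \<gamma>V, of "{\<gamma>}"] \<gamma>A by simp
    qed
    show "countable {\<gamma> \<in> reduced_arrows G (W \<inter> A). rng G \<gamma> = x}" for x
      by (rule countable_subset[OF _ cnt[of x]]) (auto simp: reduced_arrows_def)
  qed
qed

text \<open>A null set of arrows is null for almost every fibre measure, and such a set cannot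
  contain a charged arrow of that fibre.\<close>

lemma ae_class_conull:
  assumes "r_discrete G C" "ae_class C P"
  shows "\<exists>U. conull_units G C U \<and> (\<forall>\<gamma>\<in>reduced_arrows G U. P \<gamma>)"
proof -
  obtain U where U: "conull_units G C U"
    "\<And>\<gamma>. \<gamma> \<in> reduced_arrows G U \<Longrightarrow> emeasure (K (rng G \<gamma>)) {\<gamma>} \<noteq> 0"
    by (rule charged_reduction[OF assms(1)]) blast
  obtain N where N: "{\<gamma> \<in> space \<nu>. \<not> P \<gamma>} \<subseteq> N" "emeasure \<nu> N = 0" "N \<in> sets \<nu>"
    using assms(2) unfolding ae_class_iff by (elim AE_E)
  obtain W where W: "conull_units G C W" "\<forall>x\<in>W. emeasure (K x) N = 0"
    using K_null[of N] N by auto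
  have "P \<gamma>" if \<gamma>: "\<gamma> \<in> reduced_arrows G (U \<inter> W)" for \<gamma>
  proof (rule ccontr)
    assume "\<not> P \<gamma>"
    have \<gamma>A: "\<gamma> \<in> arrows G" "rng G \<gamma> \<in> W" "\<gamma> \<in> reduced_arrows G U" using \<gamma> by (auto simp: reduced_arrows_def)
    then have "{\<gamma>} \<subseteq> N" using N(1) \<open>\<not> P \<gamma>\<close> by auto
    then have "emeasure (K (rng G \<gamma>)) {\<gamma>} \<le> emeasure (K (rng G \<gamma>)) N"
      using N(3) K_sets[of "rng G \<gamma>"] \<gamma>A by (intro emeasure_mono) auto
    then show False using W(2) U(2)[OF \<gamma>A(3)] \<gamma>A(2) by simp
  qed
  then show ?thesis using conull_Int[OF U(1) W(1)] by blast
qed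

text \<open>Strictness on a reduction speaks of the reduced groupoid and its class. As the reduction
  is conull, \<open>\<nu>\<close> restricts to a probability measure, so its range measure lies in
  the reduced range class and tests \<open>E\<close>.\<close>

lemma null_units_reduction:
  assumes U: "conull_units G C U" and E: "null_units (reduction G U) (reduction_class G C U) E"
  shows "null_units G C E"
proof -
  let ?R = "reduced_arrows G U" and ?\<rho> = "restrict_space \<nu> (reduced_arrows G U)"
  have Us: "U \<in> sets (borel_of G)" "U \<subseteq> units G" using U conull_sets conull_subset by blast+
  have R: "?R \<in> sets (borel_of G)" using U by (intro reduced_arrows_measurable) (simp add: conull_units_iff)
  have RA: "?R \<subseteq> arrows G" by (auto simp: reduced_arrows_def)
  have us: "unit_space (reduction G U) = restrict_space (restrict_space (borel_of G) ?R) U"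
    unfolding unit_space_def units_reduction[OF Us(2)] by (simp add: reduction_def)
  interpret prob_space \<nu> by (rule \<nu>_prob)
  have "prob_space ?\<rho>"
  proof
    have "emeasure ?\<rho> (space ?\<rho>) = emeasure \<nu> ?R"
      using R RA by (subst emeasure_restrict_space) (auto simp: space_restrict_space Int_absorb1 Int_absorb2)
    also have "\<dots> = emeasure \<nu> (space \<nu>)"
      by (rule emeasure_eq_AE) (use AE_reduced[OF U] RA R in auto)
    finally show "emeasure ?\<rho> (space ?\<rho>) = 1" using emeasure_space_1 by simp
  qed
  have m: "rng G \<in> ?\<rho> \<rightarrow>\<^sub>M unit_space (reduction G U)"
    unfolding us
  proof (intro measurable_restrict_space2)
    show "rng G \<in> ?\<rho> \<rightarrow>\<^sub>M borel_of G"
      by (rule measurable_restrict_space1) (use rng_measurable in \<open>simp cong: measurable_cong_sets\<close>)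
    show "rng G \<in> space ?\<rho> \<rightarrow> ?R" "rng G \<in> space ?\<rho> \<rightarrow> U"
      using units_arrows by (auto simp: space_restrict_space reduced_arrows_def)
  qed
  have rm: "range_measure (reduction G U) ?\<rho> = distr ?\<rho> (unit_space (reduction G U)) (rng G)"
    by (simp add: range_measure_def reduction_def)
  have "prob_space (range_measure (reduction G U) ?\<rho>)"
    unfolding rm by (rule prob_space.prob_space_distr[OF \<open>prob_space ?\<rho>\<close> m])
  then have "range_measure (reduction G U) ?\<rho> \<in> class_of (range_measure (reduction G U) ?\<rho>)"
    by (auto simp: class_of_def equivalent_measures_refl prob_space_imp_sigma_finite)
  moreover have "?\<rho> \<in> reduction_class G C U" using \<nu>_class by (auto simp: reduction_class_def)
  ultimately have "range_measure (reduction G U) ?\<rho> \<in> range_class (reduction G U) (reduction_class G C U)"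
    unfolding range_class_def using \<open>prob_space ?\<rho>\<close> by blast
  then have "E \<in> null_sets (range_measure (reduction G U) ?\<rho>)" using E by (simp add: null_units_def)
  then have "E \<in> null_sets (distr ?\<rho> (unit_space (reduction G U)) (rng G))" by (simp only: rm)
  then have E0: "E \<in> sets (unit_space (reduction G U))" "AE x in distr ?\<rho> (unit_space (reduction G U)) (rng G). x \<notin> E"
    by (auto dest: null_setsD2 intro: AE_not_in)
  have EU: "E \<in> sets (unit_space G)"
  proof -
    have sub: "E \<subseteq> U" using sets.sets_into_space[OF E0(1)] by (auto simp: us space_restrict_space)
    obtain A where "A \<in> sets (borel_of G)" "E = U \<inter> (?R \<inter> A)"
      using E0(1) by (auto simp: us sets_restrict_space)
    then show ?thesis using sub Us R by (auto simp: sets_unit_space)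
  qed
  have "AE \<gamma> in ?\<rho>. rng G \<gamma> \<notin> E" using E0(2) by (rule AE_distrD[OF m])
  then have "AE \<gamma> in \<nu>. \<gamma> \<in> ?R \<longrightarrow> rng G \<gamma> \<notin> E"
    using R RA by (subst (asm) AE_restrict_space_iff) (auto simp: Int_absorb2)
  then have "AE \<gamma> in \<nu>. rng G \<gamma> \<notin> E" using AE_reduced[OF U] by eventually_elim auto
  then show ?thesis using EU by (simp add: null_units_iff)
qed

end

section \<open>Extending homomorphisms beyond a reduction\<close>

context borel_gpd
begin

lemma composable_measurable: "composable G \<in> sets (borel_of G \<Otimes>\<^sub>M borel_of G)"
proof -
  have "{p \<in> space (borel_of G \<Otimes>\<^sub>M borel_of G). src G (fst p) = rng G (snd p)}
      \<in> sets (borel_of G \<Otimes>\<^sub>M borel_of G)"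
    by (rule sets_equal) measurable
  also have "{p \<in> space (borel_of G \<Otimes>\<^sub>M borel_of G). src G (fst p) = rng G (snd p)} = composable G"
    by (auto simp: space_pair_measure composable_def)
  finally show ?thesis .
qed

lemma mul_vimage_measurable:
  assumes "A \<in> sets (borel_of G)"
  shows "{p \<in> composable G. mul G (fst p) (snd p) \<in> A} \<in> sets (borel_of G \<Otimes>\<^sub>M borel_of G)"
proof -
  let ?P = "borel_of G \<Otimes>\<^sub>M borel_of G"
  have m: "(\<lambda>(\<gamma>, \<eta>). mul G \<gamma> \<eta>) \<in> restrict_space ?P (composable G) \<rightarrow>\<^sub>M borel_of G"
    using borel by (simp add: borel_groupoid_def)
  have sub: "composable G \<subseteq> space ?P" by (auto simp: space_pair_measure composable_def)
  have "(\<lambda>(\<gamma>, \<eta>). mul G \<gamma> \<eta>) -` A \<inter> space (restrict_space ?P (composable G))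
      \<in> sets (restrict_space ?P (composable G))"
    using m assms by (rule measurable_sets)
  then have "(\<lambda>(\<gamma>, \<eta>). mul G \<gamma> \<eta>) -` A \<inter> space (restrict_space ?P (composable G)) \<in> sets ?P"
    using composable_measurable sub by (subst (asm) sets_restrict_space_iff) (auto simp: Int_absorb2)
  also have "(\<lambda>(\<gamma>, \<eta>). mul G \<gamma> \<eta>) -` A \<inter> space (restrict_space ?P (composable G))
      = {p \<in> composable G. mul G (fst p) (snd p) \<in> A}"
    using sub by (auto simp: space_restrict_space split_beta)
  finally show ?thesis .
qed

lemma ginv_unit: assumes "x \<in> units G" shows "ginv G x = x"
proof -
  have x: "x \<in> arrows G" using assms by (rule units_arrows)
  have "mul G x (ginv G x) = ginv G x" using mul_rng[of "ginv G x"] x assms by simp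
  then show ?thesis using mul_ginv[OF x] assms by simp
qed

text \<open>Left multiplication by \<open>\<gamma>\<close> carries a countable range fibre of the
  reduction over all these arrows, even if their common range lies outside \<open>U\<close>.\<close>

lemma countable_source_fibre:
  assumes "\<gamma> \<in> arrows G" "src G \<gamma> \<in> U" "countable {\<eta> \<in> reduced_arrows G U. rng G \<eta> = src G \<gamma>}"
  shows "countable {\<eta> \<in> arrows G. src G \<eta> \<in> U \<and> rng G \<eta> = rng G \<gamma>}"
proof (rule countable_subset)
  show "countable (mul G \<gamma> ` {\<eta> \<in> reduced_arrows G U. rng G \<eta> = src G \<gamma>})"
    using assms(3) by (rule countable_image)
  show "{\<eta> \<in> arrows G. src G \<eta> \<in> U \<and> rng G \<eta> = rng G \<gamma>} \<subseteq> mul G \<gamma> ` {\<eta> \<in> reduced_arrows G U. rng G \<eta> = src G \<gamma>}"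
  proof
    fix \<eta> assume "\<eta> \<in> {\<eta> \<in> arrows G. src G \<eta> \<in> U \<and> rng G \<eta> = rng G \<gamma>}"
    then have \<eta>: "\<eta> \<in> arrows G" "src G \<eta> \<in> U" "rng G \<eta> = rng G \<gamma>" by auto
    have "mul G (ginv G \<gamma>) \<eta> \<in> reduced_arrows G U" "rng G (mul G (ginv G \<gamma>) \<eta>) = src G \<gamma>"
      using mul_closed[of "ginv G \<gamma>" \<eta>] \<eta> assms(1,2) by (auto simp: reduced_arrows_def)
    moreover have "\<eta> = mul G \<gamma> (mul G (ginv G \<gamma>) \<eta>)" using mul_ginv_cancel[of \<gamma> \<eta>] \<eta> assms(1) by simp
    ultimately show "\<eta> \<in> mul G \<gamma> ` {\<eta> \<in> reduced_arrows G U. rng G \<eta> = src G \<gamma>}" by blast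
  qed
qed

end

lemma inverse_branch_measurable:
  assumes M: "standard_borel_space M" and f: "f \<in> M \<rightarrow>\<^sub>M M" and A: "separating_sequence M A"
    and T: "T \<in> sets M" and inj: "inj_on f T"
  shows "(\<lambda>x. if x \<in> f ` T then the_inv_into T f x else x) \<in> M \<rightarrow>\<^sub>M M"
proof (rule measurableI)
  have img: "f ` S \<in> sets M" if "S \<in> sets M" "S \<subseteq> T" for S
    using injective_borel_image[OF M f A that(1)] inj that(2) inj_on_subset by blast
  have inv: "the_inv_into T f (f z) = z" if "z \<in> T" for z using inj that by (rule the_inv_into_f_f)
  fix x assume "x \<in> space M"
  then show "(if x \<in> f ` T then the_inv_into T f x else x) \<in> space M"
    using inv sets.sets_into_space[OF T] by auto
next
  have img: "f ` S \<in> sets M" if "S \<in> sets M" "S \<subseteq> T" for S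
    using injective_borel_image[OF M f A that(1)] inj that(2) inj_on_subset by blast
  have inv: "the_inv_into T f (f z) = z" if "z \<in> T" for z using inj that by (rule the_inv_into_f_f)
  fix S assume S: "S \<in> sets M"
  have "(\<lambda>x. if x \<in> f ` T then the_inv_into T f x else x) -` S \<inter> space M
      = f ` (T \<inter> S) \<union> (S - f ` T)"
    using sets.sets_into_space[OF S] sets.sets_into_space[OF img[OF T order_refl]] inv
    by (auto split: if_splits)
  also have "\<dots> \<in> sets M" using img[of "T \<inter> S"] img[of T] S T by auto
  finally show "(\<lambda>x. if x \<in> f ` T then the_inv_into T f x else x) -` S \<inter> space M \<in> sets M" .
qed

context measured_gpd
begin

lemma conull_nonempty: "conull_units G C U \<Longrightarrow> U \<noteq> {}"
proof
  assume "conull_units G C U" "U = {}"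
  then have "AE \<gamma> in \<nu>. False" by (simp add: conull_units_iff)
  interpret prob_space \<nu> by (rule \<nu>_prob)
  show False using \<open>AE \<gamma> in \<nu>. False\<close> by simp
qed

text \<open>Points outside \<open>U\<close> may well be connected to \<open>U\<close>, by uncountably many arrows altogether, but for
  each of them the arrows coming from \<open>U\<close> are countable in number. Choosing one of these in a Borel
  way gives a homomorphism to the reduction that is the identity there.\<close>

lemma borel_section_to_reduction:
  assumes U: "conull_units G C U"
    and charged: "\<And>\<gamma>. \<gamma> \<in> reduced_arrows G U \<Longrightarrow> emeasure (K (rng G \<gamma>)) {\<gamma>} \<noteq> 0"
    and cnt: "\<And>x. countable {\<gamma> \<in> reduced_arrows G U. rng G \<gamma> = x}"
  obtains N g where "N \<in> sets (borel_of G)" "N = rng G ` {\<gamma> \<in> arrows G. src G \<gamma> \<in> U}"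
    "g \<in> borel_of G \<rightarrow>\<^sub>M borel_of G"
    "\<And>x. x \<in> N \<Longrightarrow> g x \<in> arrows G \<and> src G (g x) \<in> U \<and> rng G (g x) = x"
    "\<And>x. x \<in> U \<Longrightarrow> g x = x"
proof -
  let ?M = "borel_of G"
  obtain A where A: "separating_sequence ?M A" using standard_borel_separating[OF standard] by blast
  have [measurable]: "U \<in> sets ?M" and Uu: "U \<subseteq> units G" using U conull_sets conull_subset by auto
  define E where "E = {\<gamma> \<in> arrows G. src G \<gamma> \<in> U}"
  have "{\<gamma> \<in> space ?M. src G \<gamma> \<in> U} \<in> sets ?M" by measurable
  then have E: "E \<in> sets ?M" by (simp add: E_def)
  have EA: "E \<subseteq> arrows G" by (auto simp: E_def)
  have Ecnt: "countable {\<eta> \<in> E. rng G \<eta> = rng G \<gamma>}" if "\<gamma> \<in> E" for \<gamma>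
    using countable_source_fibre[of \<gamma> U] that cnt by (simp add: E_def conj_assoc)
  obtain Q :: "nat \<Rightarrow> 'a set" where "(\<forall>n. Q n \<in> sets ?M \<and> Q n \<subseteq> E) \<and>
    (\<forall>x. countable {z \<in> E. rng G z = x} \<longrightarrow> {z \<in> E. rng G z = x} \<noteq> {} \<longrightarrow> (\<exists>n. \<exists>!z. z \<in> Q n \<and> rng G z = x))"
    using isolating_sequence[OF standard rng_measurable A E] by (rule exE)
  then have Q: "\<And>n. Q n \<in> sets ?M" "\<And>n. Q n \<subseteq> E"
    "\<And>x. countable {z \<in> E. rng G z = x} \<Longrightarrow> {z \<in> E. rng G z = x} \<noteq> {} \<Longrightarrow> \<exists>n. \<exists>!z. z \<in> Q n \<and> rng G z = x"
    by simp_all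
  \<comment> \<open>These arrows lead from \<open>\<gamma>\<close> to the other members of
    \<open>Q n\<close> with the same range. If \<open>\<gamma>\<close> starts in \<open>U\<close>,
    they all belong to the reduction and are charged, so \<open>S n \<gamma>\<close> is empty as
    soon as it is null.\<close>
  define S where "S n \<gamma> = {\<eta> \<in> E. (\<gamma>, \<eta>) \<in> composable G \<and> mul G \<gamma> \<eta> \<in> Q n \<and> \<eta> \<noteq> src G \<gamma>}" for n \<gamma>
  have S_sets: "(SIGMA \<gamma>:space ?M. S n \<gamma>) \<in> sets (?M \<Otimes>\<^sub>M ?M)" for n
  proof -
    let ?P = "?M \<Otimes>\<^sub>M ?M"
    have [measurable]: "{p \<in> composable G. mul G (fst p) (snd p) \<in> Q n} \<in> sets ?P"
      by (rule mul_vimage_measurable[OF Q(1)])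
    have [measurable]: "E \<in> sets ?M" by (rule E)
    have eq: "{p \<in> space ?P. snd p = src G (fst p)} \<in> sets ?P" by (rule sets_equal) measurable
    have "{p \<in> space ?P. p \<in> {p \<in> composable G. mul G (fst p) (snd p) \<in> Q n} \<and> snd p \<in> E}
        - {p \<in> space ?P. snd p = src G (fst p)} \<in> sets ?P"
      using eq by measurable
    also have "{p \<in> space ?P. p \<in> {p \<in> composable G. mul G (fst p) (snd p) \<in> Q n} \<and> snd p \<in> E}
        - {p \<in> space ?P. snd p = src G (fst p)} = (SIGMA \<gamma>:space ?M. S n \<gamma>)"
      by (auto simp: S_def space_pair_measure composable_def)
    finally show ?thesis .
  qed
  have S_meas: "S n \<gamma> \<in> sets ?M" if "\<gamma> \<in> arrows G" for n \<gamma>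
  proof -
    have "Pair \<gamma> -` (SIGMA \<gamma>:space ?M. S n \<gamma>) \<in> sets ?M" by (rule sets_Pair1[OF S_sets])
    also have "Pair \<gamma> -` (SIGMA \<gamma>:space ?M. S n \<gamma>) = S n \<gamma>" using that by auto
    finally show ?thesis .
  qed
  have KS: "(\<lambda>\<gamma>. emeasure (K (src G \<gamma>)) (S n \<gamma>)) \<in> borel_measurable ?M" for n
    by (rule emeasure_measurable_subprob_algebra2[OF S_sets measurable_compose[OF src_unit_space K_measurable]])
  \<comment> \<open>The members of \<open>Q n\<close> that share their range with no other member.
    Stated through the kernel this is visibly Borel, whereas emptiness of
    \<open>S n \<gamma>\<close> would involve a projection.\<close>
  define T where "T n = {\<gamma> \<in> Q n. emeasure (K (src G \<gamma>)) (S n \<gamma>) = 0}" for n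
  have T: "T n \<in> sets ?M" for n
  proof -
    have [measurable]: "Q n \<in> sets ?M" by (rule Q(1))
    note [measurable] = KS[of n]
    have "{\<gamma> \<in> space ?M. \<gamma> \<in> Q n \<and> emeasure (K (src G \<gamma>)) (S n \<gamma>) = 0} \<in> sets ?M" by measurable
    also have "{\<gamma> \<in> space ?M. \<gamma> \<in> Q n \<and> emeasure (K (src G \<gamma>)) (S n \<gamma>) = 0} = T n"
      using Q(2) EA by (auto simp: T_def)
    finally show ?thesis .
  qed
  have TE: "T n \<subseteq> E" for n using Q(2) by (auto simp: T_def)
  have inj: "inj_on (rng G) (T n)" for n
  proof (rule inj_onI, rule ccontr)
    fix \<gamma> \<eta> assume \<gamma>: "\<gamma> \<in> T n" and \<eta>: "\<eta> \<in> T n" and eq: "rng G \<gamma> = rng G \<eta>" and ne: "\<gamma> \<noteq> \<eta>"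
    have ga: "\<gamma> \<in> arrows G" "src G \<gamma> \<in> U" "\<eta> \<in> arrows G" "src G \<eta> \<in> U"
      using \<gamma> \<eta> TE by (auto simp: E_def)
    define \<delta> where "\<delta> = mul G (ginv G \<gamma>) \<eta>"
    have \<delta>: "\<delta> \<in> arrows G" "rng G \<delta> = src G \<gamma>" "src G \<delta> = src G \<eta>"
      unfolding \<delta>_def using mul_closed[of "ginv G \<gamma>" \<eta>] ga eq by auto
    have m: "mul G \<gamma> \<delta> = \<eta>" unfolding \<delta>_def using mul_ginv_cancel[of \<gamma> \<eta>] ga eq by simp
    have "\<delta> \<noteq> src G \<gamma>" using m ne mul_src[OF ga(1)] by auto
    then have "{\<delta>} \<subseteq> S n \<gamma>" using \<delta> m \<eta> ga by (auto simp: S_def E_def composable_def T_def)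
    moreover have "S n \<gamma> \<in> sets (K (src G \<gamma>))" using S_meas[OF ga(1)] K_sets ga by simp
    ultimately have "emeasure (K (src G \<gamma>)) {\<delta>} \<le> emeasure (K (src G \<gamma>)) (S n \<gamma>)" by (rule emeasure_mono)
    also have "\<dots> = 0" using \<gamma> by (simp add: T_def)
    finally show False using charged[of \<delta>] \<delta> ga by (simp add: reduced_arrows_def)
  qed
  have cover: "\<exists>n. rng G \<gamma> \<in> rng G ` T n" if \<gamma>: "\<gamma> \<in> E" for \<gamma>
  proof -
    \<comment> \<open>The isolated arrow \<open>z\<close> may differ from \<open>\<gamma>\<close>;
      only its range matters for the covering.\<close>
    obtain n where n: "\<exists>!z. z \<in> Q n \<and> rng G z = rng G \<gamma>"
      using Q(3)[OF Ecnt[OF \<gamma>]] \<gamma> by blast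
    then obtain z where z: "z \<in> Q n" "rng G z = rng G \<gamma>" by blast
    have zA: "z \<in> arrows G" using z Q(2) EA by blast
    have "S n z = {}"
    proof (rule ccontr)
      assume "S n z \<noteq> {}"
      then obtain \<eta> where \<eta>: "\<eta> \<in> arrows G" "src G z = rng G \<eta>" "mul G z \<eta> \<in> Q n" "\<eta> \<noteq> src G z"
        by (auto simp: S_def composable_def)
      have "rng G (mul G z \<eta>) = rng G \<gamma>" using mul_closed[OF zA \<eta>(1,2)] z by simp
      then have "mul G z \<eta> = z" using n z \<eta>(3) by blast
      then show False using mul_left_eq_iff[OF zA \<eta>(1,2)] \<eta>(4) by simp
    qed
    then have "z \<in> T n" using z(1) by (simp add: T_def)
    then show ?thesis using z(2) by (metis image_eqI)
  qed
  define N where "N = (\<Union>n. rng G ` T n)"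
  have NE: "N = rng G ` E" using cover TE by (auto simp: N_def)
  have img: "rng G ` T n \<in> sets ?M" for n by (rule injective_borel_image[OF standard rng_measurable A T inj])
  have N: "N \<in> sets ?M" unfolding N_def using img by auto
  define b where "b n x = (if x \<in> rng G ` T n then the_inv_into (T n) (rng G) x else x)" for n x
  have b: "b n \<in> ?M \<rightarrow>\<^sub>M ?M" for n
    unfolding b_def by (rule inverse_branch_measurable[OF standard rng_measurable A T inj])
  define l where "l x = (LEAST n. x \<in> rng G ` T n)" for x
  have l: "l \<in> ?M \<rightarrow>\<^sub>M count_space UNIV"
  proof -
    have "{x \<in> space ?M. x \<in> rng G ` T n} \<in> sets ?M" for n using sets.Int[OF sets.top img[of n]] by (simp only: Int_def mem_Collect_eq)
    then show ?thesis unfolding l_def by (rule measurable_least_index)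
  qed
  have bl: "(\<lambda>x. b (l x) x) \<in> ?M \<rightarrow>\<^sub>M ?M" by (rule measurable_compose_countable[OF b l])
  \<comment> \<open>The identity on \<open>U\<close> is imposed by hand: the arrow selected at a
    unit of \<open>U\<close> could be any arrow coming from \<open>U\<close>.\<close>
  define g where "g x = (if x \<in> U then x else b (l x) x)" for x
  have UN: "U \<subseteq> N" unfolding NE using Uu units_arrows by (force simp: E_def)
  have bN: "b (l x) x \<in> E \<and> rng G (b (l x) x) = x" if "x \<in> N" for x
  proof -
    have "x \<in> rng G ` T (l x)" using that unfolding N_def l_def by (metis (mono_tags, lifting) LeastI UN_E)
    then show ?thesis using the_inv_into_into[OF inj, of x "l x" "T (l x)"] f_the_inv_into_f[OF inj, of x "l x"] TE
      by (auto simp: b_def)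
  qed
  show ?thesis
  proof (rule that[of N g])
    show "N \<in> sets ?M" by (rule N)
    show "N = rng G ` {\<gamma> \<in> arrows G. src G \<gamma> \<in> U}" unfolding NE E_def ..
    show "g \<in> ?M \<rightarrow>\<^sub>M ?M" unfolding g_def using bl by measurable
    show "g x \<in> arrows G \<and> src G (g x) \<in> U \<and> rng G (g x) = x" if "x \<in> N" for x
      using bN[OF that] Uu units_arrows by (auto simp: g_def E_def)
    show "g x = x" if "x \<in> U" for x using that by (simp add: g_def)
  qed
qed

text \<open>Conjugation by the selected arrows moves both ends of an arrow into \<open>U\<close>,
  and \<open>g x = x\<close> on \<open>U\<close> makes it trivial there. It is available over the
  saturation \<open>N\<close> of \<open>U\<close>, which no arrow leaves; every other arrow is sent
  to one fixed unit \<open>u\<close>, which still respects range and source.\<close>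

lemma retraction_to_reduction:
  assumes "r_discrete G C" and U0: "conull_units G C U0"
  obtains U h where "conull_units G C U" "U \<subseteq> U0" "h \<in> borel_of G \<rightarrow>\<^sub>M borel_of G"
    "\<And>\<gamma>. \<gamma> \<in> arrows G \<Longrightarrow>
      h \<gamma> \<in> reduced_arrows G U \<and> rng G (h \<gamma>) = h (rng G \<gamma>) \<and> src G (h \<gamma>) = h (src G \<gamma>)"
    "\<And>\<gamma>. \<gamma> \<in> reduced_arrows G U \<Longrightarrow> h \<gamma> = \<gamma>"
proof -
  let ?M = "borel_of G"
  obtain U1 where U1: "conull_units G C U1"
    "\<And>\<gamma>. \<gamma> \<in> reduced_arrows G U1 \<Longrightarrow> emeasure (K (rng G \<gamma>)) {\<gamma>} \<noteq> 0"
    "\<And>x. countable {\<gamma> \<in> reduced_arrows G U1. rng G \<gamma> = x}"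
    by (rule charged_reduction[OF assms(1)]) blast
  define U where "U = U0 \<inter> U1"
  have U: "conull_units G C U" unfolding U_def by (rule conull_Int[OF U0 U1(1)])
  have sub: "reduced_arrows G U \<subseteq> reduced_arrows G U1" by (auto simp: U_def reduced_arrows_def)
  have cnt: "countable {\<gamma> \<in> reduced_arrows G U. rng G \<gamma> = x}" for x
    by (rule countable_subset[OF _ U1(3)[of x]]) (use sub in auto)
  have Uu: "U \<subseteq> units G" using U conull_subset by auto
  obtain N g where N: "N \<in> sets ?M" "N = rng G ` {\<gamma> \<in> arrows G. src G \<gamma> \<in> U}"
    and g: "g \<in> ?M \<rightarrow>\<^sub>M ?M"
    "\<And>x. x \<in> N \<Longrightarrow> g x \<in> arrows G \<and> src G (g x) \<in> U \<and> rng G (g x) = x"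
    "\<And>x. x \<in> U \<Longrightarrow> g x = x"
    using borel_section_to_reduction[OF U U1(2) cnt] sub by blast
  obtain u where u: "u \<in> U" using conull_nonempty[OF U] by blast
  then have uA: "u \<in> units G" "u \<in> arrows G" using Uu units_arrows by auto
  have NU: "N \<subseteq> units G" using N(2) by auto
  have rs: "rng G \<gamma> \<in> N \<longleftrightarrow> src G \<gamma> \<in> N" if \<gamma>: "\<gamma> \<in> arrows G" for \<gamma>
  proof
    assume "rng G \<gamma> \<in> N"
    then obtain z where z: "z \<in> arrows G" "src G z \<in> U" "rng G \<gamma> = rng G z" using N(2) by auto
    have "mul G (ginv G \<gamma>) z \<in> arrows G" "src G (mul G (ginv G \<gamma>) z) \<in> U" "src G \<gamma> = rng G (mul G (ginv G \<gamma>) z)"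
      using mul_closed[of "ginv G \<gamma>" z] z \<gamma> by auto
    then show "src G \<gamma> \<in> N" unfolding N(2) by blast
  next
    assume "src G \<gamma> \<in> N"
    then obtain z where z: "z \<in> arrows G" "src G z \<in> U" "src G \<gamma> = rng G z" using N(2) by auto
    have "mul G \<gamma> z \<in> arrows G" "src G (mul G \<gamma> z) \<in> U" "rng G \<gamma> = rng G (mul G \<gamma> z)"
      using mul_closed[of \<gamma> z] z \<gamma> by auto
    then show "rng G \<gamma> \<in> N" unfolding N(2) by blast
  qed
  define k where "k \<gamma> = mul G (ginv G (g (rng G \<gamma>))) (mul G \<gamma> (g (src G \<gamma>)))" for \<gamma>
  define h where "h \<gamma> = (if rng G \<gamma> \<in> N then k \<gamma> else u)" for \<gamma>
  have k: "mul G \<gamma> (g (src G \<gamma>)) \<in> arrows G" "rng G (mul G \<gamma> (g (src G \<gamma>))) = rng G \<gamma>"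
    "k \<gamma> \<in> arrows G" "rng G (k \<gamma>) = src G (g (rng G \<gamma>))" "src G (k \<gamma>) = src G (g (src G \<gamma>))"
    if \<gamma>: "\<gamma> \<in> arrows G" "rng G \<gamma> \<in> N" for \<gamma>
  proof -
    have gr: "g (rng G \<gamma>) \<in> arrows G" "rng G (g (rng G \<gamma>)) = rng G \<gamma>"
      and gs: "g (src G \<gamma>) \<in> arrows G" "rng G (g (src G \<gamma>)) = src G \<gamma>"
      using g(2) \<gamma> rs by auto
    show *: "mul G \<gamma> (g (src G \<gamma>)) \<in> arrows G" "rng G (mul G \<gamma> (g (src G \<gamma>))) = rng G \<gamma>"
      using mul_closed[OF \<gamma>(1) gs(1)] gs by simp_all
    have "src G (mul G \<gamma> (g (src G \<gamma>))) = src G (g (src G \<gamma>))"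
      using mul_closed[OF \<gamma>(1) gs(1)] gs by simp
    then show "k \<gamma> \<in> arrows G" "rng G (k \<gamma>) = src G (g (rng G \<gamma>))" "src G (k \<gamma>) = src G (g (src G \<gamma>))"
      unfolding k_def using mul_closed[of "ginv G (g (rng G \<gamma>))" "mul G \<gamma> (g (src G \<gamma>))"] gr * by simp_all
  qed
  have kx: "h x = src G (g x)" if "x \<in> N" for x
  proof -
    have x: "x \<in> units G" using that NU by auto
    have gx: "g x \<in> arrows G" "rng G (g x) = x" using g(2)[OF that] by auto
    have "mul G x (g x) = g x" using mul_rng[OF gx(1)] gx(2) by simp
    then show ?thesis using x that gx by (simp add: h_def k_def ginv_mul)
  qed
  show ?thesis
  proof (rule that[of U h])
    show "conull_units G C U" by (rule U)
    show "U \<subseteq> U0" by (simp add: U_def)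
    have P: "{\<gamma> \<in> space ?M. rng G \<gamma> \<in> N} \<in> sets ?M" using N(1) by measurable
    let ?R = "restrict_space ?M {\<gamma>. rng G \<gamma> \<in> N}"
    have sR: "\<gamma> \<in> space ?R \<Longrightarrow> \<gamma> \<in> arrows G \<and> rng G \<gamma> \<in> N" for \<gamma>
      by (simp add: space_restrict_space)
    have gs: "(\<lambda>\<gamma>. g (src G \<gamma>)) \<in> ?R \<rightarrow>\<^sub>M ?M"
      by (rule measurable_restrict_space1[OF measurable_compose[OF src_measurable g(1)]])
    have gr: "(\<lambda>\<gamma>. ginv G (g (rng G \<gamma>))) \<in> ?R \<rightarrow>\<^sub>M ?M"
      by (rule measurable_restrict_space1[OF measurable_compose[OF
            measurable_compose[OF rng_measurable g(1)] ginv_measurable]])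
    have idR: "(\<lambda>\<gamma>. \<gamma>) \<in> ?R \<rightarrow>\<^sub>M ?M"
      by (rule measurable_restrict_space1[OF measurable_ident_sets[OF refl]])
    have "(\<lambda>\<gamma>. mul G \<gamma> (g (src G \<gamma>))) \<in> ?R \<rightarrow>\<^sub>M ?M"
    proof (rule mul_measurable[OF idR gs])
      fix \<gamma> assume "\<gamma> \<in> space ?R"
      then have "src G \<gamma> \<in> N" using sR[of \<gamma>] rs[of \<gamma>] by blast
      then show "src G \<gamma> = rng G (g (src G \<gamma>))" using g(2)[of "src G \<gamma>"] by simp
    qed
    then have "k \<in> ?R \<rightarrow>\<^sub>M ?M"
      unfolding k_def
    proof (rule mul_measurable[OF gr])
      fix \<gamma> assume "\<gamma> \<in> space ?R"
      then show "src G (ginv G (g (rng G \<gamma>))) = rng G (mul G \<gamma> (g (src G \<gamma>)))"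
        using sR[of \<gamma>] k(2)[of \<gamma>] g(2)[of "rng G \<gamma>"] by simp
    qed
    then show "h \<in> ?M \<rightarrow>\<^sub>M ?M"
      unfolding h_def using uA by (subst measurable_If_restrict_space_iff[OF P]) auto
    show "h \<gamma> \<in> reduced_arrows G U \<and> rng G (h \<gamma>) = h (rng G \<gamma>) \<and> src G (h \<gamma>) = h (src G \<gamma>)"
      if \<gamma>: "\<gamma> \<in> arrows G" for \<gamma>
    proof (cases "rng G \<gamma> \<in> N")
      case True
      then have "src G \<gamma> \<in> N" using rs \<gamma> by blast
      then show ?thesis using True k[OF \<gamma> True] kx g(2) by (simp add: h_def[of \<gamma>] reduced_arrows_def)
    next
      case False
      then have "src G \<gamma> \<notin> N" using rs \<gamma> by blast
      then show ?thesis using False \<gamma> u uA by (simp add: h_def reduced_arrows_def)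
    qed
    show "h \<gamma> = \<gamma>" if "\<gamma> \<in> reduced_arrows G U" for \<gamma>
    proof -
      have \<gamma>: "\<gamma> \<in> arrows G" "rng G \<gamma> \<in> U" "src G \<gamma> \<in> U" using that by (auto simp: reduced_arrows_def)
      have "rng G (rng G \<gamma>) \<in> N" unfolding N(2) using \<gamma> Uu units_arrows by (intro imageI) auto
      then have "rng G \<gamma> \<in> N" using \<gamma> by simp
      then show ?thesis using \<gamma> g(3) by (simp add: h_def k_def mul_src mul_rng ginv_unit)
    qed
  qed
qed

end

section \<open>Strict homomorphisms between measured groupoids\<close>

locale measured_gpd_pair =
  A: measured_gpd G1 C1 \<nu>1 K1 V1 + B: measured_gpd G2 C2 \<nu>2 K2 V2
  for G1 :: "'a groupoid" and C1 \<nu>1 K1 V1 and G2 :: "'b groupoid" and C2 \<nu>2 K2 V2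
begin

lemma strict_mul:
  assumes "strict_on_reduction G1 C1 U G2 C2 \<phi>"
    and "\<gamma> \<in> reduced_arrows G1 U" "\<eta> \<in> reduced_arrows G1 U" "src G1 \<gamma> = rng G1 \<eta>"
  shows "(\<phi> \<gamma>, \<phi> \<eta>) \<in> composable G2" "\<phi> (mul G1 \<gamma> \<eta>) = mul G2 (\<phi> \<gamma>) (\<phi> \<eta>)"
proof -
  have "(\<gamma>, \<eta>) \<in> composable (reduction G1 U)" using assms(2-4) by (simp add: composable_def)
  then show "(\<phi> \<gamma>, \<phi> \<eta>) \<in> composable G2" "\<phi> (mul G1 \<gamma> \<eta>) = mul G2 (\<phi> \<gamma>) (\<phi> \<eta>)"
    using assms(1) unfolding strict_on_reduction_def strict_homomorphism_def by auto
qed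

lemma strict_unit:
  assumes s: "strict_on_reduction G1 C1 U G2 C2 \<phi>" and x: "x \<in> U"
  shows "\<phi> x \<in> units G2"
proof -
  have xu: "x \<in> units G1" using s x A.conull_subset unfolding strict_on_reduction_def by blast
  then have x': "x \<in> arrows G1" by (rule A.units_arrows)
  have xr: "x \<in> reduced_arrows G1 U" using x xu x' by (simp add: reduced_arrows_def)
  have "mul G1 x x = x" using A.mul_rng[OF x'] xu by simp
  then have "mul G2 (\<phi> x) (\<phi> x) = \<phi> x" "\<phi> x \<in> arrows G2" "src G2 (\<phi> x) = rng G2 (\<phi> x)"
    using strict_mul[OF s xr xr] xu by (simp_all add: composable_def)
  then show ?thesis by (metis B.idempotent_unit B.rng_in_units)
qed

lemma strict_rng_src:
  assumes s: "strict_on_reduction G1 C1 U G2 C2 \<phi>" and \<gamma>: "\<gamma> \<in> reduced_arrows G1 U"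
  shows "\<phi> \<gamma> \<in> arrows G2" "rng G2 (\<phi> \<gamma>) = \<phi> (rng G1 \<gamma>)" "src G2 (\<phi> \<gamma>) = \<phi> (src G1 \<gamma>)"
proof -
  have g: "\<gamma> \<in> arrows G1" "rng G1 \<gamma> \<in> U" "src G1 \<gamma> \<in> U" using \<gamma> by (auto simp: reduced_arrows_def)
  then have r: "rng G1 \<gamma> \<in> reduced_arrows G1 U" "src G1 \<gamma> \<in> reduced_arrows G1 U"
    using A.units_arrows by (simp_all add: reduced_arrows_def)
  have 1: "(\<phi> (rng G1 \<gamma>), \<phi> \<gamma>) \<in> composable G2" using strict_mul(1)[OF s r(1) \<gamma>] g by simp
  have 2: "(\<phi> \<gamma>, \<phi> (src G1 \<gamma>)) \<in> composable G2" using strict_mul(1)[OF s \<gamma> r(2)] g by simp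
  show "\<phi> \<gamma> \<in> arrows G2" using 1 by (simp add: composable_def)
  show "rng G2 (\<phi> \<gamma>) = \<phi> (rng G1 \<gamma>)" "src G2 (\<phi> \<gamma>) = \<phi> (src G1 \<gamma>)"
    using 1 2 strict_unit[OF s g(2)] strict_unit[OF s g(3)] by (simp_all add: composable_def)
qed

text \<open>Nonsingularity on units is applied to the complement of \<open>W\<close>; the set it
  makes null for the reduced class is null for \<open>C1\<close> by
  \<open>null_units_reduction\<close>.\<close>

lemma strict_conull:
  assumes s: "strict_on_reduction G1 C1 U G2 C2 \<phi>" and W: "conull_units G2 C2 W"
  shows "conull_units G1 C1 {x \<in> U. \<phi> x \<in> W}"
proof -
  have U: "conull_units G1 C1 U" using s by (simp add: strict_on_reduction_def)
  then have Uu: "U \<subseteq> units G1" by (rule A.conull_subset)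
  define E where "E = \<phi> -` (units G2 - W) \<inter> U"
  have "null_units (reduction G1 U) (reduction_class G1 C1 U) (\<phi> -` (units G2 - W) \<inter> units (reduction G1 U))"
    using s W unfolding strict_on_reduction_def strict_homomorphism_def conull_units_def by blast
  then have "null_units G1 C1 E"
    unfolding E_def A.units_reduction[OF Uu] by (rule A.null_units_reduction[OF U])
  then have E: "E \<in> sets (unit_space G1)" "AE \<gamma> in \<nu>1. rng G1 \<gamma> \<notin> E" by (simp_all add: A.null_units_iff)
  have eq: "{x \<in> U. \<phi> x \<in> W} = U - E" using strict_unit[OF s] by (auto simp: E_def)
  have "AE \<gamma> in \<nu>1. rng G1 \<gamma> \<in> U" using U by (simp add: A.conull_units_iff)
  then have "AE \<gamma> in \<nu>1. rng G1 \<gamma> \<in> U - E" using E(2) by eventually_elim simp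
  then show ?thesis unfolding eq using U E(1) by (simp add: A.conull_units_iff sets.Diff)
qed

text \<open>After the retraction \<open>h\<close> the map \<open>\<phi>\<close> is evaluated only at
  arrows where it is strict. Off the reduction only compatibility with range and source is recorded,
  which is all that a pulled-back representation needs there.\<close>

lemma homomorphism_extension:
  assumes "r_discrete G1 C1" and \<phi>: "\<phi> \<in> borel_of G1 \<rightarrow>\<^sub>M borel_of G2"
    and s: "strict_on_reduction G1 C1 U0 G2 C2 \<phi>"
  obtains U \<Phi> where "conull_units G1 C1 U" "U \<subseteq> U0" "\<Phi> \<in> borel_of G1 \<rightarrow>\<^sub>M borel_of G2"
    "\<And>\<gamma>. \<gamma> \<in> arrows G1 \<Longrightarrow> rng G2 (\<Phi> \<gamma>) = \<Phi> (rng G1 \<gamma>) \<and> src G2 (\<Phi> \<gamma>) = \<Phi> (src G1 \<gamma>)"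
    "\<And>\<gamma>. \<gamma> \<in> reduced_arrows G1 U \<Longrightarrow> \<Phi> \<gamma> = \<phi> \<gamma>"
proof -
  have "conull_units G1 C1 U0" using s by (simp add: strict_on_reduction_def)
  then obtain U h where U: "conull_units G1 C1 U" "U \<subseteq> U0" "h \<in> borel_of G1 \<rightarrow>\<^sub>M borel_of G1"
    and h: "\<And>\<gamma>. \<gamma> \<in> arrows G1 \<Longrightarrow>
      h \<gamma> \<in> reduced_arrows G1 U \<and> rng G1 (h \<gamma>) = h (rng G1 \<gamma>) \<and> src G1 (h \<gamma>) = h (src G1 \<gamma>)"
    "\<And>\<gamma>. \<gamma> \<in> reduced_arrows G1 U \<Longrightarrow> h \<gamma> = \<gamma>"
    using A.retraction_to_reduction[OF assms(1)] by blast
  have sub: "reduced_arrows G1 U \<subseteq> reduced_arrows G1 U0" using U(2) by (auto simp: reduced_arrows_def)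
  show ?thesis
  proof (rule that[of U "\<phi> \<circ> h"])
    show "\<phi> \<circ> h \<in> borel_of G1 \<rightarrow>\<^sub>M borel_of G2" by (rule measurable_comp[OF U(3) \<phi>])
    fix \<gamma> assume \<gamma>: "\<gamma> \<in> arrows G1"
    then have "h \<gamma> \<in> reduced_arrows G1 U0" using h(1) sub by blast
    from strict_rng_src[OF s this]
    show "rng G2 ((\<phi> \<circ> h) \<gamma>) = (\<phi> \<circ> h) (rng G1 \<gamma>) \<and> src G2 ((\<phi> \<circ> h) \<gamma>) = (\<phi> \<circ> h) (src G1 \<gamma>)"
      using h(1)[OF \<gamma>] by simp
  qed (use U h in auto)
qed

end

section \<open>Sections of Hilbert bundles\<close>

locale pre_hilbert =
  fixes H :: "'h chilbert"
  assumes hilbert: "complex_hilbert_space H"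
begin

lemma zero_closed [simp]: "hzero H \<in> hcar H"
  and add_closed [simp]: "u \<in> hcar H \<Longrightarrow> v \<in> hcar H \<Longrightarrow> hadd H u v \<in> hcar H"
  and scale_closed [simp]: "u \<in> hcar H \<Longrightarrow> hscale H a u \<in> hcar H"
  and add_commute: "u \<in> hcar H \<Longrightarrow> v \<in> hcar H \<Longrightarrow> hadd H u v = hadd H v u"
  and add_assoc: "u \<in> hcar H \<Longrightarrow> v \<in> hcar H \<Longrightarrow> w \<in> hcar H \<Longrightarrow>
    hadd H (hadd H u v) w = hadd H u (hadd H v w)"
  and zero_add: "u \<in> hcar H \<Longrightarrow> hadd H (hzero H) u = u"
  and add_inverse: "u \<in> hcar H \<Longrightarrow> \<exists>v\<in>hcar H. hadd H u v = hzero H"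
  and scale_one: "u \<in> hcar H \<Longrightarrow> hscale H 1 u = u"
  and scale_scale: "u \<in> hcar H \<Longrightarrow> hscale H a (hscale H b u) = hscale H (a * b) u"
  and scale_add_left: "u \<in> hcar H \<Longrightarrow> hscale H (a + b) u = hadd H (hscale H a u) (hscale H b u)"
  and scale_add_right: "u \<in> hcar H \<Longrightarrow> v \<in> hcar H \<Longrightarrow>
    hscale H a (hadd H u v) = hadd H (hscale H a u) (hscale H a v)"
  and inner_add_left: "u \<in> hcar H \<Longrightarrow> v \<in> hcar H \<Longrightarrow> w \<in> hcar H \<Longrightarrow>
    hinner H (hadd H u v) w = hinner H u w + hinner H v w"
  and inner_scale_left: "u \<in> hcar H \<Longrightarrow> w \<in> hcar H \<Longrightarrow> hinner H (hscale H a u) w = a * hinner H u w"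
  and inner_pos: "u \<in> hcar H \<Longrightarrow> u \<noteq> hzero H \<Longrightarrow> Re (hinner H u u) > 0"
  by (insert hilbert, unfold complex_hilbert_space_def, elim conjE, metis)+

lemma inner_commute: "u \<in> hcar H \<Longrightarrow> v \<in> hcar H \<Longrightarrow> hinner H u v = cnj (hinner H v u)"
  using hilbert unfolding complex_hilbert_space_def by blast

lemma inner_add_right: "u \<in> hcar H \<Longrightarrow> v \<in> hcar H \<Longrightarrow> w \<in> hcar H \<Longrightarrow>
    hinner H w (hadd H u v) = hinner H w u + hinner H w v"
  using inner_commute[of w "hadd H u v"] inner_commute[of u w] inner_commute[of v w]
  by (simp add: inner_add_left)

lemma inner_scale_right: "u \<in> hcar H \<Longrightarrow> w \<in> hcar H \<Longrightarrow> hinner H w (hscale H a u) = cnj a * hinner H w u"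
  using inner_commute[of w "hscale H a u"] inner_commute[of u w] by (simp add: inner_scale_left)

lemma scale_zero: assumes "u \<in> hcar H" shows "hscale H 0 u = hzero H"
proof -
  obtain w where w: "w \<in> hcar H" "hadd H (hscale H 0 u) w = hzero H" using add_inverse[of "hscale H 0 u"] assms by auto
  have "hadd H (hscale H 0 u) (hscale H 0 u) = hscale H 0 u"
    using scale_add_left[OF assms, of 0 0] by simp
  then have "hadd H (hscale H 0 u) (hadd H (hscale H 0 u) w) = hadd H (hscale H 0 u) w"
    using add_assoc[of "hscale H 0 u" "hscale H 0 u" w] assms w by simp
  then show ?thesis using w assms add_commute[of "hscale H 0 u" "hzero H"] zero_add[of "hscale H 0 u"] by simp
qed

lemma inner_zero_left: "w \<in> hcar H \<Longrightarrow> hinner H (hzero H) w = 0"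
  using inner_scale_left[of w w 0] by (simp add: scale_zero)

lemma inner_zero_right: "w \<in> hcar H \<Longrightarrow> hinner H w (hzero H) = 0"
  using inner_commute[of w "hzero H"] by (simp add: inner_zero_left)

lemma add_zero: "u \<in> hcar H \<Longrightarrow> hadd H u (hzero H) = u"
  using add_commute[of u "hzero H"] by (simp add: zero_add)

lemma minus_closed [simp]: "u \<in> hcar H \<Longrightarrow> v \<in> hcar H \<Longrightarrow> hminus H u v \<in> hcar H"
  by (simp add: hminus_def)

lemma inner_minus_left: "u \<in> hcar H \<Longrightarrow> v \<in> hcar H \<Longrightarrow> w \<in> hcar H \<Longrightarrow>
    hinner H (hminus H u v) w = hinner H u w - hinner H v w"
  by (simp add: hminus_def inner_add_left inner_scale_left)

lemma inner_minus_right: "u \<in> hcar H \<Longrightarrow> v \<in> hcar H \<Longrightarrow> w \<in> hcar H \<Longrightarrow>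
    hinner H w (hminus H u v) = hinner H w u - hinner H w v"
  by (simp add: hminus_def inner_add_right inner_scale_right)

lemma inner_nonneg: "u \<in> hcar H \<Longrightarrow> Re (hinner H u u) \<ge> 0"
  using inner_pos[of u] inner_zero_left[of "hzero H"] by (cases "u = hzero H") auto

lemma norm_nonneg: "u \<in> hcar H \<Longrightarrow> hnorm H u \<ge> 0"
  by (simp add: hnorm_def inner_nonneg)

lemma dist_nonneg: "u \<in> hcar H \<Longrightarrow> v \<in> hcar H \<Longrightarrow> hdist H u v \<ge> 0"
  by (simp add: hdist_def norm_nonneg)

lemma norm_power2: "u \<in> hcar H \<Longrightarrow> (hnorm H u)\<^sup>2 = Re (hinner H u u)"
  by (simp add: hnorm_def inner_nonneg)

lemma inner_self: assumes "u \<in> hcar H" shows "hinner H u u = complex_of_real ((hnorm H u)\<^sup>2)"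
  using inner_commute[OF assms assms] norm_power2[OF assms] by (auto simp: complex_eq_iff)

lemma norm_minus_power2:
  assumes "u \<in> hcar H" "v \<in> hcar H"
  shows "(hnorm H (hminus H u v))\<^sup>2 = (hnorm H u)\<^sup>2 + (hnorm H v)\<^sup>2 - 2 * Re (hinner H u v)"
  using assms inner_commute[OF assms]
  by (simp add: norm_power2 inner_minus_left inner_minus_right)

lemma norm_scale:
  assumes "u \<in> hcar H" shows "hnorm H (hscale H a u) = cmod a * hnorm H u"
proof -
  have "hinner H (hscale H a u) (hscale H a u) = (a * cnj a) * hinner H u u"
    using assms by (simp add: inner_scale_left inner_scale_right)
  also have "\<dots> = complex_of_real ((cmod a)\<^sup>2 * (hnorm H u)\<^sup>2)"
    using assms complex_norm_square[of a] by (simp add: inner_self)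
  finally have "(hnorm H (hscale H a u))\<^sup>2 = (cmod a * hnorm H u)\<^sup>2"
    using assms norm_power2[of "hscale H a u"] by (simp add: power_mult_distrib)
  then show ?thesis using norm_nonneg[of u] norm_nonneg[of "hscale H a u"] assms
    by (simp add: power2_eq_iff_nonneg)
qed

text \<open>Expands the squared norm of \<open>u\<close> minus \<open>t\<close> times
  \<open>v\<close>, which is nonnegative, for the coefficient \<open>t\<close> of the projection of
  \<open>u\<close> onto \<open>v\<close>.\<close>

lemma cauchy_schwarz:
  assumes "u \<in> hcar H" "v \<in> hcar H"
  shows "cmod (hinner H u v) \<le> hnorm H u * hnorm H v"
proof (cases "v = hzero H")
  case True
  then show ?thesis using assms norm_nonneg by (simp add: inner_zero_right)
next
  case False
  define c N where "c = hinner H u v" and "N = (hnorm H v)\<^sup>2"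
  have N: "N > 0" using inner_pos[OF assms(2) False] norm_power2[OF assms(2)] by (simp add: N_def)
  define t where "t = c / of_real N"
  have "cnj t * c = of_real ((cmod c)\<^sup>2 / N)"
    using complex_norm_square[of c] by (simp add: t_def mult.commute)
  then have re: "Re (hinner H u (hscale H t v)) = (cmod c)\<^sup>2 / N"
    using assms by (simp add: inner_scale_right c_def)
  have "cmod t = cmod c / N" using N by (simp add: t_def norm_divide)
  moreover have "(hnorm H (hscale H t v))\<^sup>2 = (cmod t)\<^sup>2 * N"
    using assms(2) by (simp add: norm_scale power_mult_distrib N_def)
  ultimately have "(hnorm H (hscale H t v))\<^sup>2 = (cmod c / N)\<^sup>2 * N" by simp
  also have "\<dots> = (cmod c)\<^sup>2 / N" using N by (simp add: power2_eq_square)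
  finally have "0 \<le> (hnorm H u)\<^sup>2 + (cmod c)\<^sup>2 / N - 2 * ((cmod c)\<^sup>2 / N)"
    using norm_minus_power2[of u "hscale H t v"] assms re
      zero_le_power2[of "hnorm H (hminus H u (hscale H t v))"] by simp
  then have "(cmod c)\<^sup>2 / N \<le> (hnorm H u)\<^sup>2" by simp
  then have "(cmod c)\<^sup>2 \<le> (hnorm H u * hnorm H v)\<^sup>2"
    using N by (simp add: N_def divide_le_eq power_mult_distrib)
  then show ?thesis unfolding c_def
    by (rule power2_le_imp_le) (simp add: norm_nonneg[OF assms(1)] norm_nonneg[OF assms(2)])
qed

lemma norm_add_le:
  assumes "u \<in> hcar H" "v \<in> hcar H" shows "hnorm H (hadd H u v) \<le> hnorm H u + hnorm H v"
proof -
  have "Re (hinner H u v) \<le> hnorm H u * hnorm H v"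
    using cauchy_schwarz[OF assms] complex_Re_le_cmod order_trans by blast
  moreover have "Re (hinner H v u) = Re (hinner H u v)"
    by (subst inner_commute[OF assms(2,1)]) simp
  moreover have "(hnorm H (hadd H u v))\<^sup>2
      = Re (hinner H u u) + Re (hinner H u v) + (Re (hinner H v u) + Re (hinner H v v))"
    using assms by (simp add: norm_power2 inner_add_left inner_add_right)
  ultimately have "(hnorm H (hadd H u v))\<^sup>2 \<le> (hnorm H u + hnorm H v)\<^sup>2"
    using norm_power2[OF assms(1)] norm_power2[OF assms(2)] unfolding power2_sum by linarith
  then show ?thesis
    by (rule power2_le_imp_le) (simp add: norm_nonneg[OF assms(1)] norm_nonneg[OF assms(2)])
qed

lemma add_neg: "u \<in> hcar H \<Longrightarrow> hadd H u (hscale H (-1) u) = hzero H"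
  using scale_add_left[of u 1 "-1"] by (simp add: scale_one scale_zero)

lemma dist_triangle:
  assumes "u \<in> hcar H" "v \<in> hcar H" "w \<in> hcar H"
  shows "hdist H u w \<le> hdist H u v + hdist H v w"
proof -
  let ?n = "hscale H (-1)"
  have "hadd H (hminus H u v) (hminus H v w) = hadd H u (hadd H (hadd H (?n v) v) (?n w))"
    unfolding hminus_def using assms by (simp add: add_assoc)
  also have "\<dots> = hminus H u w"
    using assms add_commute[of "?n v" v] by (simp add: add_neg zero_add hminus_def)
  finally show ?thesis unfolding hdist_def using norm_add_le[of "hminus H u v" "hminus H v w"] assms by simp
qed

lemma dist_add_le:
  assumes "u \<in> hcar H" "v \<in> hcar H" "u' \<in> hcar H" "v' \<in> hcar H"
  shows "hdist H (hadd H u v) (hadd H u' v') \<le> hdist H u u' + hdist H v v'"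
proof -
  let ?n = "hscale H (-1)"
  have "hminus H (hadd H u v) (hadd H u' v') = hadd H u (hadd H v (hadd H (?n u') (?n v')))"
    unfolding hminus_def using assms by (simp add: scale_add_right add_assoc)
  also have "hadd H v (hadd H (?n u') (?n v')) = hadd H (?n u') (hadd H v (?n v'))"
    using assms add_assoc[of v "?n u'" "?n v'", symmetric] add_assoc[of "?n u'" v "?n v'", symmetric]
      add_commute[of v "?n u'"] by simp
  also have "hadd H u \<dots> = hadd H (hminus H u u') (hminus H v v')"
    unfolding hminus_def using assms by (simp add: add_assoc)
  finally show ?thesis unfolding hdist_def using norm_add_le[of "hminus H u u'" "hminus H v v'"] assms by simp
qed

lemma dist_scale:
  assumes "u \<in> hcar H" shows "hdist H (hscale H a u) (hscale H b u) = cmod (a - b) * hnorm H u"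
proof -
  have "hminus H (hscale H a u) (hscale H b u) = hscale H (a - b) u"
    unfolding hminus_def using assms scale_add_left[OF assms, of a "- b"] by (simp add: scale_scale)
  then show ?thesis using norm_scale[OF assms] by (simp add: hdist_def)
qed

lemma tendsto_inner:
  assumes u: "u \<in> hcar H" "\<And>k. U k \<in> hcar H" "(\<lambda>k. hdist H u (U k)) \<longlonglongrightarrow> 0"
    and v: "v \<in> hcar H" "\<And>k. V k \<in> hcar H" "(\<lambda>k. hdist H v (V k)) \<longlonglongrightarrow> 0"
  shows "(\<lambda>k. hinner H (U k) (V k)) \<longlonglongrightarrow> hinner H u v"
proof -
  let ?d = "\<lambda>k. hdist H u (U k)" and ?e = "\<lambda>k. hdist H v (V k)"
  have "(\<lambda>k. hnorm H u * ?e k + ?d k * hnorm H v + ?d k * ?e k) \<longlonglongrightarrow> hnorm H u * 0 + 0 * hnorm H v + 0 * 0"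
    by (intro tendsto_intros u v)
  then have lim: "(\<lambda>k. hnorm H u * ?e k + ?d k * hnorm H v + ?d k * ?e k) \<longlonglongrightarrow> 0" by simp
  have "cmod (hinner H (U k) (V k) - hinner H u v) \<le> hnorm H u * ?e k + ?d k * hnorm H v + ?d k * ?e k" for k
  proof -
    let ?p = "hminus H u (U k)" and ?q = "hminus H v (V k)"
    have pq: "?p \<in> hcar H" "?q \<in> hcar H" using u v by simp_all
    \<comment> \<open>Writing \<open>U k\<close> and \<open>V k\<close> as \<open>u\<close> and
      \<open>v\<close> minus small vectors \<open>?p\<close> and \<open>?q\<close> leaves three
      terms, each with a small factor.\<close>
    have "hinner H (U k) (V k) - hinner H u v = hinner H ?p ?q - hinner H u ?q - hinner H ?p v"
      using u v by (simp add: inner_minus_left inner_minus_right)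
    also have "cmod \<dots> \<le> cmod (hinner H ?p ?q) + cmod (hinner H u ?q) + cmod (hinner H ?p v)"
      by (meson norm_triangle_ineq4 norm_triangle_le_diff add_right_mono order_trans)
    also have "\<dots> \<le> hnorm H ?p * hnorm H ?q + hnorm H u * hnorm H ?q + hnorm H ?p * hnorm H v"
      using cauchy_schwarz pq u v by (intro add_mono) auto
    finally show ?thesis by (simp add: hdist_def algebra_simps)
  qed
  then have "(\<lambda>k. hinner H (U k) (V k) - hinner H u v) \<longlonglongrightarrow> 0"
    by (intro Lim_null_comparison[OF _ lim]) auto
  then show ?thesis by (rule LIM_zero_cancel)
qed

end

section \<open>Countable dense families in the fibres\<close>

text \<open>Rational coefficients keep the combinations dense in the span, and lists of triples over
  countable types can be enumerated by \<open>from_nat\<close>, the same enumeration in every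
  fibre.\<close>

primrec rational_comb :: "'h chilbert \<Rightarrow> (nat \<Rightarrow> 'h) \<Rightarrow> (rat \<times> rat \<times> nat) list \<Rightarrow> 'h" where
  "rational_comb H f [] = hzero H"
| "rational_comb H f (t # l) =
    hadd H (hscale H (Complex (of_rat (fst t)) (of_rat (fst (snd t)))) (f (snd (snd t)))) (rational_comb H f l)"

lemma rational_complex_dense:
  fixes a :: complex assumes "e > 0"
  obtains p q :: rat where "cmod (a - Complex (of_rat p) (of_rat q)) < e"
proof -
  obtain p q where p: "\<bar>Re a - of_rat p\<bar> < e / 2" and q: "\<bar>Im a - of_rat q\<bar> < e / 2"
  proof -
    obtain p where "Re a - e / 2 < of_rat p" "of_rat p < Re a + e / 2"
      using of_rat_dense[of "Re a - e / 2" "Re a + e / 2"] assms by auto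
    moreover obtain q where "Im a - e / 2 < of_rat q" "of_rat q < Im a + e / 2"
      using of_rat_dense[of "Im a - e / 2" "Im a + e / 2"] assms by auto
    ultimately show ?thesis by (intro that[of p q]) (simp_all only: abs_less_iff, linarith+)
  qed
  have "cmod (a - Complex (of_rat p) (of_rat q)) \<le> \<bar>Re a - of_rat p\<bar> + \<bar>Im a - of_rat q\<bar>"
    using cmod_le[of "a - Complex (of_rat p) (of_rat q)"] by simp
  then show ?thesis using p q by (intro that[of p q]) linarith
qed

context pre_hilbert
begin

lemma rational_comb_closed [simp]: "range f \<subseteq> hcar H \<Longrightarrow> rational_comb H f l \<in> hcar H"
  by (induction l) (auto simp: image_subset_iff)

lemma rational_comb_append:
  "range f \<subseteq> hcar H \<Longrightarrow> rational_comb H f (l @ m) = hadd H (rational_comb H f l) (rational_comb H f m)"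
  by (induction l) (auto simp: zero_add add_assoc image_subset_iff)

lemma hspan_closed: "S \<subseteq> hcar H \<Longrightarrow> v \<in> hspan H S \<Longrightarrow> v \<in> hcar H"
  by (erule hspan.induct) auto

lemma dist_self: "u \<in> hcar H \<Longrightarrow> hdist H u u = 0"
  by (simp add: hdist_def hminus_def add_neg) (simp add: hnorm_def inner_zero_left)

lemma rational_comb_dense:
  assumes f: "range f \<subseteq> hcar H" and v: "v \<in> hspan H (range f)"
  shows "\<forall>e>0. \<exists>l. hdist H v (rational_comb H f l) < e"
  using v
proof induction
  case 1
  then show ?case by (auto intro!: exI[of _ "[]"] simp: dist_self)
next
  case (2 v a)
  then obtain n where n: "v = f n" by blast
  have v: "v \<in> hcar H" using n f by auto
  show ?case
  proof (intro allI impI)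
    fix e :: real assume "e > 0"
    \<comment> \<open>Adding 1 covers the case that \<open>v\<close> has norm 0.\<close>
    then have "e / (hnorm H v + 1) > 0" using norm_nonneg[OF v] by simp
    then obtain p q where pq: "cmod (a - Complex (of_rat p) (of_rat q)) < e / (hnorm H v + 1)"
      by (rule rational_complex_dense)
    have "hdist H (hscale H a v) (rational_comb H f [(p, q, n)])
        = cmod (a - Complex (of_rat p) (of_rat q)) * hnorm H v"
      using v n by (simp add: add_zero dist_scale)
    also have "\<dots> \<le> cmod (a - Complex (of_rat p) (of_rat q)) * (hnorm H v + 1)"
      by (intro mult_left_mono) auto
    also have "\<dots> < e" using pq norm_nonneg[OF v] by (simp add: pos_less_divide_eq)
    finally show "\<exists>l. hdist H (hscale H a v) (rational_comb H f l) < e" by blast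
  qed
next
  case (3 v w)
  show ?case
  proof (intro allI impI)
    fix e :: real assume "e > 0"
    then obtain l m where lm: "hdist H v (rational_comb H f l) < e / 2" "hdist H w (rational_comb H f m) < e / 2"
      using 3 by (meson half_gt_zero)
    have "hdist H (hadd H v w) (rational_comb H f (l @ m))
        \<le> hdist H v (rational_comb H f l) + hdist H w (rational_comb H f m)"
      unfolding rational_comb_append[OF f]
      using hspan_closed[OF f] 3(1,2) f by (intro dist_add_le) auto
    then show "\<exists>l. hdist H (hadd H v w) (rational_comb H f l) < e" using lm by (intro exI[of _ "l @ m"]) linarith
  qed
qed

end

lemma hilbert_isomorphism_closed: "hilbert_isomorphism H K T \<Longrightarrow> u \<in> hcar H \<Longrightarrow> T u \<in> hcar K"
  by (auto simp: hilbert_isomorphism_def bij_betw_def)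

lemma hilbert_isomorphism_inner:
  "hilbert_isomorphism H K T \<Longrightarrow> u \<in> hcar H \<Longrightarrow> v \<in> hcar H \<Longrightarrow> hinner K (T u) (T v) = hinner H u v"
  by (auto simp: hilbert_isomorphism_def)

lemma hilbert_isomorphism_norm:
  "hilbert_isomorphism H K T \<Longrightarrow> u \<in> hcar H \<Longrightarrow> hnorm K (T u) = hnorm H u"
  by (simp add: hnorm_def hilbert_isomorphism_inner)

lemma hilbert_isomorphism_dist:
  assumes "complex_hilbert_space H" "complex_hilbert_space K"
    and T: "hilbert_isomorphism H K T" and "u \<in> hcar H" "v \<in> hcar H"
  shows "hdist K (T u) (T v) = hdist H u v"
proof -
  interpret H: pre_hilbert H by unfold_locales (rule assms)
  interpret K: pre_hilbert K by unfold_locales (rule assms)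
  have c: "T u \<in> hcar K" "T v \<in> hcar K" using hilbert_isomorphism_closed[OF T] assms by auto
  have "(hdist K (T u) (T v))\<^sup>2 = (hdist H u v)\<^sup>2"
    unfolding hdist_def using c assms
    by (simp add: H.norm_minus_power2 K.norm_minus_power2 hilbert_isomorphism_norm hilbert_isomorphism_inner)
  moreover have "hdist K (T u) (T v) \<ge> 0" "hdist H u v \<ge> 0"
    unfolding hdist_def using c assms by (auto intro!: H.norm_nonneg K.norm_nonneg)
  ultimately show ?thesis by (simp add: power2_eq_iff_nonneg)
qed

section \<open>Measurability of Borel sections\<close>

definition rational_section :: "'x hilbert_bundle \<Rightarrow> (rat \<times> rat \<times> nat) list \<Rightarrow> 'x \<Rightarrow> vec" where
  "rational_section \<H> l x = rational_comb (fib \<H> x) (\<lambda>n. fund \<H> n x) l"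

locale borel_hilbert_bundle =
  fixes X :: "'x measure" and \<H> :: "'x hilbert_bundle"
  assumes is_bundle: "is_hilbert_bundle X \<H>"
begin

lemma fibre: "x \<in> space X \<Longrightarrow> complex_hilbert_space (fib \<H> x)"
  and fund_closed: "x \<in> space X \<Longrightarrow> fund \<H> n x \<in> hcar (fib \<H> x)"
  and fund_measurable: "(\<lambda>x. hinner (fib \<H> x) (fund \<H> m x) (fund \<H> n x)) \<in> borel_measurable X"
  using is_bundle unfolding is_hilbert_bundle_def by simp_all

lemma pre_hilbert_fibre: "x \<in> space X \<Longrightarrow> pre_hilbert (fib \<H> x)"
  by (simp add: pre_hilbert_def fibre)

lemma rational_section_closed: "x \<in> space X \<Longrightarrow> rational_section \<H> l x \<in> hcar (fib \<H> x)"
  unfolding rational_section_def using fund_closed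
  by (intro pre_hilbert.rational_comb_closed[OF pre_hilbert_fibre]) auto

lemma rational_section_dense:
  assumes x: "x \<in> space X" and v: "v \<in> hcar (fib \<H> x)" and "e > 0"
  shows "\<exists>l. hdist (fib \<H> x) v (rational_section \<H> l x) < e"
proof -
  interpret pre_hilbert "fib \<H> x" by (rule pre_hilbert_fibre[OF x])
  have f: "range (\<lambda>n. fund \<H> n x) \<subseteq> hcar (fib \<H> x)" using fund_closed[OF x] by auto
  obtain w where w: "w \<in> hspan (fib \<H> x) (range (\<lambda>n. fund \<H> n x))" "hdist (fib \<H> x) v w < e / 2"
    using is_bundle x v \<open>e > 0\<close> unfolding is_hilbert_bundle_def by (meson half_gt_zero)
  obtain l where l: "hdist (fib \<H> x) w (rational_section \<H> l x) < e / 2"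
    using rational_comb_dense[OF f w(1)] \<open>e > 0\<close> unfolding rational_section_def by (meson half_gt_zero)
  have "hdist (fib \<H> x) v (rational_section \<H> l x)
      \<le> hdist (fib \<H> x) v w + hdist (fib \<H> x) w (rational_section \<H> l x)"
    by (rule dist_triangle[OF v hspan_closed[OF f w(1)] rational_section_closed[OF x]])
  then show ?thesis using w l by (intro exI[of _ l]) linarith
qed

lemma inner_rational_section_measurable:
  assumes "borel_section X \<H> \<xi>"
  shows "(\<lambda>x. hinner (fib \<H> x) (\<xi> x) (rational_section \<H> l x)) \<in> borel_measurable X"
proof (induction l)
  case Nil
  have "hinner (fib \<H> x) (\<xi> x) (rational_section \<H> [] x) = 0" if "x \<in> space X" for x
    using assms that pre_hilbert.inner_zero_right[OF pre_hilbert_fibre[OF that]]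
    by (simp add: borel_section_def rational_section_def)
  then show ?case by (simp cong: measurable_cong)
next
  case (Cons t l)
  obtain p q n where t: "t = (p, q, n)" by (cases t) auto
  let ?c = "Complex (of_rat p) (of_rat q)"
  have "hinner (fib \<H> x) (\<xi> x) (rational_section \<H> (t # l) x)
      = cnj ?c * hinner (fib \<H> x) (\<xi> x) (fund \<H> n x) + hinner (fib \<H> x) (\<xi> x) (rational_section \<H> l x)"
    if x: "x \<in> space X" for x
  proof -
    interpret pre_hilbert "fib \<H> x" by (rule pre_hilbert_fibre[OF x])
    have "\<xi> x \<in> hcar (fib \<H> x)" using assms x by (simp add: borel_section_def)
    then show ?thesis using rational_section_closed[OF x, of l] fund_closed[OF x, of n] t
      by (simp add: rational_section_def inner_add_right inner_scale_right)
  qed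
  moreover have "(\<lambda>x. cnj ?c * hinner (fib \<H> x) (\<xi> x) (fund \<H> n x)
      + hinner (fib \<H> x) (\<xi> x) (rational_section \<H> l x)) \<in> borel_measurable X"
    using assms unfolding borel_section_def
    by (intro borel_measurable_add borel_measurable_times borel_measurable_const Cons) blast
  ultimately show ?case by (simp cong: measurable_cong)
qed

lemma borel_section_swap:
  assumes "\<And>x. x \<in> space X \<Longrightarrow> \<xi> x \<in> hcar (fib \<H> x)" "\<And>x. x \<in> space X \<Longrightarrow> \<eta> x \<in> hcar (fib \<H> x)"
    and "(\<lambda>x. hinner (fib \<H> x) (\<xi> x) (\<eta> x)) \<in> borel_measurable X"
  shows "(\<lambda>x. hinner (fib \<H> x) (\<eta> x) (\<xi> x)) \<in> borel_measurable X"
proof -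
  have "(\<lambda>x. cnj (hinner (fib \<H> x) (\<xi> x) (\<eta> x))) \<in> borel_measurable X"
    by (rule measurable_compose[OF assms(3) borel_measurable_continuous_onI]) (intro continuous_intros)
  moreover have "cnj (hinner (fib \<H> x) (\<xi> x) (\<eta> x)) = hinner (fib \<H> x) (\<eta> x) (\<xi> x)" if "x \<in> space X" for x
    by (rule sym, rule pre_hilbert.inner_commute[OF pre_hilbert_fibre[OF that]]) (use assms(1,2) that in auto)
  ultimately show ?thesis by (simp cong: measurable_cong)
qed

lemma borel_rational_section: "borel_section X \<H> (rational_section \<H> l)"
  unfolding borel_section_def
proof (intro conjI ballI allI)
  show "rational_section \<H> l x \<in> hcar (fib \<H> x)" if "x \<in> space X" for x by (rule rational_section_closed[OF that])
  fix n
  have "borel_section X \<H> (fund \<H> n)" by (simp add: borel_section_def fund_closed fund_measurable)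
  then show "(\<lambda>x. hinner (fib \<H> x) (rational_section \<H> l x) (fund \<H> n x)) \<in> borel_measurable X"
    by (intro borel_section_swap[of "fund \<H> n"] fund_closed rational_section_closed inner_rational_section_measurable)
qed

text \<open>Borel sections are defined through inner products with a fixed sequence, so the norm is
  expressed as a countable supremum: \<open>?F l x\<close> equals the squared norm of
  \<open>\<xi> x\<close> minus the squared distance to the \<open>l\<close>-th rational section, and
  by density this distance becomes arbitrarily small.\<close>

lemma norm_measurable:
  assumes \<xi>: "borel_section X \<H> \<xi>"
  shows "(\<lambda>x. (hnorm (fib \<H> x) (\<xi> x))\<^sup>2) \<in> borel_measurable X"
proof -
  let ?F = "\<lambda>l x. 2 * Re (hinner (fib \<H> x) (\<xi> x) (rational_section \<H> l x))
    - Re (hinner (fib \<H> x) (rational_section \<H> l x) (rational_section \<H> l x))"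
  have F: "?F l x = (hnorm (fib \<H> x) (\<xi> x))\<^sup>2 - (hdist (fib \<H> x) (\<xi> x) (rational_section \<H> l x))\<^sup>2"
    if x: "x \<in> space X" for l x
  proof -
    interpret pre_hilbert "fib \<H> x" by (rule pre_hilbert_fibre[OF x])
    have "\<xi> x \<in> hcar (fib \<H> x)" using \<xi> x by (simp add: borel_section_def)
    then show ?thesis
      using norm_minus_power2[OF _ rational_section_closed[OF x, of l], of "\<xi> x"]
        norm_power2[OF rational_section_closed[OF x, of l]] by (simp add: hdist_def)
  qed
  have Fm: "?F l \<in> borel_measurable X" for l
    using inner_rational_section_measurable[OF \<xi>, of l]
      inner_rational_section_measurable[OF borel_rational_section, of l l] by measurable
  have "(SUP l. ?F l x) = (hnorm (fib \<H> x) (\<xi> x))\<^sup>2" if x: "x \<in> space X" for x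
  proof (rule antisym)
    show "(SUP l. ?F l x) \<le> (hnorm (fib \<H> x) (\<xi> x))\<^sup>2"
      by (rule cSUP_least) (use F[OF x] in auto)
    have bdd: "bdd_above (range (\<lambda>l. ?F l x))"
      by (rule bdd_aboveI[of _ "(hnorm (fib \<H> x) (\<xi> x))\<^sup>2"]) (use F[OF x] in auto)
    show "(hnorm (fib \<H> x) (\<xi> x))\<^sup>2 \<le> (SUP l. ?F l x)"
    proof (rule field_le_epsilon)
      fix e :: real assume e: "e > 0"
      have "\<xi> x \<in> hcar (fib \<H> x)" using \<xi> x by (simp add: borel_section_def)
      then obtain l where l: "hdist (fib \<H> x) (\<xi> x) (rational_section \<H> l x) < sqrt e"
        using rational_section_dense[OF x, of "\<xi> x" "sqrt e"] e by auto
      interpret pre_hilbert "fib \<H> x" by (rule pre_hilbert_fibre[OF x])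
      have "hdist (fib \<H> x) (\<xi> x) (rational_section \<H> l x) \<ge> 0"
        unfolding hdist_def using \<open>\<xi> x \<in> _\<close> rational_section_closed[OF x] by (intro norm_nonneg) simp
      then have "(hdist (fib \<H> x) (\<xi> x) (rational_section \<H> l x))\<^sup>2 < e"
        using l e power_strict_mono[OF l, of 2] by simp
      then have "(hnorm (fib \<H> x) (\<xi> x))\<^sup>2 \<le> ?F l x + e" using F[OF x, of l] by simp
      also have "?F l x \<le> (SUP l. ?F l x)" by (rule cSUP_upper[OF _ bdd]) simp
      finally show "(hnorm (fib \<H> x) (\<xi> x))\<^sup>2 \<le> (SUP l. ?F l x) + e" by simp
    qed
  qed
  moreover have "(\<lambda>x. SUP l. ?F l x) \<in> borel_measurable X"
  proof (rule borel_measurable_cSUP[OF _ Fm])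
    show "bdd_above (range (\<lambda>l. ?F l x))" if "x \<in> space X" for x
      by (rule bdd_aboveI[of _ "(hnorm (fib \<H> x) (\<xi> x))\<^sup>2"]) (use F[OF that] in auto)
  qed simp
  ultimately show ?thesis by (simp cong: measurable_cong)
qed

text \<open>Replaces a section by a measurable choice among countably many fixed ones. Squared
  distances are compared because they are polynomial in norms and inner products, whose
  measurability is known.\<close>

lemma approximating_index:
  assumes \<xi>: "borel_section X \<H> \<xi>"
  obtains i :: "nat \<Rightarrow> 'x \<Rightarrow> nat" where "\<And>k. i k \<in> X \<rightarrow>\<^sub>M count_space UNIV"
    "\<And>k x. x \<in> space X \<Longrightarrow> hdist (fib \<H> x) (\<xi> x) (rational_section \<H> (from_nat (i k x)) x) < inverse (real (Suc k))"
proof -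
  define P where "P k n x \<longleftrightarrow> (hdist (fib \<H> x) (\<xi> x) (rational_section \<H> (from_nat n) x))\<^sup>2 < (inverse (real (Suc k)))\<^sup>2"
    for k n x
  define i where "i k x = (LEAST n. P k n x)" for k x
  have c: "\<xi> x \<in> hcar (fib \<H> x)" if "x \<in> space X" for x using \<xi> that by (simp add: borel_section_def)
  show ?thesis
  proof (rule that[of i])
    fix k
    have "{x \<in> space X. P k n x} \<in> sets X" for n
    proof -
      let ?w = "rational_section \<H> (from_nat n)"
      have "(\<lambda>x. (hnorm (fib \<H> x) (\<xi> x))\<^sup>2 + (hnorm (fib \<H> x) (?w x))\<^sup>2
          - 2 * Re (hinner (fib \<H> x) (\<xi> x) (?w x))) \<in> borel_measurable X"
        using norm_measurable[OF \<xi>] norm_measurable[OF borel_rational_section, of "from_nat n"]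
          inner_rational_section_measurable[OF \<xi>, of "from_nat n"] by measurable
      moreover have "(hnorm (fib \<H> x) (\<xi> x))\<^sup>2 + (hnorm (fib \<H> x) (?w x))\<^sup>2
          - 2 * Re (hinner (fib \<H> x) (\<xi> x) (?w x)) = (hdist (fib \<H> x) (\<xi> x) (?w x))\<^sup>2" if "x \<in> space X" for x
        unfolding hdist_def
        by (rule pre_hilbert.norm_minus_power2[OF pre_hilbert_fibre[OF that] c[OF that] rational_section_closed[OF that], symmetric])
      ultimately have [measurable]: "(\<lambda>x. (hdist (fib \<H> x) (\<xi> x) (?w x))\<^sup>2) \<in> borel_measurable X"
        by (simp cong: measurable_cong)
      show ?thesis unfolding P_def by measurable
    qed
    then show "i k \<in> X \<rightarrow>\<^sub>M count_space UNIV" unfolding i_def by (rule measurable_least_index)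
  next
    fix k x assume x: "x \<in> space X"
    interpret pre_hilbert "fib \<H> x" by (rule pre_hilbert_fibre[OF x])
    have nn: "0 \<le> hdist (fib \<H> x) (\<xi> x) (rational_section \<H> l x)" for l
      unfolding hdist_def using c[OF x] rational_section_closed[OF x] by (intro norm_nonneg) simp
    obtain l where "hdist (fib \<H> x) (\<xi> x) (rational_section \<H> l x) < inverse (real (Suc k))"
      using rational_section_dense[OF x c[OF x], of "inverse (real (Suc k))"] by auto
    then have "P k (to_nat l) x" unfolding P_def using nn by (simp add: power_strict_mono)
    then have "P k (i k x) x" unfolding i_def by (rule LeastI)
    then show "hdist (fib \<H> x) (\<xi> x) (rational_section \<H> (from_nat (i k x)) x) < inverse (real (Suc k))"
      unfolding P_def by (rule power_less_imp_less_base) simp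
  qed
qed

end

section \<open>Pulled-back bundles\<close>

definition pullback :: "'x hilbert_bundle \<Rightarrow> ('y \<Rightarrow> 'x) \<Rightarrow> 'y hilbert_bundle" where
  "pullback \<H> \<pi> = \<lparr>fib = (\<lambda>y. fib \<H> (\<pi> y)), fund = (\<lambda>n y. fund \<H> n (\<pi> y))\<rparr>"

lemma pullback_simps [simp]:
  "fib (pullback \<H> \<pi>) y = fib \<H> (\<pi> y)" "fund (pullback \<H> \<pi>) n y = fund \<H> n (\<pi> y)"
  "rational_section (pullback \<H> \<pi>) l y = rational_section \<H> l (\<pi> y)"
  by (simp_all add: pullback_def rational_section_def)

lemma hilbert_bundle_pullback:
  assumes "is_hilbert_bundle X \<H>" and \<pi>: "\<pi> \<in> Y \<rightarrow>\<^sub>M X"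
  shows "is_hilbert_bundle Y (pullback \<H> \<pi>)"
proof -
  have "(\<lambda>y. hinner (fib \<H> (\<pi> y)) (fund \<H> m (\<pi> y)) (fund \<H> n (\<pi> y))) \<in> borel_measurable Y" for m n
    using measurable_compose[OF \<pi>, of "\<lambda>x. hinner (fib \<H> x) (fund \<H> m x) (fund \<H> n x)"] assms(1)
    by (simp add: is_hilbert_bundle_def)
  then show ?thesis using assms(1) measurable_space[OF \<pi>] by (simp add: is_hilbert_bundle_def)
qed

lemma borel_section_pullback:
  assumes "borel_section X \<H> \<xi>" and \<pi>: "\<pi> \<in> Y \<rightarrow>\<^sub>M X"
  shows "borel_section Y (pullback \<H> \<pi>) (\<lambda>y. \<xi> (\<pi> y))"
proof -
  have "(\<lambda>y. hinner (fib \<H> (\<pi> y)) (\<xi> (\<pi> y)) (fund \<H> n (\<pi> y))) \<in> borel_measurable Y" for n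
    using measurable_compose[OF \<pi>, of "\<lambda>x. hinner (fib \<H> x) (\<xi> x) (fund \<H> n x)"] assms(1)
    by (simp add: borel_section_def)
  then show ?thesis using assms(1) measurable_space[OF \<pi>] by (simp add: borel_section_def)
qed

lemma pullback_pullback: "pullback (pullback \<H> \<pi>) \<rho> = pullback \<H> (\<lambda>y. \<pi> (\<rho> y))"
  by (simp add: pullback_def)

text \<open>Base maps that agree only on \<open>space Y\<close> may give different records, so the
  condition is transferred point by point instead of by equality of bundles.\<close>

lemma borel_section_pullback_cong:
  assumes "borel_section Y (pullback \<H> \<pi>) \<zeta>" "\<And>y. y \<in> space Y \<Longrightarrow> \<pi> y = \<rho> y"
  shows "borel_section Y (pullback \<H> \<rho>) \<zeta>"
proof -
  have "(\<lambda>y. hinner (fib \<H> (\<rho> y)) (\<zeta> y) (fund \<H> n (\<rho> y))) \<in> borel_measurable Y" for n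
  proof -
    have "(\<lambda>y. hinner (fib \<H> (\<pi> y)) (\<zeta> y) (fund \<H> n (\<pi> y))) \<in> borel_measurable Y"
      using assms(1) by (simp add: borel_section_def)
    then show ?thesis by (rule iffD1[OF measurable_cong, rotated]) (use assms(2) in simp)
  qed
  moreover have "\<zeta> y \<in> hcar (fib \<H> (\<rho> y))" if "y \<in> space Y" for y
  proof -
    have "\<zeta> y \<in> hcar (fib \<H> (\<pi> y))" using assms(1) that by (simp add: borel_section_def)
    then show ?thesis using assms(2)[OF that] by simp
  qed
  ultimately show ?thesis by (simp add: borel_section_def)
qed

text \<open>A representation has Borel coefficients, by definition, only for sections over the units
  evaluated at source and range. Sections over \<open>Y\<close> are approximated by rational
  sections with measurable indices: each fixed pair of indices falls under the definition, countably
  many pieces are glued, and since \<open>L\<close> is isometric the coefficients converge.\<close>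

lemma (in borel_gpd) coefficient_measurable:
  assumes L: "representation G C \<H> L" and \<theta>: "\<theta> \<in> Y \<rightarrow>\<^sub>M borel_of G"
    and \<zeta>: "borel_section Y (pullback \<H> (\<lambda>y. src G (\<theta> y))) \<zeta>"
    and \<omega>: "borel_section Y (pullback \<H> (\<lambda>y. rng G (\<theta> y))) \<omega>"
  shows "(\<lambda>y. hinner (fib \<H> (rng G (\<theta> y))) (L (\<theta> y) (\<zeta> y)) (\<omega> y)) \<in> borel_measurable Y"
proof -
  let ?s = "\<lambda>y. src G (\<theta> y)" and ?r = "\<lambda>y. rng G (\<theta> y)"
  have H: "is_hilbert_bundle (unit_space G) \<H>" using L by (simp add: representation_def)
  have sm: "?s \<in> Y \<rightarrow>\<^sub>M unit_space G" and rm: "?r \<in> Y \<rightarrow>\<^sub>M unit_space G"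
    using measurable_compose[OF \<theta> src_unit_space] measurable_compose[OF \<theta> rng_unit_space] .
  interpret H: borel_hilbert_bundle "unit_space G" \<H> by (rule borel_hilbert_bundle.intro[OF H])
  interpret S: borel_hilbert_bundle Y "pullback \<H> ?s" by (rule borel_hilbert_bundle.intro[OF hilbert_bundle_pullback[OF H sm]])
  interpret R: borel_hilbert_bundle Y "pullback \<H> ?r" by (rule borel_hilbert_bundle.intro[OF hilbert_bundle_pullback[OF H rm]])
  obtain i where i: "\<And>k. i k \<in> Y \<rightarrow>\<^sub>M count_space UNIV"
    "\<And>k y. y \<in> space Y \<Longrightarrow> hdist (fib \<H> (?s y)) (\<zeta> y) (rational_section \<H> (from_nat (i k y)) (?s y)) < inverse (real (Suc k))"
    using S.approximating_index[OF \<zeta>] by auto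
  obtain j where j: "\<And>k. j k \<in> Y \<rightarrow>\<^sub>M count_space UNIV"
    "\<And>k y. y \<in> space Y \<Longrightarrow> hdist (fib \<H> (?r y)) (\<omega> y) (rational_section \<H> (from_nat (j k y)) (?r y)) < inverse (real (Suc k))"
    using R.approximating_index[OF \<omega>] by auto
  define F where "F k y = hinner (fib \<H> (?r y)) (L (\<theta> y) (rational_section \<H> (from_nat (i k y)) (?s y)))
    (rational_section \<H> (from_nat (j k y)) (?r y))" for k y
  show ?thesis
  proof (rule borel_measurable_LIMSEQ_metric)
    fix k
    have base: "(\<lambda>y. hinner (fib \<H> (?r y)) (L (\<theta> y) (rational_section \<H> (from_nat m) (?s y)))
        (rational_section \<H> (from_nat n) (?r y))) \<in> borel_measurable Y" for m n
    proof (rule measurable_compose[OF \<theta>])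
      show "(\<lambda>\<gamma>. hinner (fib \<H> (rng G \<gamma>)) (L \<gamma> (rational_section \<H> (from_nat m) (src G \<gamma>)))
          (rational_section \<H> (from_nat n) (rng G \<gamma>))) \<in> borel_measurable (borel_of G)"
        using L H.borel_rational_section by (simp add: representation_def)
    qed
    have "(\<lambda>y. hinner (fib \<H> (?r y)) (L (\<theta> y) (rational_section \<H> (from_nat m) (?s y)))
        (rational_section \<H> (from_nat (j k y)) (?r y))) \<in> borel_measurable Y" for m
      by (rule measurable_compose_countable[OF base j(1)])
    from measurable_compose_countable[OF this i(1)]
    show "F k \<in> borel_measurable Y" unfolding F_def .
  next
    fix y assume y: "y \<in> space Y"
    have iso: "hilbert_isomorphism (fib \<H> (?s y)) (fib \<H> (?r y)) (L (\<theta> y))"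
      using L measurable_space[OF \<theta> y] by (simp add: representation_def)
    interpret pre_hilbert "fib \<H> (?r y)" using R.pre_hilbert_fibre[OF y] by simp
    have z: "\<zeta> y \<in> hcar (fib \<H> (?s y))" "\<omega> y \<in> hcar (fib \<H> (?r y))"
      using \<zeta> \<omega> y by (simp_all add: borel_section_def)
    have w: "rational_section \<H> l (?s y) \<in> hcar (fib \<H> (?s y))" "rational_section \<H> l (?r y) \<in> hcar (fib \<H> (?r y))" for l
      using S.rational_section_closed[OF y, of l] R.rational_section_closed[OF y, of l] by simp_all
    have null: "(\<lambda>k. inverse (real (Suc k))) \<longlonglongrightarrow> 0" by (rule LIMSEQ_inverse_real_of_nat)
    have d: "hdist (fib \<H> (?r y)) (L (\<theta> y) (\<zeta> y)) (L (\<theta> y) (rational_section \<H> l (?s y)))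
        = hdist (fib \<H> (?s y)) (\<zeta> y) (rational_section \<H> l (?s y))" for l
      by (rule hilbert_isomorphism_dist[OF _ _ iso z(1) w(1)]) (use S.fibre[OF y] R.fibre[OF y] in simp_all)
    have Lz: "L (\<theta> y) (\<zeta> y) \<in> hcar (fib \<H> (?r y))" "\<And>l. L (\<theta> y) (rational_section \<H> l (?s y)) \<in> hcar (fib \<H> (?r y))"
      using hilbert_isomorphism_closed[OF iso] z w by auto
    show "(\<lambda>k. F k y) \<longlonglongrightarrow> hinner (fib \<H> (?r y)) (L (\<theta> y) (\<zeta> y)) (\<omega> y)"
      unfolding F_def
    proof (rule tendsto_inner[OF Lz _ z(2) w(2)])
      show "(\<lambda>k. hdist (fib \<H> (?r y)) (L (\<theta> y) (\<zeta> y)) (L (\<theta> y) (rational_section \<H> (from_nat (i k y)) (?s y)))) \<longlonglongrightarrow> 0"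
        unfolding d
        by (rule tendsto_sandwich[OF always_eventually always_eventually tendsto_const null])
          (use pre_hilbert.dist_nonneg[OF S.pre_hilbert_fibre[OF y]] z w i(2)[OF y] in \<open>auto intro: less_imp_le\<close>)
      show "(\<lambda>k. hdist (fib \<H> (?r y)) (\<omega> y) (rational_section \<H> (from_nat (j k y)) (?r y))) \<longlonglongrightarrow> 0"
        by (rule tendsto_sandwich[OF always_eventually always_eventually tendsto_const null])
          (use dist_nonneg z w j(2)[OF y] in \<open>auto intro: less_imp_le\<close>)
    qed
  qed
qed

section \<open>Transfer of property T\<close>

context measured_gpd_pair
begin

lemma extension_units:
  assumes \<Phi>: "\<Phi> \<in> borel_of G1 \<rightarrow>\<^sub>M borel_of G2"
    and hom: "\<And>\<gamma>. \<gamma> \<in> arrows G1 \<Longrightarrow> rng G2 (\<Phi> \<gamma>) = \<Phi> (rng G1 \<gamma>) \<and> src G2 (\<Phi> \<gamma>) = \<Phi> (src G1 \<gamma>)"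
  shows "\<Phi> \<in> unit_space G1 \<rightarrow>\<^sub>M unit_space G2"
proof (rule B.measurable_unit_spaceI[OF A.measurable_unit_spaceD[OF \<Phi>]])
  fix x assume "x \<in> space (unit_space G1)"
  then have x: "x \<in> units G1" "x \<in> arrows G1" using A.units_arrows by auto
  then have "\<Phi> x \<in> arrows G2" "rng G2 (\<Phi> x) = \<Phi> x" using measurable_space[OF \<Phi>] hom by auto
  then show "\<Phi> x \<in> units G2" using B.rng_in_units by metis
qed

text \<open>That every \<open>L (\<Phi> \<gamma>)\<close> joins the right fibres comes from
  compatibility of \<open>\<Phi>\<close> with range and source. Multiplicativity comes from
  \<open>\<phi>\<close> and is claimed only on a reduction where the two maps agree and
  \<open>\<phi>\<close> takes values where \<open>L\<close> is multiplicative.\<close>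

lemma pullback_representation:
  assumes L: "representation G2 C2 \<H> L"
    and \<Phi>: "\<Phi> \<in> borel_of G1 \<rightarrow>\<^sub>M borel_of G2"
    and hom: "\<And>\<gamma>. \<gamma> \<in> arrows G1 \<Longrightarrow> rng G2 (\<Phi> \<gamma>) = \<Phi> (rng G1 \<gamma>) \<and> src G2 (\<Phi> \<gamma>) = \<Phi> (src G1 \<gamma>)"
    and s: "strict_on_reduction G1 C1 U0 G2 C2 \<phi>" and U: "conull_units G1 C1 U" "U \<subseteq> U0"
    and eq: "\<And>\<gamma>. \<gamma> \<in> reduced_arrows G1 U \<Longrightarrow> \<Phi> \<gamma> = \<phi> \<gamma>"
  shows "representation G1 C1 (pullback \<H> \<Phi>) (\<lambda>\<gamma>. L (\<Phi> \<gamma>))"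
proof -
  have \<Phi>u: "\<Phi> \<in> unit_space G1 \<rightarrow>\<^sub>M unit_space G2" by (rule extension_units[OF \<Phi> hom])
  have H: "is_hilbert_bundle (unit_space G2) \<H>" using L by (simp add: representation_def)
  have \<Phi>a: "\<Phi> \<gamma> \<in> arrows G2" if "\<gamma> \<in> arrows G1" for \<gamma> using measurable_space[OF \<Phi>] that by simp
  obtain W where W: "conull_units G2 C2 W"
    "\<And>\<gamma> \<eta> v. (\<gamma>, \<eta>) \<in> composable (reduction G2 W) \<Longrightarrow> v \<in> hcar (fib \<H> (src G2 \<eta>)) \<Longrightarrow>
      L (mul G2 \<gamma> \<eta>) v = L \<gamma> (L \<eta> v)"
    using L unfolding representation_def by blast
  define U' where "U' = {x \<in> U0. \<phi> x \<in> W} \<inter> U"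
  have U': "conull_units G1 C1 U'" unfolding U'_def by (rule A.conull_Int[OF strict_conull[OF s W(1)] U(1)])
  show ?thesis
    unfolding representation_def
  proof (intro conjI ballI allI impI exI[of _ U'])
    show "is_hilbert_bundle (unit_space G1) (pullback \<H> \<Phi>)" by (rule hilbert_bundle_pullback[OF H \<Phi>u])
    show "hilbert_isomorphism (fib (pullback \<H> \<Phi>) (src G1 \<gamma>)) (fib (pullback \<H> \<Phi>) (rng G1 \<gamma>)) (L (\<Phi> \<gamma>))"
      if "\<gamma> \<in> arrows G1" for \<gamma>
    proof -
      have "hilbert_isomorphism (fib \<H> (src G2 (\<Phi> \<gamma>))) (fib \<H> (rng G2 (\<Phi> \<gamma>))) (L (\<Phi> \<gamma>))"
        using L \<Phi>a[OF that] by (simp add: representation_def)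
      then show ?thesis using hom[OF that] by simp
    qed
    show "conull_units G1 C1 U'" by (rule U')
  next
    fix \<xi> \<eta>
    assume \<xi>: "borel_section (unit_space G1) (pullback \<H> \<Phi>) \<xi>"
      and \<eta>: "borel_section (unit_space G1) (pullback \<H> \<Phi>) \<eta>"
    have "borel_section (borel_of G1) (pullback (pullback \<H> \<Phi>) (src G1)) (\<lambda>\<gamma>. \<xi> (src G1 \<gamma>))"
      by (rule borel_section_pullback[OF \<xi> A.src_unit_space])
    then have 1: "borel_section (borel_of G1) (pullback \<H> (\<lambda>\<gamma>. src G2 (\<Phi> \<gamma>))) (\<lambda>\<gamma>. \<xi> (src G1 \<gamma>))"
      unfolding pullback_pullback by (rule borel_section_pullback_cong) (use hom in simp)
    have "borel_section (borel_of G1) (pullback (pullback \<H> \<Phi>) (rng G1)) (\<lambda>\<gamma>. \<eta> (rng G1 \<gamma>))"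
      by (rule borel_section_pullback[OF \<eta> A.rng_unit_space])
    then have 2: "borel_section (borel_of G1) (pullback \<H> (\<lambda>\<gamma>. rng G2 (\<Phi> \<gamma>))) (\<lambda>\<gamma>. \<eta> (rng G1 \<gamma>))"
      unfolding pullback_pullback by (rule borel_section_pullback_cong) (use hom in simp)
    show "(\<lambda>\<gamma>. hinner (fib (pullback \<H> \<Phi>) (rng G1 \<gamma>)) (L (\<Phi> \<gamma>) (\<xi> (src G1 \<gamma>))) (\<eta> (rng G1 \<gamma>)))
        \<in> borel_measurable (borel_of G1)"
      by (rule iffD1[OF measurable_cong B.coefficient_measurable[OF L \<Phi> 1 2]]) (use hom in simp)
  next
    fix p assume "p \<in> composable (reduction G1 U')"
    then obtain \<gamma> \<eta> where p: "p = (\<gamma>, \<eta>)" and r: "\<gamma> \<in> reduced_arrows G1 U'" "\<eta> \<in> reduced_arrows G1 U'"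
      and sr: "src G1 \<gamma> = rng G1 \<eta>" by (auto simp: composable_def)
    have U0: "\<zeta> \<in> reduced_arrows G1 U \<and> \<zeta> \<in> reduced_arrows G1 U0" if "\<zeta> \<in> reduced_arrows G1 U'" for \<zeta>
      using that U(2) by (auto simp: reduced_arrows_def U'_def)
    have m: "mul G1 \<gamma> \<eta> \<in> reduced_arrows G1 U"
      using r sr A.mul_closed[of \<gamma> \<eta>] by (auto simp: reduced_arrows_def U'_def)
    have red: "\<phi> \<zeta> \<in> reduced_arrows G2 W" if "\<zeta> \<in> reduced_arrows G1 U'" for \<zeta>
      using strict_rng_src[OF s, of \<zeta>] U0[OF that] that by (auto simp: reduced_arrows_def U'_def)
    have "(\<phi> \<gamma>, \<phi> \<eta>) \<in> composable G2" "\<phi> (mul G1 \<gamma> \<eta>) = mul G2 (\<phi> \<gamma>) (\<phi> \<eta>)"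
      using strict_mul[OF s _ _ sr] U0 r by blast+
    moreover have "src G2 (\<phi> \<eta>) = \<Phi> (src G1 \<eta>)"
      using hom[of \<eta>] eq[of \<eta>] U0[OF r(2)] by (simp add: reduced_arrows_def)
    ultimately have "L (\<Phi> (mul G1 \<gamma> \<eta>)) v = L (\<Phi> \<gamma>) (L (\<Phi> \<eta>) v)" if "v \<in> hcar (fib \<H> (\<Phi> (src G1 \<eta>)))" for v
      using W(2)[of "\<phi> \<gamma>" "\<phi> \<eta>" v] red[OF r(1)] red[OF r(2)] that eq[OF m] eq U0 r
      by (simp add: composable_def)
    then show "case p of (\<gamma>1, \<gamma>2) \<Rightarrow> \<forall>v\<in>hcar (fib (pullback \<H> \<Phi>) (src G1 \<gamma>2)).
        L (\<Phi> (mul G1 \<gamma>1 \<gamma>2)) v = L (\<Phi> \<gamma>1) (L (\<Phi> \<gamma>2) v)"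
      by (simp add: p)
  qed
qed

lemma property_T_transfer:
  assumes rd1: "r_discrete G1 C1" and rd2: "r_discrete G2 C2"
    and hom_\<phi>: "homomorphism G1 C1 G2 C2 \<phi>" and hom_\<psi>: "homomorphism G2 C2 G1 C1 \<psi>"
    and sim: "similar_homomorphisms G2 C2 G2 C2 (\<phi> \<circ> \<psi>) id"
    and T: "property_T G1 C1"
  shows "property_T G2 C2"
  unfolding property_T_def
proof (intro allI impI)
  fix \<H> L assume L: "representation G2 C2 \<H> L"
    and almost: "almost_contains_unit_invariant_sections G2 C2 \<H> L"
  interpret BA: measured_gpd_pair G2 C2 \<nu>2 K2 V2 G1 C1 \<nu>1 K1 V1 by unfold_locales
  interpret BB: measured_gpd_pair G2 C2 \<nu>2 K2 V2 G2 C2 \<nu>2 K2 V2 by unfold_locales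
  have H: "is_hilbert_bundle (unit_space G2) \<H>" using L by (simp add: representation_def)
  interpret H: borel_hilbert_bundle "unit_space G2" \<H> by (rule borel_hilbert_bundle.intro[OF H])
  obtain U0 where \<phi>: "\<phi> \<in> borel_of G1 \<rightarrow>\<^sub>M borel_of G2" "strict_on_reduction G1 C1 U0 G2 C2 \<phi>"
    using hom_\<phi> unfolding homomorphism_def by blast
  obtain U \<Phi> where U: "conull_units G1 C1 U" "U \<subseteq> U0" and \<Phi>: "\<Phi> \<in> borel_of G1 \<rightarrow>\<^sub>M borel_of G2"
    and \<Phi>_hom: "\<And>\<gamma>. \<gamma> \<in> arrows G1 \<Longrightarrow> rng G2 (\<Phi> \<gamma>) = \<Phi> (rng G1 \<gamma>) \<and> src G2 (\<Phi> \<gamma>) = \<Phi> (src G1 \<gamma>)"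
    and \<Phi>_eq: "\<And>\<gamma>. \<gamma> \<in> reduced_arrows G1 U \<Longrightarrow> \<Phi> \<gamma> = \<phi> \<gamma>"
    using homomorphism_extension[OF rd1 \<phi>] by blast
  have \<Phi>u: "\<Phi> \<in> unit_space G1 \<rightarrow>\<^sub>M unit_space G2" by (rule extension_units[OF \<Phi> \<Phi>_hom])
  have \<Phi>_unit: "\<Phi> x = \<phi> x" if "x \<in> U" for x
    using \<Phi>_eq[of x] that A.conull_subset[OF U(1)] A.units_arrows by (auto simp: reduced_arrows_def)
  let ?H = "pullback \<H> \<Phi>" and ?L = "\<lambda>\<gamma>. L (\<Phi> \<gamma>)"
  have L1: "representation G1 C1 ?H ?L" by (rule pullback_representation[OF L \<Phi> \<Phi>_hom \<phi>(2) U \<Phi>_eq])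
  have pull: "conull_units G1 C1 ({x \<in> U0. \<phi> x \<in> W} \<inter> U)" if "conull_units G2 C2 W" for W
    by (rule A.conull_Int[OF strict_conull[OF \<phi>(2) that] U(1)])
  obtain \<xi> where \<xi>: "\<And>n. unit_section G2 C2 \<H> (\<xi> n)"
    and conv: "ae_class C2 (\<lambda>\<gamma>. (\<lambda>n. hnorm (fib \<H> (rng G2 \<gamma>))
       (hminus (fib \<H> (rng G2 \<gamma>)) (\<xi> n (rng G2 \<gamma>)) (L \<gamma> (\<xi> n (src G2 \<gamma>))))) \<longlonglongrightarrow> 0)"
    using almost unfolding almost_contains_unit_invariant_sections_def by blast
  have "almost_contains_unit_invariant_sections G1 C1 ?H ?L"
    unfolding almost_contains_unit_invariant_sections_def
  proof (intro exI[of _ "\<lambda>n x. \<xi> n (\<Phi> x)"] conjI allI)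
    fix n
    have "borel_section (unit_space G2) \<H> (\<xi> n)" using \<xi> by (simp add: unit_section_def)
    from borel_section_pullback[OF this \<Phi>u]
    have b: "borel_section (unit_space G1) ?H (\<lambda>x. \<xi> n (\<Phi> x))" .
    have "ae_class (range_class G2 C2) (\<lambda>x. hnorm (fib \<H> x) (\<xi> n x) = 1)"
      using \<xi> by (simp add: unit_section_def)
    then obtain W where W: "conull_units G2 C2 W" "\<forall>x\<in>W. hnorm (fib \<H> x) (\<xi> n x) = 1"
      unfolding B.ae_range_class_conull by blast
    have "\<forall>x\<in>{x \<in> U0. \<phi> x \<in> W} \<inter> U. hnorm (fib ?H x) (\<xi> n (\<Phi> x)) = 1"
      using W(2) \<Phi>_unit by auto
    then have "ae_class (range_class G1 C1) (\<lambda>x. hnorm (fib ?H x) (\<xi> n (\<Phi> x)) = 1)"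
      unfolding A.ae_range_class_conull using pull[OF W(1)] by blast
    then show "unit_section G1 C1 ?H (\<lambda>x. \<xi> n (\<Phi> x))" using b by (simp add: unit_section_def)
  next
    \<comment> \<open>Convergence is needed at every arrow of a reduction: strictness alone does not
      prevent \<open>\<Phi>\<close> from sending many arrows into a null set of exceptions.\<close>
    obtain W where W: "conull_units G2 C2 W"
      "\<forall>\<gamma>\<in>reduced_arrows G2 W. (\<lambda>n. hnorm (fib \<H> (rng G2 \<gamma>))
         (hminus (fib \<H> (rng G2 \<gamma>)) (\<xi> n (rng G2 \<gamma>)) (L \<gamma> (\<xi> n (src G2 \<gamma>))))) \<longlonglongrightarrow> 0"
      using B.ae_class_conull[OF rd2 conv] by blast
    show "ae_class C1 (\<lambda>\<gamma>. (\<lambda>n. hnorm (fib ?H (rng G1 \<gamma>))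
       (hminus (fib ?H (rng G1 \<gamma>)) (\<xi> n (\<Phi> (rng G1 \<gamma>))) (L (\<Phi> \<gamma>) (\<xi> n (\<Phi> (src G1 \<gamma>)))))) \<longlonglongrightarrow> 0)"
    proof (rule A.ae_class_reduced[OF pull[OF W(1)]])
      fix \<gamma> assume \<gamma>: "\<gamma> \<in> reduced_arrows G1 ({x \<in> U0. \<phi> x \<in> W} \<inter> U)"
      then have g: "\<gamma> \<in> arrows G1" "rng G1 \<gamma> \<in> U" "src G1 \<gamma> \<in> U" "\<phi> (rng G1 \<gamma>) \<in> W" "\<phi> (src G1 \<gamma>) \<in> W"
        by (auto simp: reduced_arrows_def)
      have "\<Phi> \<gamma> \<in> reduced_arrows G2 W"
        using g \<Phi>_unit \<Phi>_hom[OF g(1)] measurable_space[OF \<Phi>, of \<gamma>] by (simp add: reduced_arrows_def)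
      from W(2)[rule_format, OF this]
      show "(\<lambda>n. hnorm (fib ?H (rng G1 \<gamma>))
         (hminus (fib ?H (rng G1 \<gamma>)) (\<xi> n (\<Phi> (rng G1 \<gamma>))) (L (\<Phi> \<gamma>) (\<xi> n (\<Phi> (src G1 \<gamma>)))))) \<longlonglongrightarrow> 0"
        using \<Phi>_hom[OF g(1)] by simp
    qed
  qed
  then have "contains_unit_invariant_section G1 C1 ?H ?L" using T L1 unfolding property_T_def by blast
  then obtain \<eta> where \<eta>: "unit_section G1 C1 ?H \<eta>"
    and \<eta>_inv: "ae_class C1 (\<lambda>\<gamma>. \<eta> (rng G1 \<gamma>) = L (\<Phi> \<gamma>) (\<eta> (src G1 \<gamma>)))"
    unfolding contains_unit_invariant_section_def by blast
  have \<eta>b: "borel_section (unit_space G1) ?H \<eta>" using \<eta> by (simp add: unit_section_def)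
  obtain W1 where W1: "conull_units G1 C1 W1"
    "\<And>\<gamma>. \<gamma> \<in> reduced_arrows G1 W1 \<Longrightarrow> \<eta> (rng G1 \<gamma>) = L (\<Phi> \<gamma>) (\<eta> (src G1 \<gamma>))"
    using A.ae_class_conull[OF rd1 \<eta>_inv] by blast
  have "ae_class (range_class G1 C1) (\<lambda>x. hnorm (fib ?H x) (\<eta> x) = 1)" using \<eta> by (simp add: unit_section_def)
  then obtain W2 where W2: "conull_units G1 C1 W2" "\<forall>x\<in>W2. hnorm (fib ?H x) (\<eta> x) = 1"
    unfolding A.ae_range_class_conull by blast
  \<comment> \<open>On the reduction to \<open>W\<close>, \<open>\<eta>\<close> is invariant at
    every arrow and of norm one, and \<open>\<Phi>\<close> coincides with
    \<open>\<phi>\<close>.\<close>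
  define W where "W = W1 \<inter> (W2 \<inter> U)"
  have W: "conull_units G1 C1 W" unfolding W_def by (intro A.conull_Int W1(1) W2(1) U(1))
  obtain U\<psi> where \<psi>: "\<psi> \<in> borel_of G2 \<rightarrow>\<^sub>M borel_of G1" "strict_on_reduction G2 C2 U\<psi> G1 C1 \<psi>"
    using hom_\<psi> unfolding homomorphism_def by blast
  obtain S \<theta> where S: "strict_on_reduction G2 C2 S G2 C2 (\<phi> \<circ> \<psi>)"
    and \<theta>: "\<theta> \<in> restrict_space (borel_of G2) S \<rightarrow>\<^sub>M borel_of G2"
    and sim_eq: "\<And>\<gamma>. \<gamma> \<in> reduced_arrows G2 S \<Longrightarrow>
      (\<theta> (rng G2 \<gamma>), \<phi> (\<psi> \<gamma>)) \<in> composable G2 \<and> (\<gamma>, \<theta> (src G2 \<gamma>)) \<in> composable G2 \<and>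
      mul G2 (\<theta> (rng G2 \<gamma>)) (\<phi> (\<psi> \<gamma>)) = mul G2 \<gamma> (\<theta> (src G2 \<gamma>))"
    using sim unfolding similar_homomorphisms_def by auto
  have Sc: "conull_units G2 C2 S" using S by (simp add: strict_on_reduction_def)
  obtain UL where UL: "conull_units G2 C2 UL"
    "\<And>\<gamma> \<eta> v. (\<gamma>, \<eta>) \<in> composable (reduction G2 UL) \<Longrightarrow> v \<in> hcar (fib \<H> (src G2 \<eta>)) \<Longrightarrow>
      L (mul G2 \<gamma> \<eta>) v = L \<gamma> (L \<eta> v)"
    using L unfolding representation_def by blast
  \<comment> \<open>Chosen so that all the arrows \<open>\<gamma>\<close>, \<open>\<theta> y\<close>
    and \<open>\<phi> (\<psi> \<gamma>)\<close> of the final computation lie in the reduction to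
    \<open>UL\<close>, and \<open>\<psi> \<gamma>\<close> lies in the reduction to
    \<open>W\<close>.\<close>
  define D where "D = {y \<in> U\<psi>. \<psi> y \<in> W} \<inter> ({y \<in> S. (\<phi> \<circ> \<psi>) y \<in> UL} \<inter> UL)"
  have D: "conull_units G2 C2 D"
    unfolding D_def
    by (intro B.conull_Int BA.strict_conull[OF \<psi>(2) W] BB.strict_conull[OF S UL(1)] UL(1))
  have Du: "D \<subseteq> units G2" using B.conull_subset[OF D] .
  have Ds: "D \<in> sets (unit_space G2)" using D by (simp add: B.conull_units_iff)
  have D_S: "y \<in> S" and D_UL: "y \<in> UL" and D_comp: "\<phi> (\<psi> y) \<in> UL" and D_W: "\<psi> y \<in> W" and D_\<psi>: "y \<in> U\<psi>"
    if "y \<in> D" for y using that by (auto simp: D_def)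
  have \<psi>_unit: "\<psi> y \<in> units G1" if "y \<in> D" for y using BA.strict_unit[OF \<psi>(2) D_\<psi>[OF that]] .
  have \<theta>D: "\<theta> y \<in> arrows G2" "rng G2 (\<theta> y) = y" "src G2 (\<theta> y) = \<phi> (\<psi> y)" if y: "y \<in> D" for y
  proof -
    have yu: "y \<in> units G2" "y \<in> arrows G2" using y Du B.units_arrows by auto
    have "y \<in> reduced_arrows G2 S" using D_S[OF y] yu by (simp add: reduced_arrows_def)
    from sim_eq[OF this] yu
    have c: "(\<theta> y, \<phi> (\<psi> y)) \<in> composable G2" "(y, \<theta> y) \<in> composable G2" by simp_all
    then show "\<theta> y \<in> arrows G2" "rng G2 (\<theta> y) = y" using yu by (simp_all add: composable_def)
    have "\<phi> (\<psi> y) \<in> units G2" using BB.strict_unit[OF S D_S[OF y]] by simp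
    then show "src G2 (\<theta> y) = \<phi> (\<psi> y)" using c by (simp add: composable_def)
  qed
  have \<Phi>\<psi>: "\<Phi> (\<psi> y) = \<phi> (\<psi> y)" if "y \<in> D" for y using \<Phi>_unit D_W[OF that] by (simp add: W_def)
  have \<eta>_closed: "\<eta> (\<psi> y) \<in> hcar (fib \<H> (\<phi> (\<psi> y)))" if "y \<in> D" for y
  proof -
    have "\<eta> (\<psi> y) \<in> hcar (fib \<H> (\<Phi> (\<psi> y)))" using \<eta>b \<psi>_unit[OF that] by (simp add: borel_section_def)
    then show ?thesis using \<Phi>\<psi>[OF that] by simp
  qed
  have iso: "hilbert_isomorphism (fib \<H> (\<phi> (\<psi> y))) (fib \<H> y) (L (\<theta> y))" if "y \<in> D" for y
    using L \<theta>D[OF that] unfolding representation_def by metis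
  \<comment> \<open>Off the conull set \<open>D\<close> the value is irrelevant almost everywhere;
    zero exists in every fibre and keeps the section Borel.\<close>
  define \<kappa> where "\<kappa> y = (if y \<in> D then L (\<theta> y) (\<eta> (\<psi> y)) else hzero (fib \<H> y))" for y
  have "borel_section (unit_space G2) \<H> \<kappa>"
    unfolding borel_section_def
  proof (intro conjI ballI allI)
    fix y assume y: "y \<in> space (unit_space G2)"
    interpret pre_hilbert "fib \<H> y" by (rule H.pre_hilbert_fibre[OF y])
    show "\<kappa> y \<in> hcar (fib \<H> y)"
      using hilbert_isomorphism_closed[OF iso \<eta>_closed] by (simp add: \<kappa>_def)
  next
    fix n
    \<comment> \<open>\<open>\<theta>\<close> is Borel on \<open>S\<close> only, so measurability is
      checked on \<open>D\<close> and then extended by zero.\<close>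
    let ?Y = "restrict_space (unit_space G2) {y. y \<in> D}"
    have sY: "y \<in> space ?Y \<longleftrightarrow> y \<in> D" for y using Du by (auto simp: space_restrict_space)
    have \<theta>Y: "\<theta> \<in> ?Y \<rightarrow>\<^sub>M borel_of G2"
    proof -
      have "\<theta> \<in> restrict_space (restrict_space (borel_of G2) S) D \<rightarrow>\<^sub>M borel_of G2"
        by (rule measurable_restrict_space1[OF \<theta>])
      moreover have "sets (restrict_space (restrict_space (borel_of G2) S) D) = sets ?Y"
      proof -
        have "S \<inter> D = D" "units G2 \<inter> D = D" using D_S Du by auto
        then show ?thesis
          using B.conull_sets[OF Sc] B.conull_sets[OF D] B.units_measurable
          by (simp add: unit_space_def restrict_restrict_space)
      qed
      ultimately show ?thesis by (simp cong: measurable_cong_sets)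
    qed
    have \<psi>Y: "\<psi> \<in> ?Y \<rightarrow>\<^sub>M unit_space G1"
      by (rule A.measurable_unit_spaceI[OF measurable_restrict_space1[OF B.measurable_unit_spaceD[OF \<psi>(1)]]])
        (use sY \<psi>_unit in blast)
    have "borel_section ?Y (pullback ?H \<psi>) (\<lambda>y. \<eta> (\<psi> y))" by (rule borel_section_pullback[OF \<eta>b \<psi>Y])
    then have 1: "borel_section ?Y (pullback \<H> (\<lambda>y. src G2 (\<theta> y))) (\<lambda>y. \<eta> (\<psi> y))"
      unfolding pullback_pullback by (rule borel_section_pullback_cong) (use sY \<theta>D \<Phi>\<psi> in simp)
    have "borel_section (unit_space G2) \<H> (fund \<H> n)"
      by (simp add: borel_section_def H.fund_closed H.fund_measurable)
    from borel_section_pullback[OF this measurable_restrict_space1[OF measurable_ident_sets[OF refl]]]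
    have "borel_section ?Y (pullback \<H> (\<lambda>y. y)) (fund \<H> n)" by simp
    then have 2: "borel_section ?Y (pullback \<H> (\<lambda>y. rng G2 (\<theta> y))) (fund \<H> n)"
      by (rule borel_section_pullback_cong) (use sY \<theta>D in simp)
    have 3: "(\<lambda>y. hinner (fib \<H> y) (L (\<theta> y) (\<eta> (\<psi> y))) (fund \<H> n y)) \<in> borel_measurable ?Y"
    proof (rule iffD1[OF measurable_cong B.coefficient_measurable[OF L \<theta>Y 1 2]])
      fix y assume "y \<in> space ?Y"
      then show "hinner (fib \<H> (rng G2 (\<theta> y))) (L (\<theta> y) (\<eta> (\<psi> y))) (fund \<H> n y)
          = hinner (fib \<H> y) (L (\<theta> y) (\<eta> (\<psi> y))) (fund \<H> n y)"
        using sY[of y] \<theta>D(2)[of y] by simp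
    qed
    have "{y \<in> space (unit_space G2). y \<in> D} \<in> sets (unit_space G2)"
      using sets.Int[OF sets.top Ds] by (simp only: Int_def)
    from measurable_If_restrict_space_iff[OF this,
        of "\<lambda>y. hinner (fib \<H> y) (L (\<theta> y) (\<eta> (\<psi> y))) (fund \<H> n y)" "\<lambda>y. 0" borel] 3
    have "(\<lambda>y. if y \<in> D then hinner (fib \<H> y) (L (\<theta> y) (\<eta> (\<psi> y))) (fund \<H> n y) else 0)
        \<in> borel_measurable (unit_space G2)" by simp
    moreover have "hinner (fib \<H> y) (\<kappa> y) (fund \<H> n y)
        = (if y \<in> D then hinner (fib \<H> y) (L (\<theta> y) (\<eta> (\<psi> y))) (fund \<H> n y) else 0)"
      if "y \<in> space (unit_space G2)" for y
      using pre_hilbert.inner_zero_left[OF H.pre_hilbert_fibre[OF that] H.fund_closed[OF that]]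
      by (simp add: \<kappa>_def)
    ultimately show "(\<lambda>y. hinner (fib \<H> y) (\<kappa> y) (fund \<H> n y)) \<in> borel_measurable (unit_space G2)"
      by (subst measurable_cong) auto
  qed
  moreover have "hnorm (fib \<H> y) (\<kappa> y) = 1" if y: "y \<in> D" for y
  proof -
    have "hnorm (fib \<H> (\<Phi> (\<psi> y))) (\<eta> (\<psi> y)) = 1" using W2(2) D_W[OF y] by (simp add: W_def)
    then show ?thesis
      using hilbert_isomorphism_norm[OF iso[OF y] \<eta>_closed[OF y]] y \<Phi>\<psi>[OF y] by (simp add: \<kappa>_def)
  qed
  ultimately have unit: "unit_section G2 C2 \<H> \<kappa>"
    unfolding unit_section_def B.ae_range_class_conull using D by blast
  have "ae_class C2 (\<lambda>\<gamma>. \<kappa> (rng G2 \<gamma>) = L \<gamma> (\<kappa> (src G2 \<gamma>)))"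
  proof (rule B.ae_class_reduced[OF D])
    fix \<gamma> assume \<gamma>: "\<gamma> \<in> reduced_arrows G2 D"
    define r s where "r = rng G2 \<gamma>" and "s = src G2 \<gamma>"
    have g: "\<gamma> \<in> arrows G2" "r \<in> D" "s \<in> D" using \<gamma> by (auto simp: reduced_arrows_def r_def s_def)
    have gS: "\<gamma> \<in> reduced_arrows G2 S" and g\<psi>: "\<gamma> \<in> reduced_arrows G2 U\<psi>" and gL: "\<gamma> \<in> reduced_arrows G2 UL"
      using \<gamma> by (auto simp: reduced_arrows_def D_def)
    note \<psi>g = BA.strict_rng_src[OF \<psi>(2) g\<psi>, folded r_def s_def]
    have \<psi>W: "\<psi> \<gamma> \<in> reduced_arrows G1 W" using \<psi>g D_W g by (simp add: reduced_arrows_def)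
    then have "\<psi> \<gamma> \<in> reduced_arrows G1 W1" "\<psi> \<gamma> \<in> reduced_arrows G1 U" by (auto simp: reduced_arrows_def W_def)
    then have inv: "\<eta> (\<psi> r) = L (\<phi> (\<psi> \<gamma>)) (\<eta> (\<psi> s))" using W1(2)[of "\<psi> \<gamma>"] \<Phi>_eq[of "\<psi> \<gamma>"] \<psi>g by simp
    note \<phi>\<psi>g = BB.strict_rng_src[OF S gS, folded r_def s_def, simplified]
    have red: "\<theta> r \<in> reduced_arrows G2 UL" "\<theta> s \<in> reduced_arrows G2 UL" "\<phi> (\<psi> \<gamma>) \<in> reduced_arrows G2 UL"
      using \<theta>D[OF g(2)] \<theta>D[OF g(3)] D_UL D_comp g \<phi>\<psi>g by (simp_all add: reduced_arrows_def)
    have v: "\<eta> (\<psi> s) \<in> hcar (fib \<H> (\<phi> (\<psi> s)))" by (rule \<eta>_closed[OF g(3)])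
    \<comment> \<open>\<open>\<theta>\<close> acts as an intertwiner: multiplicativity merges two
      operators into one, the similarity rewrites the product of arrows, and multiplicativity splits
      the result so that \<open>L \<gamma>\<close> comes out in front.\<close>
    have "\<kappa> r = L (\<theta> r) (L (\<phi> (\<psi> \<gamma>)) (\<eta> (\<psi> s)))" using g inv by (simp add: \<kappa>_def)
    also have "\<dots> = L (mul G2 (\<theta> r) (\<phi> (\<psi> \<gamma>))) (\<eta> (\<psi> s))"
      by (rule UL(2)[symmetric]) (use red \<theta>D[OF g(2)] \<phi>\<psi>g v in \<open>simp_all add: composable_def\<close>)
    also have "mul G2 (\<theta> r) (\<phi> (\<psi> \<gamma>)) = mul G2 \<gamma> (\<theta> s)" using sim_eq[OF gS] by (simp add: r_def s_def)
    also have "L (mul G2 \<gamma> (\<theta> s)) (\<eta> (\<psi> s)) = L \<gamma> (L (\<theta> s) (\<eta> (\<psi> s)))"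
      by (rule UL(2)) (use red gL \<theta>D[OF g(3)] v in \<open>simp_all add: composable_def s_def\<close>)
    finally show "\<kappa> (rng G2 \<gamma>) = L \<gamma> (\<kappa> (src G2 \<gamma>))" using g by (simp add: \<kappa>_def r_def s_def)
  qed
  then show "contains_unit_invariant_section G2 C2 \<H> L"
    unfolding contains_unit_invariant_section_def using unit by blast
qed

end

theorem proposition5p1:
  fixes G1 :: "'a groupoid" and C1 :: "'a measure set"
    and G2 :: "'b groupoid" and C2 :: "'b measure set"
  assumes "measured_groupoid G1 C1" and "ergodic G1 C1" and "r_discrete G1 C1"
    and "measured_groupoid G2 C2" and "ergodic G2 C2" and "r_discrete G2 C2"
    and "similar_groupoids G1 C1 G2 C2"
  shows "property_T G1 C1 \<longleftrightarrow> property_T G2 C2"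
proof -
  obtain \<nu>1 K1 V1 where "measured_gpd G1 C1 \<nu>1 K1 V1" using assms(1) by (rule measured_gpdI)
  then interpret G1: measured_gpd G1 C1 \<nu>1 K1 V1 .
  obtain \<nu>2 K2 V2 where "measured_gpd G2 C2 \<nu>2 K2 V2" using assms(4) by (rule measured_gpdI)
  then interpret G2: measured_gpd G2 C2 \<nu>2 K2 V2 .
  interpret G12: measured_gpd_pair G1 C1 \<nu>1 K1 V1 G2 C2 \<nu>2 K2 V2 by unfold_locales
  interpret G21: measured_gpd_pair G2 C2 \<nu>2 K2 V2 G1 C1 \<nu>1 K1 V1 by unfold_locales
  obtain \<phi> \<psi> where "homomorphism G1 C1 G2 C2 \<phi>" "homomorphism G2 C2 G1 C1 \<psi>"
    "similar_homomorphisms G2 C2 G2 C2 (\<phi> \<circ> \<psi>) id" "similar_homomorphisms G1 C1 G1 C1 (\<psi> \<circ> \<phi>) id"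
    using assms(7) unfolding similar_groupoids_def by blast
  \<comment> \<open>The converse direction exchanges the two groupoids and uses the other
    similarity.\<close>
  then show ?thesis
    using G12.property_T_transfer[of \<phi> \<psi>] G21.property_T_transfer[of \<psi> \<phi>] assms(3,6) by blast
qed

end
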